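(* Let $\pi^X\propto\exp(-f)$ be a probability distribution on $\mathbb{R}^d$ satisfying the Poincaré inequality with constant $\alpha>0$ ($\alpha$-PI). For any $\eta>0$, any initial distribution $\rho_0^X$ and any integer $k\ge0$, the law $\rho_k^X$ of the $k$-th iterate of the proximal sampler with target $\pi^X$ and step size $\eta$ satisfies $$\chi^2_{\pi^X}(\rho_k^X)\le\frac{\chi^2_{\pi^X}(\rho_0^X)}{(1+\alpha\eta)^{2k}}.$$ Furthermore, for all $q\ge2$, $$R_{q,\pi^X}(\rho_k^X)\le\begin{cases}R_{q,\pi^X}(\rho_0^X)-\dfrac{2k\log(1+\alpha\eta)}{q}, & \text{if } k\le\dfrac{q}{2\log(1+\alpha\eta)}\,\bigl(R_{q,\pi^X}(\rho_0^X)-1\bigr),\\[2mm] \dfrac{1}{(1+\alpha\eta)^{2(k-k_0)/q}}, & \text{if } k\ge k_0:=\Bigl\lceil\dfrac{q}{2\log(1+\alpha\eta)}\,\bigl(R_{q,\pi^X}(\rho_0^X)-1\bigr)\Bigr\rceil.\end{cases}$$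
   Context: Probability measures are identified with their Lebesgue densities when these exist. The target $\pi^X\propto \exp(-f)$, $f:\mathbb{R}^d\to\mathbb{R}$, is assumed to have finite second moment. Proximal sampler with step size $\eta>0$: define the joint probability density on $\mathbb{R}^d\times\mathbb{R}^d$ by $\pi(x,y)\propto \exp(-f(x)-\frac{1}{2\eta}\|x-y\|^2)$. Its conditionals are $\pi^{Y\mid X}(\cdot\mid x)=\mathcal N(x,\eta I)$ and $\pi^{X\mid Y}(x\mid y)\propto_x \exp(-f(x)-\frac1{2\eta}\|x-y\|^2)$, and its $X$-marginal is $\pi^X$. Starting from $x_0\sim\rho_0^X$, for $k=0,1,2,\dots$: draw $y_k\mid x_k\sim\pi^{Y\mid X}(\cdot\mid x_k)$, then draw $x_{k+1}\mid y_k\sim \pi^{X\mid Y}(\cdot\mid y_k)$ (exactly). $\rho_k^X$ denotes the law of $x_k$. For $\rho\ll\pi$: chi-squared divergence $\chi^2_\pi(\rho)=\int\frac{\rho^2}{\pi}-1$; Rényi divergence of order $q>1$: $R_{q,\pi}(\rho)=\frac1{q-1}\log\int\frac{\rho^q}{\pi^{q-1}}$. (These are $+\infty$ if $\rho\not\ll\pi$.) Poincaré inequality: $\pi$ satisfies $\alpha$-PI if for any smooth bounded $\psi:\mathbb{R}^d\to\mathbb{R}$, $\operatorname{Var}_\pi(\psi)\le\frac1\alpha\,\mathbb{E}_\pi[\|\nabla\psi\|^2]$. *)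

theory Defs
  imports "HOL-Probability.Probability"
begin

text \<open>The distribution on \<open>\<real>\<^sup>d\<close> whose Lebesgue density is proportional to \<open>exp (- V)\<close>; meaningful when
  \<open>exp (- V)\<close> is integrable.\<close>

definition gibbs :: "('a::euclidean_space \<Rightarrow> real) \<Rightarrow> 'a measure" where
  "gibbs V = density lborel (\<lambda>x. ennreal (exp (- V x) / (\<integral>z. exp (- V z) \<partial>lborel)))"

text \<open>The Gaussian with mean \<open>m\<close> and covariance \<open>v I\<close> (\<open>v\<close> is the variance, not the standard
  deviation).\<close>

definition gaussian :: "'a::euclidean_space \<Rightarrow> real \<Rightarrow> 'a measure" where
  "gaussian m v = density lborel
     (\<lambda>y. ennreal (exp (- (norm (y - m))\<^sup>2 / (2 * v)) / sqrt (2 * pi * v) ^ DIM('a)))"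

text \<open>The two conditionals of the joint density \<open>\<pi>(x, y) \<propto> exp (- f x - \<parallel>x - y\<parallel>\<^sup>2 / (2 \<eta>))\<close>.\<close>

definition cond_Y_given_X :: "real \<Rightarrow> 'a::euclidean_space \<Rightarrow> 'a measure" where
  "cond_Y_given_X \<eta> x = gaussian x \<eta>"

definition cond_X_given_Y ::
    "('a::euclidean_space \<Rightarrow> real) \<Rightarrow> real \<Rightarrow> 'a \<Rightarrow> 'a measure" where
  "cond_X_given_Y f \<eta> y = gibbs (\<lambda>x. f x + (norm (x - y))\<^sup>2 / (2 * \<eta>))"

text \<open>The law of the \<open>k\<close>-th iterate \<open>x\<^sub>k\<close> started from \<open>x\<^sub>0 \<sim> \<rho>\<^sub>0\<close>.\<close>

primrec proximal_sampler ::
    "('a::euclidean_space \<Rightarrow> real) \<Rightarrow> real \<Rightarrow> 'a measure \<Rightarrow> nat \<Rightarrow> 'a measure" where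
  "proximal_sampler f \<eta> \<rho>\<^sub>0 0 = \<rho>\<^sub>0"
| "proximal_sampler f \<eta> \<rho>\<^sub>0 (Suc k) =
     bind (bind (proximal_sampler f \<eta> \<rho>\<^sub>0 k) (cond_Y_given_X \<eta>)) (cond_X_given_Y f \<eta>)"

text \<open>A real-valued Lebesgue density; only used for measures absolutely continuous with respect to
  \<open>lborel\<close>, where it is determined almost everywhere.\<close>

definition lebesgue_density :: "'a::euclidean_space measure \<Rightarrow> 'a \<Rightarrow> real" where
  "lebesgue_density \<mu> x = enn2real (RN_deriv lborel \<mu> x)"

text \<open>Both divergences take values in \<open>ereal\<close>. The reference measure \<open>\<pi>\<close> is the first argument
  and is assumed to have a Lebesgue density; \<open>absolutely_continuous \<pi> \<rho>\<close> says \<open>\<rho> \<lless> \<pi>\<close>.\<close>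

definition chi_squared :: "'a::euclidean_space measure \<Rightarrow> 'a measure \<Rightarrow> ereal" where
  "chi_squared \<pi> \<rho> =
     (if absolutely_continuous \<pi> \<rho>
      then enn2ereal (\<integral>\<^sup>+x. ennreal ((lebesgue_density \<rho> x)\<^sup>2 / lebesgue_density \<pi> x) \<partial>lborel) - 1
      else \<infinity>)"

definition renyi_integral ::
    "real \<Rightarrow> 'a::euclidean_space measure \<Rightarrow> 'a measure \<Rightarrow> ennreal" where
  "renyi_integral q \<pi> \<rho> =
     (\<integral>\<^sup>+x. ennreal (lebesgue_density \<rho> x powr q / lebesgue_density \<pi> x powr (q - 1)) \<partial>lborel)"

definition renyi :: "real \<Rightarrow> 'a::euclidean_space measure \<Rightarrow> 'a measure \<Rightarrow> ereal" where
  "renyi q \<pi> \<rho> =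
     (if absolutely_continuous \<pi> \<rho> \<and> renyi_integral q \<pi> \<rho> \<noteq> \<infinity>
      then ereal (1 / (q - 1) * ln (enn2real (renyi_integral q \<pi> \<rho>)))
      else \<infinity>)"

text \<open>\<open>C\<^sup>\<infinity>\<close> functions: all iterated directional derivatives exist as Frechet derivatives.\<close>

primrec times_differentiable :: "nat \<Rightarrow> ('a::euclidean_space \<Rightarrow> real) \<Rightarrow> bool" where
  "times_differentiable 0 \<psi> \<longleftrightarrow> continuous_on UNIV \<psi>"
| "times_differentiable (Suc n) \<psi> \<longleftrightarrow>
     (\<forall>x. \<psi> differentiable (at x)) \<and>
     (\<forall>v. times_differentiable n (\<lambda>x. frechet_derivative \<psi> (at x) v))"

definition smooth :: "('a::euclidean_space \<Rightarrow> real) \<Rightarrow> bool" where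
  "smooth \<psi> \<longleftrightarrow> (\<forall>n. times_differentiable n \<psi>)"

text \<open>The Poincare inequality. The expected squared gradient norm is a nonnegative integral, so that
  the inequality is void, rather than false, when it is infinite.\<close>

definition poincare :: "real \<Rightarrow> 'a::euclidean_space measure \<Rightarrow> bool" where
  "poincare \<alpha> \<mu> \<longleftrightarrow>
     (\<forall>\<psi> \<psi>'. smooth \<psi> \<and> bounded (range \<psi>) \<and> (\<forall>x. GDERIV \<psi> x :> \<psi>' x) \<longrightarrow>
        ennreal (prob_space.variance \<mu> \<psi>)
          \<le> ennreal (1 / \<alpha>) * (\<integral>\<^sup>+x. ennreal ((norm (\<psi>' x))\<^sup>2) \<partial>\<mu>))"

end

theory Submission
  imports Defs
begin

text \<open>
  Let \<open>h\<close> be the density of the current law with respect to \<open>\<pi> = gibbs f\<close>, let \<open>X \<sim> \<pi>\<close>, and let \<open>Y\<close> be \<open>X\<close>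
  plus Gaussian noise of variance \<open>\<eta>\<close>. One step of the sampler takes two conditional expectations: the new
  \<open>Y\<close>-law has density \<open>E[h(X) | Y]\<close> (\<open>posterior_mean\<close>), and the new \<open>X\<close>-law has the density obtained from that
  one by averaging over the noise (\<open>heat\<close>). Put \<open>B = (\<integral> h\<^sup>q d\<pi>) powr (1 / (q - 1)) = exp R\<^sub>q\<close>. The heart of the
  matter is that each of the two half steps multiplies \<open>B - 1\<close> by at most \<open>(1 + \<alpha> \<eta>) powr (- 2 / q)\<close>
  (\<open>posterior_mean_contraction\<close>, \<open>heat_contraction\<close>). For \<open>q = 2\<close> the number \<open>B - 1\<close> is the chi-squared
  divergence. For \<open>q \<ge> 2\<close>, after \<open>k\<close> steps \<open>exp R\<^sub>k - 1 \<le> exp (- 2 x) (exp R\<^sub>0 - 1)\<close> with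
  \<open>x = 2 k ln (1 + \<alpha> \<eta>) / q\<close>, and both regimes of the Renyi bound are elementary consequences
  (\<open>renyi_linear_phase\<close>, \<open>renyi_exponential_phase\<close>).

  A half step is contracting because the noise may be added in small portions of variance \<open>\<delta>\<close>. If \<open>H\<close> is the
  conditional expectation of a density \<open>G\<close> over one portion, a Taylor expansion gives
  \<open>E G\<^sup>q - E H\<^sup>q \<ge> (2 (q - 1) / q) E (G powr (q/2) - H powr (q/2))\<^sup>2\<close> up to a multiple of \<open>E \<bar>G - H\<bar>\<^sup>3\<close>. The
  constant \<open>2 (q - 1) / q\<close> is right only to second order, which is what forces the subdivision: for \<open>q > 2\<close>
  no inequality with that constant holds for an arbitrary conditional expectation. The square is at least
  \<open>\<beta> Var (G powr (q/2))\<close>, where \<open>\<beta>\<close> measures how far from fully correlated two successive positions are, and the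
  variance is at least \<open>E G\<^sup>q (1 - 1 / B)\<close> by interpolation. Hence \<open>B - 1\<close> loses the factor \<open>1 - 2 \<beta> / q\<close>
  (\<open>small_step_contraction\<close>). The cubic errors are of order \<open>\<delta> powr (3/2)\<close> and vanish in total with the mesh,
  provided that \<open>G\<close> has already been smoothed a little; the short initial stretch where it has not is
  estimated by plain Jensen.

  The gap \<open>\<beta>\<close> for positions distributed as \<open>X\<close> plus noise of variance \<open>t\<close> is \<open>\<alpha> \<delta> / (1 + \<alpha> (t + \<delta>))\<close>, so that
  \<open>\<Prod> (1 - 2 \<beta> / q)\<close> tends to \<open>(1 + \<alpha> \<eta>) powr (- 2 / q)\<close>. For \<open>t = 0\<close> it comes from the Poincare inequality applied
  to a heat average \<open>Q \<psi>\<close>, whose gradient is dominated by the local variance: \<open>\<delta> \<parallel>\<nabla> Q \<psi>\<parallel>\<^sup>2 \<le> Q (\<psi>\<^sup>2) - (Q \<psi>)\<^sup>2\<close>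
  (\<open>heat_grad_le_heat_var\<close>). It propagates in \<open>t\<close> because the local variance of \<open>Q \<psi>\<close> is at most the average of the
  local variance of \<open>\<psi>\<close> (\<open>heat_var_heat_le\<close>, \<open>heat_gap_smear\<close>).

  All this is done for densities bounded above and away from zero; a truncation extends it to every density
  with finite moment of order \<open>q\<close> (\<open>proximal_step_contraction\<close>).
\<close>

section \<open>Power inequalities\<close>

text \<open>
  Concavity of a power with exponent in \<open>[0, 1]\<close>, including the boundary point \<open>x = 0\<close>.
\<close>

lemma powr_le_tangent:
  fixes x A p :: real
  assumes "0 \<le> x" "0 < A" "0 \<le> p" "p \<le> 1"
  shows "x powr p \<le> A powr p + p * A powr (p - 1) * (x - A)"
proof (cases "x = 0")
  case True
  then show ?thesis using assms
    by (simp add: powr_diff field_simps mult_left_le_one_le)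
next
  case False
  then have x: "x > 0" using assms by simp
  define y where "y = x / A"
  have y: "y > 0" using x assms by (simp add: y_def)
  have "y powr p * 1 powr (1 - p) \<le> p * y + (1 - p) * 1"
    using y assms by (intro Youngs_inequality_0) auto
  then have "y powr p \<le> 1 + p * (y - 1)" by (simp add: algebra_simps)
  then have "A powr p * y powr p \<le> A powr p * (1 + p * (y - 1))"
    using assms by (intro mult_left_mono) auto
  moreover have "A powr p * y powr p = x powr p"
    using assms x by (simp add: y_def powr_mult[symmetric])
  moreover have "A powr p * (p * (y - 1)) = p * A powr (p - 1) * (x - A)"
    using assms by (simp add: y_def powr_diff field_simps)
  ultimately show ?thesis by (simp add: algebra_simps)
qed

text \<open>
  The tangent inequality for a convex power, read off from the concave one by taking \<open>q\<close>-th roots.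
\<close>

lemma powr_ge_tangent:
  fixes x b q :: real
  assumes "0 < x" "0 < b" "1 \<le> q"
  shows "x powr q \<ge> b powr q + q * b powr (q - 1) * (x - b)"
proof -
  have "(x powr q) powr (1/q) \<le> (b powr q) powr (1/q) + (1/q) * (b powr q) powr (1/q - 1) * (x powr q - b powr q)"
    using assms by (intro powr_le_tangent) auto
  moreover have "q * (1/q - 1) = - (q - 1)" using assms by (simp add: field_simps)
  ultimately have "x \<le> b + (1/q) * b powr (- (q - 1)) * (x powr q - b powr q)"
    using assms by (simp add: powr_powr)
  then have "(x - b) * (q * b powr (q - 1)) \<le> ((1/q) * b powr (- (q - 1)) * (x powr q - b powr q)) * (q * b powr (q - 1))"
    using assms by (intro mult_right_mono) auto
  also have "\<dots> = x powr q - b powr q"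
  proof -
    have "b powr (- (q - 1)) * b powr (q - 1) = 1"
      unfolding powr_add[symmetric] using assms by simp
    then have "(1/q * b powr (- (q - 1)) * (x powr q - b powr q)) * (q * b powr (q - 1))
       = (x powr q - b powr q) * (1/q * q)"
      by (metis (no_types, opaque_lifting) mult.assoc mult.commute mult.right_neutral)
    then show ?thesis using assms by simp
  qed
  finally show ?thesis by (simp add: algebra_simps)
qed

text \<open>
  The left-hand side without the cubic term vanishes to second order at \<open>x = 1\<close>: there
  \<open>x powr q - 1 - q (x - 1)\<close> behaves like \<open>q (q - 1) / 2\<close> times \<open>(x - 1)\<^sup>2\<close> and the square like \<open>q\<^sup>2 / 4\<close> times it, which
  is what determines the constant \<open>2 (q - 1) / q\<close>. The cubic term is the Taylor remainder.
\<close>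

lemma powr_defect_normalized:
  fixes q l L :: real
  assumes "0 < l" "l \<le> 1" "1 \<le> L" "2 \<le> q"
  shows "\<exists>C\<ge>0. \<forall>x\<in>{l..L}.
    x powr q - 1 - q * (x - 1) - (2 * (q - 1) / q) * (x powr (q/2) - 1)\<^sup>2 \<ge> - C * \<bar>x - 1\<bar> ^ 3"
proof -
  define c where "c = 2 * (q - 1) / q"
  \<comment> \<open>The function to be bounded, expanded in powers of \<open>x\<close>, and its first three derivatives.\<close>
  define d where "d n = (\<lambda>x::real. if n = (0::nat) then (1 - c) * x powr q + 2 * c * x powr (q/2) - q * x + (q - 1 - c)
     else if n = 1 then (1 - c) * q * x powr (q - 1) + c * q * x powr (q/2 - 1) - q
     else if n = 2 then (1 - c) * q * (q - 1) * x powr (q - 2) + c * q * (q/2 - 1) * x powr (q/2 - 2)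
     else (1 - c) * q * (q - 1) * (q - 2) * x powr (q - 3) + c * q * (q/2 - 1) * (q/2 - 2) * x powr (q/2 - 3))" for n
  have cq: "c * q = 2 * (q - 1)" using assms by (simp add: c_def)
  have DER: "DERIV (d m) t :> d (Suc m) t" if m3: "m < 3" and lt: "l \<le> t" "t \<le> L" for m t
  proof -
    have t: "t > 0" using lt assms by simp
    consider "m = 0" | "m = 1" | "m = 2" using m3 by linarith
    then show ?thesis
    proof cases
      case 1 then show ?thesis unfolding d_def using t
        by (auto intro!: derivative_eq_intros simp: field_simps)
    next
      case 2 then show ?thesis unfolding d_def using t
        by (auto intro!: derivative_eq_intros simp: algebra_simps numeral_2_eq_2)
    next
      case 3 then show ?thesis unfolding d_def using t
        by (auto intro!: derivative_eq_intros simp: field_simps)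
    qed
  qed
  have "continuous_on {l..L} (d 3)" unfolding d_def using assms
    by (auto intro!: continuous_intros)
  then have "compact (d 3 ` {l..L})" by (intro compact_continuous_image) auto
  then have "bounded (d 3 ` {l..L})" by (rule compact_imp_bounded)
  then obtain K where K: "\<And>x. x \<in> {l..L} \<Longrightarrow> \<bar>d 3 x\<bar> \<le> K"
    unfolding bounded_iff real_norm_def by blast
  have K0: "K \<ge> 0" using K[of 1] assms by force
  have "x powr q - 1 - q * (x - 1) - c * (x powr (q/2) - 1)\<^sup>2 \<ge> - (K / 6) * \<bar>x - 1\<bar> ^ 3"
    if x: "x \<in> {l..L}" for x
  proof (cases "x = 1")
    case False
    have "(x powr (q/2))\<^sup>2 = x powr q" using x assms
      by (simp add: powr_powr powr_realpow[symmetric] flip: powr_numeral)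
    then have eq: "x powr q - 1 - q * (x - 1) - c * (x powr (q/2) - 1)\<^sup>2 = d 0 x"
      by (simp add: d_def power2_diff algebra_simps)
    obtain t where t: "(if x < 1 then x < t \<and> t < 1 else 1 < t \<and> t < x)"
      and e: "d 0 x = (\<Sum>m<3. (d m 1 / fact m) * (x - 1)^m) + (d 3 t / fact 3) * (x - 1)^3"
      using Taylor[of 3 d "d 0" l L 1 x] DER False x assms by auto
    have d0: "d 0 1 = 0" "d 1 1 = 0" using cq by (simp_all add: d_def algebra_simps)
    have "d 2 1 = q * ((q - 1) - c * q / 2)" by (simp add: d_def field_simps)
    then have d2: "d 2 1 = 0" using cq by simp
    have "d 0 x = (d 3 t / 6) * (x - 1)^3"
      using e d0 d2 by (simp add: eval_nat_numeral fact_numeral)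
    moreover have "\<bar>d 3 t\<bar> \<le> K" using K[of t] t x assms by (auto split: if_splits)
    then have "\<bar>(d 3 t / 6) * (x - 1)^3\<bar> \<le> (K/6) * \<bar>x - 1\<bar>^3"
      by (simp add: abs_mult power_abs divide_right_mono mult_right_mono)
    ultimately show ?thesis unfolding eq by linarith
  qed simp
  then show ?thesis using K0 unfolding c_def by (intro exI[of _ "K/6"]) auto
qed

text \<open>
  The Bregman divergence of \<open>x powr q\<close> is compared with a squared difference of \<open>q/2\<close>-th powers, which is the
  quantity that a variance inequality controls. By homogeneity it suffices to treat \<open>b = 1\<close>.
\<close>

lemma powr_defect_ge_square_minus_cube:
  fixes q m M :: real
  assumes "0 < m" "m \<le> M" "2 \<le> q"
  shows "\<exists>C\<ge>0. \<forall>a\<in>{m..M}. \<forall>b\<in>{m..M}.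
    a powr q - b powr q - q * b powr (q - 1) * (a - b)
      \<ge> (2 * (q - 1) / q) * (a powr (q/2) - b powr (q/2))\<^sup>2 - C * \<bar>a - b\<bar> ^ 3"
proof -
  define c where "c = 2 * (q - 1) / q"
  obtain C where C0: "C \<ge> 0" and C: "\<And>x. x \<in> {m/M..M/m} \<Longrightarrow>
    x powr q - 1 - q * (x - 1) - c * (x powr (q/2) - 1)\<^sup>2 \<ge> - C * \<bar>x - 1\<bar> ^ 3"
    using powr_defect_normalized[of "m/M" "M/m" q] assms unfolding c_def by auto
  have "a powr q - b powr q - q * b powr (q - 1) * (a - b)
      \<ge> c * (a powr (q/2) - b powr (q/2))\<^sup>2 - (C * M powr q / m ^ 3) * \<bar>a - b\<bar> ^ 3"
    if ab: "a \<in> {m..M}" "b \<in> {m..M}" for a b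
  proof -
    have pos: "a > 0" "b > 0" "M > 0" using ab assms by auto
    define x where "x = a / b"
    have a: "a = b * x" using pos by (simp add: x_def)
    have xp: "x > 0" using pos by (simp add: x_def)
    have "x \<in> {m/M..M/m}" using ab pos assms unfolding x_def
      by (auto intro!: frac_le)
    note Cx = C[OF this]
    have "b powr q * (x powr q - 1 - q * (x - 1) - c * (x powr (q/2) - 1)\<^sup>2) \<ge> b powr q * (- C * \<bar>x - 1\<bar> ^ 3)"
      using Cx by (intro mult_left_mono) auto
    moreover have "b powr q * (x powr q - 1 - q * (x - 1) - c * (x powr (q/2) - 1)\<^sup>2)
       = a powr q - b powr q - q * b powr (q - 1) * (a - b) - c * (a powr (q/2) - b powr (q/2))\<^sup>2"
    proof -
      have 1: "b powr q = (b powr (q/2))\<^sup>2" using pos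
        by (simp add: powr_powr powr_realpow[symmetric] flip: powr_numeral)
      have 2: "b powr (q - 1) * (a - b) = b powr q * (x - 1)"
        using pos by (simp add: x_def powr_diff field_simps)
      have 3: "a powr r = b powr r * x powr r" for r unfolding a using pos xp by (simp add: powr_mult)
      have "(a powr (q/2) - b powr (q/2))\<^sup>2 = b powr q * (x powr (q/2) - 1)\<^sup>2"
        unfolding 1 3[of "q/2"] by (simp add: power2_eq_square algebra_simps)
      moreover have "q * b powr (q - 1) * (a - b) = q * (b powr q * (x - 1))" using 2 by simp
      ultimately show ?thesis by (simp add: 3[of q] algebra_simps)
    qed
    moreover have "b powr q * (C * \<bar>x - 1\<bar> ^ 3) \<le> (C * M powr q / m ^ 3) * \<bar>a - b\<bar> ^ 3"
    proof -
      have "\<bar>x - 1\<bar> = \<bar>a - b\<bar> / b" using pos by (simp add: x_def abs_if field_simps)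
      also have "\<dots> \<le> \<bar>a - b\<bar> / m" using ab assms pos by (intro divide_left_mono) auto
      finally have "\<bar>x - 1\<bar> ^ 3 \<le> (\<bar>a - b\<bar> / m) ^ 3" by (intro power_mono) auto
      moreover have "b powr q \<le> M powr q" using ab assms pos by (intro powr_mono2) auto
      ultimately have "b powr q * (C * \<bar>x - 1\<bar> ^ 3) \<le> M powr q * (C * (\<bar>a - b\<bar> / m) ^ 3)"
        using C0 by (intro mult_mono mult_left_mono) auto
      then show ?thesis by (simp add: power_divide mult_ac)
    qed
    ultimately show ?thesis by linarith
  qed
  moreover have "C * M powr q / m ^ 3 \<ge> 0" using C0 assms by simp
  ultimately show ?thesis unfolding c_def by blast
qed

section \<open>Contraction over one short step\<close>

lemma (in prob_space) integrable_of_bounded: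
  fixes f :: "'a \<Rightarrow> real"
  assumes "f \<in> borel_measurable M" "\<And>x. \<bar>f x\<bar> \<le> B"
  shows "integrable M f"
  using assms by (intro integrable_const_bound[of _ B]) auto

lemma powr_bounds:
  fixes x :: real
  assumes "0 < m" "m \<le> x" "x \<le> K" "0 \<le> r"
  shows "\<bar>x powr r\<bar> \<le> K powr r"
  using assms by (auto intro: powr_mono2)

lemma (in prob_space) integrable_powr_of_bounds:
  assumes [measurable]: "G \<in> borel_measurable M"
    and m: "0 < m" and G: "\<And>x. m \<le> G x" "\<And>x. G x \<le> (K::real)" and r: "0 \<le> r"
  shows "integrable M (\<lambda>x. G x powr r)"
proof (rule integrable_of_bounded[where B = "K powr r"])
  show "\<bar>G x powr r\<bar> \<le> K powr r" for x
    using m G[of x] r by (intro powr_bounds)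
qed simp

text \<open>
  Interpolation of the moment of order \<open>q/2\<close> between the moments of order \<open>1\<close> (normalised) and \<open>q\<close>: under the
  probability measure with density \<open>G\<close>, Jensen applies to the power \<open>(q - 2) / (2 (q - 1))\<close> of \<open>G powr (q - 1)\<close>.
\<close>

lemma (in prob_space) half_moment_interpolation:
  assumes [measurable]: "G \<in> borel_measurable M"
    and G: "\<And>x. m \<le> G x" "\<And>x. G x \<le> (K::real)" and m: "0 < m" and q: "2 \<le> q"
    and G1: "expectation G = 1"
  shows "(expectation (\<lambda>x. G x powr (q/2)))\<^sup>2 \<le> expectation (\<lambda>x. G x powr q) powr ((q - 2) / (q - 1))"
    and "1 \<le> expectation (\<lambda>x. G x powr q)"
proof -
  note int = integrable_powr_of_bounds[OF assms(1) m G]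
  have Gpos: "G x > 0" for x using G(1)[of x] m by linarith
  have intG: "integrable M G"
    using int[of 1] Gpos by (simp add: less_imp_le abs_of_nonneg)
  define A where "A = expectation (\<lambda>x. G x powr q)"
  have "expectation (\<lambda>x. 1 + q * (G x - 1)) \<le> A" unfolding A_def
    using int[of q] intG q powr_ge_tangent[OF Gpos, of 1 q] by (intro integral_mono) auto
  then show A1: "1 \<le> expectation (\<lambda>x. G x powr q)" using intG by (simp add: G1 prob_space A_def)
  define \<theta> where "\<theta> = (q - 2) / (2 * (q - 1))"
  have th: "0 \<le> \<theta>" "\<theta> \<le> 1" using q by (simp_all add: \<theta>_def field_simps)
  \<comment> \<open>The density \<open>G\<close> is the weight, and concavity of \<open>y powr \<theta>\<close> is applied to \<open>y = G powr (q - 1)\<close>.\<close>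
  have pt: "G x powr (q/2) \<le> A powr \<theta> * G x + \<theta> * A powr (\<theta> - 1) * (G x powr q - A * G x)" for x
  proof -
    have "(G x powr (q - 1)) powr \<theta> \<le> A powr \<theta> + \<theta> * A powr (\<theta> - 1) * (G x powr (q - 1) - A)"
      using A1 th A_def by (intro powr_le_tangent) auto
    then have "G x * (G x powr (q - 1)) powr \<theta> \<le> G x * (A powr \<theta> + \<theta> * A powr (\<theta> - 1) * (G x powr (q - 1) - A))"
      using Gpos[of x] by (intro mult_left_mono) auto
    moreover have "G x * (G x powr (q - 1)) powr \<theta> = G x powr (q/2)"
    proof -
      have e: "(q - 1) * \<theta> = q/2 - 1" using q by (simp add: \<theta>_def field_simps)
      show ?thesis using Gpos[of x] unfolding powr_powr e by (simp add: powr_diff)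
    qed
    moreover have "G x * G x powr (q - 1) = G x powr q" using Gpos[of x] by (simp add: powr_diff)
    moreover have "G x * (A powr \<theta> + \<theta> * A powr (\<theta> - 1) * (G x powr (q - 1) - A))
       = A powr \<theta> * G x + \<theta> * A powr (\<theta> - 1) * (G x * G x powr (q - 1) - A * G x)" by (simp add: algebra_simps)
    ultimately show ?thesis by metis
  qed
  have "expectation (\<lambda>x. G x powr (q/2)) \<le> expectation (\<lambda>x. A powr \<theta> * G x + \<theta> * A powr (\<theta> - 1) * (G x powr q - A * G x))"
    using int[of q] int[of "q/2"] intG q by (intro integral_mono pt) auto
  also have "\<dots> = A powr \<theta>" using int[of q] intG q G1 by (simp add: A_def)
  finally have "(expectation (\<lambda>x. G x powr (q/2)))\<^sup>2 \<le> (A powr \<theta>)\<^sup>2"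
    by (intro power_mono integral_nonneg_AE) auto
  also have "(A powr \<theta>)\<^sup>2 = A powr (2 * \<theta>)" by (simp add: power2_eq_square flip: powr_add)
  also have "2 * \<theta> = (q - 2) / (q - 1)" using q by (simp add: \<theta>_def field_simps)
  finally show "(expectation (\<lambda>x. G x powr (q/2)))\<^sup>2 \<le> expectation (\<lambda>x. G x powr q) powr ((q - 2) / (q - 1))"
    by (simp add: A_def)
qed

text \<open>
  If \<open>g\<close> is the density of \<open>\<rho>\<close> with respect to \<open>\<mu>\<close>, this is \<open>exp (R\<^sub>q)\<close> for the Renyi divergence \<open>R\<^sub>q\<close> of \<open>\<rho>\<close>
  from \<open>\<mu>\<close>; it is the exponential that decays geometrically.
\<close>

definition exp_renyi :: "real \<Rightarrow> 'b measure \<Rightarrow> ('b \<Rightarrow> real) \<Rightarrow> real" where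
  "exp_renyi q \<mu> g = (\<integral>x. g x powr q \<partial>\<mu>) powr (1 / (q - 1))"

text \<open>
  Here \<open>H\<close> is the conditional expectation of \<open>G\<close> on some information, which the hypotheses express by an
  orthogonality relation, and \<open>\<beta>\<close> is a lower bound for the part of the variance of \<open>G powr (q/2)\<close> that this
  information cannot explain. The loss \<open>E G\<^sup>q - E H\<^sup>q\<close> is then a fraction of \<open>E G\<^sup>q (1 - 1 / B)\<close>, and the concave
  function \<open>A powr (1 / (q - 1))\<close> turns it into a fraction of \<open>B - 1\<close>.
\<close>

lemma (in prob_space) small_step_contraction:
  assumes [measurable]: "G \<in> borel_measurable M" "H \<in> borel_measurable M"
    and G: "\<And>x. m \<le> G x" "\<And>x. G x \<le> (K::real)"
    and H: "\<And>x. m \<le> H x" "\<And>x. H x \<le> K"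
    and m: "0 < m" and q: "2 \<le> q"
    and G1: "expectation G = 1" and H1: "expectation H = 1"
    and orth: "expectation (\<lambda>x. (G x - H x) * H x powr (q - 1)) = 0"
    and gap: "expectation (\<lambda>x. (G x powr (q/2) - H x powr (q/2))\<^sup>2)
      \<ge> \<beta> * (expectation (\<lambda>x. G x powr q) - (expectation (\<lambda>x. G x powr (q/2)))\<^sup>2)"
    and beta: "0 \<le> \<beta>"
    and C: "C \<ge> 0" "\<And>a b. a \<in> {m..K} \<Longrightarrow> b \<in> {m..K} \<Longrightarrow>
      a powr q - b powr q - q * b powr (q - 1) * (a - b)
      \<ge> (2 * (q - 1) / q) * (a powr (q/2) - b powr (q/2))\<^sup>2 - C * \<bar>a - b\<bar> ^ 3"
    and cube: "expectation (\<lambda>x. \<bar>G x - H x\<bar> ^ 3) \<le> \<epsilon>"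
  shows "exp_renyi q M H - 1 \<le> (1 - (2/q) * \<beta>) * (exp_renyi q M G - 1) + C * \<epsilon>"
proof -
  have Gpos: "G x > 0" and Hpos: "H x > 0" for x using G(1)[of x] H(1)[of x] m by linarith+
  note intG = integrable_powr_of_bounds[OF assms(1) m G]
  note intH = integrable_powr_of_bounds[OF assms(2) m H]
  have intGH: "integrable M (\<lambda>x. (G x - H x) * H x powr (q - 1))"
  proof (rule integrable_of_bounded[where B = "K * K powr (q - 1)"])
    fix x
    have "\<bar>G x - H x\<bar> \<le> K" using G[of x] H[of x] m by (auto simp: abs_le_iff)
    then show "\<bar>(G x - H x) * H x powr (q - 1)\<bar> \<le> K * K powr (q - 1)"
      unfolding abs_mult using H m q by (intro mult_mono powr_bounds[where m = m]) auto
  qed simp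
  have intD: "integrable M (\<lambda>x. \<bar>G x - H x\<bar> ^ 3)"
  proof (rule integrable_of_bounded[where B = "K ^ 3"])
    fix x
    have "\<bar>G x - H x\<bar> \<le> K" using G[of x] H[of x] m by (auto simp: abs_le_iff)
    then show "\<bar>\<bar>G x - H x\<bar> ^ 3\<bar> \<le> K ^ 3" by (simp add: power_mono)
  qed simp
  have intS: "integrable M (\<lambda>x. (G x powr (q/2) - H x powr (q/2))\<^sup>2)"
  proof (rule integrable_of_bounded[where B = "(K powr (q/2))\<^sup>2"])
    fix x
    have "\<bar>G x powr (q/2)\<bar> \<le> K powr (q/2)" "\<bar>H x powr (q/2)\<bar> \<le> K powr (q/2)"
      using G[of x] H[of x] m q by (intro powr_bounds[where m = m]; simp)+
    then have "\<bar>G x powr (q/2) - H x powr (q/2)\<bar> \<le> K powr (q/2)"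
      using powr_ge_zero[of "G x" "q/2"] powr_ge_zero[of "H x" "q/2"] by linarith
    then have "\<bar>G x powr (q/2) - H x powr (q/2)\<bar>\<^sup>2 \<le> (K powr (q/2))\<^sup>2" by (intro power_mono) auto
    then show "\<bar>(G x powr (q/2) - H x powr (q/2))\<^sup>2\<bar> \<le> (K powr (q/2))\<^sup>2" by simp
  qed simp
  define A where "A = expectation (\<lambda>x. G x powr q)"
  define A' where "A' = expectation (\<lambda>x. H x powr q)"
  define c where "c = 2 * (q - 1) / q"
  define p where "p = 1 / (q - 1)"
  define B where "B = A powr p"
  note hm = half_moment_interpolation[OF assms(1) G m q G1] half_moment_interpolation(2)[OF assms(2) H m q H1]
  have A1: "A \<ge> 1" "A' \<ge> 1" using hm by (auto simp: A_def A'_def)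
  have p: "0 \<le> p" "p \<le> 1" using q by (simp_all add: p_def)
  have B1: "B \<ge> 1" using A1 p by (simp add: B_def ge_one_powr_ge_zero)
  have c0: "c \<ge> 0" using q by (simp add: c_def)
  \<comment> \<open>Orthogonality allows the linear term of the Bregman divergence to be inserted for free.\<close>
  have "A - A' = expectation (\<lambda>x. G x powr q - H x powr q - q * ((G x - H x) * H x powr (q - 1)))"
    using intG[of q] intH[of q] intGH q by (simp add: A_def A'_def orth)
  also have "\<dots> \<ge> expectation (\<lambda>x. c * (G x powr (q/2) - H x powr (q/2))\<^sup>2 - C * \<bar>G x - H x\<bar> ^ 3)"
    using intG[of q] intH[of q] intGH intS intD q C(2) G H
    by (intro integral_mono) (auto simp: c_def mult_ac)
  finally have "A - A' \<ge> c * expectation (\<lambda>x. (G x powr (q/2) - H x powr (q/2))\<^sup>2) - C * expectation (\<lambda>x. \<bar>G x - H x\<bar> ^ 3)"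
    using intS intD by simp
  moreover have "c * expectation (\<lambda>x. (G x powr (q/2) - H x powr (q/2))\<^sup>2)
     \<ge> c * (\<beta> * (A - (expectation (\<lambda>x. G x powr (q/2)))\<^sup>2))"
    using gap c0 unfolding A_def by (intro mult_left_mono) auto
  moreover have "c * (\<beta> * (A - (expectation (\<lambda>x. G x powr (q/2)))\<^sup>2)) \<ge> c * (\<beta> * (A - A / B))"
  proof -
    have "(q - 2) / (q - 1) = 1 - p" using q by (simp add: p_def field_simps)
    then have "(expectation (\<lambda>x. G x powr (q/2)))\<^sup>2 \<le> A / B"
      using hm(1) A1 unfolding A_def[symmetric] B_def by (simp add: powr_diff)
    then show ?thesis using c0 beta by (intro mult_left_mono) auto
  qed
  moreover have "C * expectation (\<lambda>x. \<bar>G x - H x\<bar> ^ 3) \<le> C * \<epsilon>" using cube C by (intro mult_left_mono) auto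
  ultimately have dA: "A' - A \<le> C * \<epsilon> - c * (\<beta> * (A - A / B))" by linarith
  \<comment> \<open>The tangent is taken at \<open>A\<close> and not at \<open>A'\<close>, so that only the upper bound on \<open>A' - A\<close> is used.\<close>
  have "A' powr p \<le> A powr p + p * A powr (p - 1) * (A' - A)"
    using A1 p by (intro powr_le_tangent) auto
  also have "\<dots> \<le> A powr p + p * A powr (p - 1) * (C * \<epsilon> - c * (\<beta> * (A - A / B)))"
    using dA p by (intro add_left_mono mult_left_mono) auto
  also have "\<dots> = B - (2/q) * \<beta> * (B - 1) + p * A powr (p - 1) * (C * \<epsilon>)"
  proof -
    have "A powr (p - 1) * (A - A / B) = B - 1"
      using A1 B1 by (simp add: powr_diff field_simps flip: B_def)
    moreover have "p * c = 2 / q" using q by (simp add: p_def c_def field_simps)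
    moreover have "p * A powr (p - 1) * (c * (\<beta> * (A - A / B))) = (p * c) * \<beta> * (A powr (p - 1) * (A - A / B))"
      by (simp add: mult_ac)
    ultimately have "p * A powr (p - 1) * (c * (\<beta> * (A - A / B))) = (2/q) * \<beta> * (B - 1)" by simp
    then show ?thesis by (simp add: right_diff_distrib B_def[symmetric] del: mult.assoc)
  qed
  also have "\<dots> \<le> B - (2/q) * \<beta> * (B - 1) + 1 * (C * \<epsilon>)"
  proof -
    have "0 \<le> expectation (\<lambda>x. \<bar>G x - H x\<bar> ^ 3)" by simp
    then have "0 \<le> \<epsilon>" using cube by linarith
    moreover have "A powr (p - 1) \<le> 1" using powr_mono[of "p - 1" 0 A] A1 p by simp
    then have "p * A powr (p - 1) \<le> 1" using p by (simp add: mult_le_one)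
    ultimately show ?thesis using C by (intro add_left_mono mult_right_mono) auto
  qed
  finally show ?thesis unfolding exp_renyi_def A_def[symmetric] A'_def[symmetric] p_def[symmetric] B_def[symmetric]
    by (simp add: algebra_simps)
qed

section \<open>Gaussian measures\<close>

text \<open>
  The integrand is a product over the coordinates, so the normalising constant is a power of the one-dimensional one.
\<close>

lemma gauss_nn_integral:
  fixes t :: real
  assumes t: "t > 0"
  shows "(\<integral>\<^sup>+u. ennreal (exp (- (norm (u::'a::euclidean_space))\<^sup>2 / (2 * t))) \<partial>lborel) = ennreal (sqrt (2 * pi * t) ^ DIM('a))"
proof -
  have one: "(\<integral>\<^sup>+x. ennreal (exp (- x\<^sup>2 / (2 * t))) \<partial>lborel) = ennreal (sqrt (2 * pi * t))"
  proof -
    interpret prob_space "density lborel (normal_density 0 (sqrt t))" using t by (intro prob_space_normal_density) simp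
    have "(\<integral>\<^sup>+x. ennreal (normal_density 0 (sqrt t) x) \<partial>lborel) = 1"
      using emeasure_space_1 by (simp add: emeasure_density)
    then have "ennreal (sqrt (2 * pi * t)) * (\<integral>\<^sup>+x. ennreal (normal_density 0 (sqrt t) x) \<partial>lborel) = ennreal (sqrt (2 * pi * t))"
      by simp
    also have "ennreal (sqrt (2 * pi * t)) * (\<integral>\<^sup>+x. ennreal (normal_density 0 (sqrt t) x) \<partial>lborel)
       = (\<integral>\<^sup>+x. ennreal (sqrt (2 * pi * t) * normal_density 0 (sqrt t) x) \<partial>lborel)"
      using t by (subst nn_integral_cmult[symmetric]) (auto simp: ennreal_mult)
    also have "\<dots> = (\<integral>\<^sup>+x. ennreal (exp (- x\<^sup>2 / (2 * t))) \<partial>lborel)"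
      using t by (intro nn_integral_cong) (simp add: normal_density_def)
    finally show ?thesis .
  qed
  have "(\<integral>\<^sup>+u. ennreal (exp (- (norm (u::'a))\<^sup>2 / (2 * t))) \<partial>lborel)
      = (\<integral>\<^sup>+u. (\<Prod>b\<in>(Basis::'a set). (\<lambda>x. ennreal (exp (- x\<^sup>2 / (2 * t)))) (u \<bullet> b)) \<partial>lborel)"
  proof (intro nn_integral_cong)
    fix u :: 'a
    have "- (norm u)\<^sup>2 / (2 * t) = (\<Sum>b\<in>Basis. - (u \<bullet> b)\<^sup>2 / (2 * t))"
      by (simp add: norm_eq_sqrt_inner euclidean_inner[of u u] power2_eq_square sum_nonneg sum_negf flip: sum_divide_distrib)
    then show "ennreal (exp (- (norm u)\<^sup>2 / (2 * t))) = (\<Prod>b\<in>Basis. ennreal (exp (- (u \<bullet> b)\<^sup>2 / (2 * t))))"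
      by (simp add: exp_sum prod_ennreal)
  qed
  also have "\<dots> = (\<Prod>b\<in>(Basis::'a set). (\<integral>\<^sup>+x. ennreal (exp (- x\<^sup>2 / (2 * t))) \<partial>lborel))"
    by (rule nn_integral_lborel_prod) auto
  also have "\<dots> = ennreal (sqrt (2 * pi * t) ^ DIM('a))" by (simp only: one prod_constant) (use t in \<open>simp add: ennreal_power\<close>)
  finally show ?thesis .
qed

definition gauss_density :: "real \<Rightarrow> 'a::euclidean_space \<Rightarrow> real" where
  "gauss_density t u = exp (- (norm u)\<^sup>2 / (2 * t)) / sqrt (2 * pi * t) ^ DIM('a)"

lemma gauss_density_pos: "t > 0 \<Longrightarrow> gauss_density t u > 0"
  by (simp add: gauss_density_def)

lemma gauss_density_nonneg: "t > 0 \<Longrightarrow> gauss_density t u \<ge> 0"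
  by (simp add: gauss_density_def)

lemma gauss_density_le: "t > 0 \<Longrightarrow> gauss_density t (u::'a::euclidean_space) \<le> 1 / sqrt (2 * pi * t) ^ DIM('a)"
  by (simp add: gauss_density_def divide_right_mono)

lemma measurable_gauss_density [measurable]: "gauss_density t \<in> borel_measurable borel"
  unfolding gauss_density_def by measurable

lemma gaussian_eq_density: "gaussian m v = density lborel (\<lambda>y. ennreal (gauss_density v (y - m)))"
  by (simp add: gaussian_def gauss_density_def)

lemma sets_gaussian [measurable_cong, simp]: "sets (gaussian m v) = sets borel"
  by (simp add: gaussian_def)

lemma space_gaussian [simp]: "space (gaussian m v) = UNIV"
  by (simp add: gaussian_def)

lemma gauss_density_nn_integral:
  assumes "t > 0"
  shows "(\<integral>\<^sup>+u. ennreal (gauss_density t (u::'a::euclidean_space)) \<partial>lborel) = 1"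
proof -
  have p: "sqrt (2 * pi * t) ^ DIM('a) > 0" using assms by simp
  have "(\<integral>\<^sup>+u. ennreal (gauss_density t (u::'a)) \<partial>lborel)
     = (\<integral>\<^sup>+u. ennreal (exp (- (norm (u::'a))\<^sup>2 / (2 * t))) * ennreal (1 / sqrt (2 * pi * t) ^ DIM('a)) \<partial>lborel)"
    using p by (intro nn_integral_cong) (simp add: gauss_density_def flip: ennreal_mult)
  also have "\<dots> = ennreal (sqrt (2 * pi * t) ^ DIM('a)) * ennreal (1 / sqrt (2 * pi * t) ^ DIM('a))"
    by (subst nn_integral_multc) (use gauss_nn_integral[OF assms, where 'a = 'a] in auto)
  also have "\<dots> = 1" using p assms by (simp flip: ennreal_mult)
  finally show ?thesis .
qed

lemma nn_integral_lborel_translate: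
  fixes f :: "'a::euclidean_space \<Rightarrow> ennreal"
  assumes [measurable]: "f \<in> borel_measurable borel"
  shows "(\<integral>\<^sup>+y. f (x + y) \<partial>lborel) = (\<integral>\<^sup>+y. f y \<partial>lborel)"
  using nn_integral_distr[of "(+) x" lborel borel f] by (simp add: lborel_distr_plus)

lemma nn_integral_gaussian:
  assumes "t > 0" and [measurable]: "f \<in> borel_measurable borel"
  shows "(\<integral>\<^sup>+y. f y \<partial>gaussian x t) = (\<integral>\<^sup>+y. ennreal (gauss_density t (y - x)) * f y \<partial>lborel)"
  unfolding gaussian_eq_density by (subst nn_integral_density) auto

lemma nn_integral_gaussian_shift:
  fixes x :: "'a::euclidean_space"
  assumes "t > 0" and [measurable]: "f \<in> borel_measurable borel"
  shows "(\<integral>\<^sup>+u. f (x + u) \<partial>gaussian 0 t) = (\<integral>\<^sup>+y. f y \<partial>gaussian x t)"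
  using nn_integral_lborel_translate[of "\<lambda>y. ennreal (gauss_density t (y - x)) * f y" x]
  by (simp add: nn_integral_gaussian assms)

lemma prob_space_gaussian: 
  fixes m :: "'a::euclidean_space"
  assumes "t > 0" shows "prob_space (gaussian m t)"
proof 
  have "emeasure (gaussian m t) (space (gaussian m t)) = (\<integral>\<^sup>+y. 1 \<partial>gaussian m t)" by simp
  also have "\<dots> = (\<integral>\<^sup>+y. 1 \<partial>gaussian (0::'a) t)"
    using nn_integral_gaussian_shift[OF assms, of "\<lambda>_. 1" m] by simp
  also have "\<dots> = 1" using gauss_density_nn_integral[OF assms, where 'a = 'a]
    by (subst nn_integral_gaussian[OF assms]) auto
  finally show "emeasure (gaussian m t) (space (gaussian m t)) = 1" .
qed

lemma distr_gaussian_shift: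
  assumes "t > 0"
  shows "distr (gaussian 0 t) borel (\<lambda>u. x + u) = gaussian x t"
proof (rule measure_eqI)
  fix A assume "A \<in> sets (distr (gaussian 0 t) borel (\<lambda>u. x + u))"
  then have [measurable]: "A \<in> sets borel" by simp
  have "emeasure (distr (gaussian 0 t) borel (\<lambda>u. x + u)) A = (\<integral>\<^sup>+u. indicator A (x + u) \<partial>gaussian 0 t)"
    by (subst nn_integral_indicator[symmetric], simp, subst nn_integral_distr) auto
  also have "\<dots> = emeasure (gaussian x t) A"
    by (subst nn_integral_gaussian_shift[OF assms]) auto
  finally show "emeasure (distr (gaussian 0 t) borel (\<lambda>u. x + u)) A = emeasure (gaussian x t) A" .
qed simp

text \<open>
  Completing the square in \<open>y\<close>. The product formula makes the convolution of two Gaussians immediate in any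
  dimension.
\<close>

lemma gauss_density_mult:
  fixes y z :: "'a::euclidean_space"
  assumes "s > 0" "t > 0"
  shows "gauss_density s y * gauss_density t (z - y)
    = gauss_density (s + t) z * gauss_density (s * t / (s + t)) (y - (s / (s + t)) *\<^sub>R z)"
proof -
  have st: "s + t > 0" using assms by simp
  have n: "(norm (y - (s / (s + t)) *\<^sub>R z))\<^sup>2 = (norm y)\<^sup>2 - 2 * (s / (s + t)) * (y \<bullet> z) + (s / (s + t))\<^sup>2 * (norm z)\<^sup>2"
    unfolding power2_norm_eq_inner by (simp add: inner_diff inner_commute power2_eq_square algebra_simps)
  have n2: "(norm (z - y))\<^sup>2 = (norm z)\<^sup>2 - 2 * (y \<bullet> z) + (norm y)\<^sup>2"
    unfolding power2_norm_eq_inner by (simp add: inner_diff inner_commute algebra_simps)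
  have "- (norm y)\<^sup>2 / (2 * s) + - (norm (z - y))\<^sup>2 / (2 * t)
      = - (norm z)\<^sup>2 / (2 * (s + t)) + - (norm (y - (s / (s + t)) *\<^sub>R z))\<^sup>2 / (2 * (s * t / (s + t)))"
    unfolding n n2 using assms st by (simp add: divide_simps) (simp add: algebra_simps power2_eq_square)
  then have e: "exp (- (norm y)\<^sup>2 / (2 * s)) * exp (- (norm (z - y))\<^sup>2 / (2 * t))
      = exp (- (norm z)\<^sup>2 / (2 * (s + t))) * exp (- (norm (y - (s / (s + t)) *\<^sub>R z))\<^sup>2 / (2 * (s * t / (s + t))))"
    by (simp add: mult_exp_exp)
  have "sqrt (2 * pi * s) * sqrt (2 * pi * t) = sqrt (2 * pi * (s + t)) * sqrt (2 * pi * (s * t / (s + t)))"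
    using assms st by (simp add: real_sqrt_mult[symmetric] field_simps)
  then have "sqrt (2 * pi * s) ^ DIM('a) * sqrt (2 * pi * t) ^ DIM('a) 
     = sqrt (2 * pi * (s + t)) ^ DIM('a) * sqrt (2 * pi * (s * t / (s + t))) ^ DIM('a)"
    by (simp add: power_mult_distrib[symmetric])
  then show ?thesis unfolding gauss_density_def times_divide_times_eq e by simp
qed

lemma gauss_density_convolution:
  fixes z :: "'a::euclidean_space"
  assumes "s > 0" "t > 0"
  shows "(\<integral>\<^sup>+y. ennreal (gauss_density s y) * ennreal (gauss_density t (z - y)) \<partial>lborel) = ennreal (gauss_density (s + t) z)"
proof -
  have v: "s * t / (s + t) > 0" "s + t > 0" using assms by simp_all
  have "(\<integral>\<^sup>+y. ennreal (gauss_density s y) * ennreal (gauss_density t (z - y)) \<partial>lborel)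
    = (\<integral>\<^sup>+y. ennreal (gauss_density (s + t) z) * ennreal (gauss_density (s * t / (s + t)) (y - (s / (s + t)) *\<^sub>R z)) \<partial>lborel)"
    using assms v by (intro nn_integral_cong) (simp add: gauss_density_mult gauss_density_nonneg flip: ennreal_mult)
  also have "\<dots> = ennreal (gauss_density (s + t) z) * (\<integral>\<^sup>+y. ennreal (gauss_density (s * t / (s + t)) (- (s / (s + t)) *\<^sub>R z + y)) \<partial>lborel)"
    by (subst nn_integral_cmult) (auto simp: algebra_simps)
  also have "\<dots> = ennreal (gauss_density (s + t) z)"
    by (subst nn_integral_lborel_translate) (auto simp: gauss_density_nn_integral[OF v(1)])
  finally show ?thesis .
qed

lemma nn_integral_gaussian_add:
  fixes f :: "'a::euclidean_space \<Rightarrow> ennreal"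
  assumes st: "s > 0" "t > 0" and [measurable]: "f \<in> borel_measurable borel"
  shows "(\<integral>\<^sup>+u. \<integral>\<^sup>+v. f (u + v) \<partial>gaussian 0 t \<partial>gaussian 0 s) = (\<integral>\<^sup>+w. f w \<partial>gaussian 0 (s + t))"
proof -
  have "(\<integral>\<^sup>+u. \<integral>\<^sup>+v. f (u + v) \<partial>gaussian 0 t \<partial>gaussian 0 s)
      = (\<integral>\<^sup>+u. ennreal (gauss_density s u) * (\<integral>\<^sup>+z. ennreal (gauss_density t (z - u)) * f z \<partial>lborel) \<partial>lborel)"
    by (subst nn_integral_gaussian_shift[OF st(2)], simp, subst nn_integral_gaussian[OF st(2)], simp,
        subst nn_integral_gaussian[OF st(1)]) simp_all
  also have "\<dots> = (\<integral>\<^sup>+u. \<integral>\<^sup>+z. f z * (ennreal (gauss_density s u) * ennreal (gauss_density t (z - u))) \<partial>lborel \<partial>lborel)"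
    by (simp add: nn_integral_cmult[symmetric] mult_ac)
  also have "\<dots> = (\<integral>\<^sup>+z. \<integral>\<^sup>+u. f z * (ennreal (gauss_density s u) * ennreal (gauss_density t (z - u))) \<partial>lborel \<partial>lborel)"
    by (rule lborel_pair.Fubini') simp
  also have "\<dots> = (\<integral>\<^sup>+z. f z * ennreal (gauss_density (s + t) z) \<partial>lborel)"
    by (simp add: nn_integral_cmult gauss_density_convolution[OF st])
  also have "\<dots> = (\<integral>\<^sup>+w. f w \<partial>gaussian 0 (s + t))"
    using st by (simp add: nn_integral_gaussian mult.commute)
  finally show ?thesis .
qed

lemma distr_gaussian_add:
  fixes s t :: real
  assumes st: "s > 0" "t > 0"
  shows "distr (gaussian 0 s \<Otimes>\<^sub>M gaussian 0 t) borel (\<lambda>(u, v). u + v) = gaussian (0::'a::euclidean_space) (s + t)"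
proof (rule measure_eqI)
  interpret t: prob_space "gaussian (0::'a) t" by (rule prob_space_gaussian[OF st(2)])
  fix A :: "'a set" assume "A \<in> sets (distr (gaussian (0::'a) s \<Otimes>\<^sub>M gaussian 0 t) borel (\<lambda>(u, v). u + v))"
  then have [measurable]: "A \<in> sets borel" by simp
  have "emeasure (distr (gaussian 0 s \<Otimes>\<^sub>M gaussian 0 t) borel (\<lambda>(u, v). u + v)) A
      = (\<integral>\<^sup>+z. indicator A (fst z + snd z) \<partial>(gaussian 0 s \<Otimes>\<^sub>M gaussian 0 t))"
    by (subst nn_integral_indicator[symmetric], simp, subst nn_integral_distr) (auto simp: case_prod_beta)
  also have "\<dots> = (\<integral>\<^sup>+u. \<integral>\<^sup>+v. indicator A (u + v) \<partial>gaussian 0 t \<partial>gaussian 0 s)"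
    by (subst t.nn_integral_fst[symmetric]) auto
  also have "\<dots> = emeasure (gaussian 0 (s + t)) A"
    by (subst nn_integral_gaussian_add[OF st]) auto
  finally show "emeasure (distr (gaussian 0 s \<Otimes>\<^sub>M gaussian 0 t) borel (\<lambda>(u, v). u + v)) A = emeasure (gaussian 0 (s + t)) A" .
qed simp

section \<open>The heat operator and local variances\<close>

lemma expectation_pair:
  fixes f :: "'b \<times> 'c \<Rightarrow> real"
  assumes "prob_space M" "prob_space N" and [measurable]: "f \<in> borel_measurable (M \<Otimes>\<^sub>M N)"
    and B: "\<And>z. \<bar>f z\<bar> \<le> B"
  shows "(\<integral>z. f z \<partial>(M \<Otimes>\<^sub>M N)) = (\<integral>x. \<integral>y. f (x, y) \<partial>N \<partial>M)"
proof -
  interpret M: prob_space M by fact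
  interpret N: prob_space N by fact
  interpret pair_prob_space M N ..
  have "integrable (M \<Otimes>\<^sub>M N) f" by (rule integrable_of_bounded[OF _ B]) simp
  then show ?thesis by (rule integral_fst'[symmetric])
qed

lemma expectation_swap:
  fixes f :: "'b \<Rightarrow> 'c \<Rightarrow> real"
  assumes "prob_space M" "prob_space N" and [measurable]: "case_prod f \<in> borel_measurable (M \<Otimes>\<^sub>M N)"
    and B: "\<And>x y. \<bar>f x y\<bar> \<le> B"
  shows "(\<integral>x. \<integral>y. f x y \<partial>N \<partial>M) = (\<integral>y. \<integral>x. f x y \<partial>M \<partial>N)"
proof -
  interpret M: prob_space M by fact
  interpret N: prob_space N by fact
  interpret pair_prob_space M N ..
  have "integrable (M \<Otimes>\<^sub>M N) (case_prod f)" by (rule integrable_of_bounded[where B = B]) (auto simp: B)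
  then show ?thesis by (rule Fubini_integral[symmetric])
qed

lemma abs_expectation_le:
  fixes f :: "'b \<Rightarrow> real"
  assumes "prob_space M" "\<And>x. \<bar>f x\<bar> \<le> B"
  shows "\<bar>\<integral>x. f x \<partial>M\<bar> \<le> B"
proof -
  interpret prob_space M by fact
  show ?thesis
  proof (cases "integrable M f")
    case True
    then have "expectation (\<lambda>x. \<bar>f x\<bar>) \<le> B" by (intro integral_le_const) (use assms(2) in auto)
    then show ?thesis using integral_abs_bound[of M f] by linarith
  next
    case False
    then show ?thesis using assms(2)[of undefined] by (simp add: not_integrable_integral_eq)
  qed
qed

text \<open>
  The class of test functions. It is closed under all the operators below, and every member is integrable
  with respect to any probability measure.
\<close>

definition bounded_borel :: "('a::euclidean_space \<Rightarrow> real) \<Rightarrow> bool" where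
  "bounded_borel b \<longleftrightarrow> b \<in> borel_measurable borel \<and> (\<exists>B. \<forall>x. \<bar>b x\<bar> \<le> B)"

lemma bounded_borelI: "b \<in> borel_measurable borel \<Longrightarrow> (\<And>x. \<bar>b x\<bar> \<le> B) \<Longrightarrow> bounded_borel b"
  by (auto simp: bounded_borel_def)

lemma bounded_borel_measurable [measurable_dest]: "bounded_borel b \<Longrightarrow> b \<in> borel_measurable borel"
  by (simp add: bounded_borel_def)

lemma bounded_borelE:
  assumes "bounded_borel b" obtains B where "B \<ge> 0" "\<And>x. \<bar>b x\<bar> \<le> B"
proof -
  obtain B where B: "\<And>x. \<bar>b x\<bar> \<le> B" using assms by (auto simp: bounded_borel_def)
  moreover have "B \<ge> 0" using B[of undefined] by linarith
  ultimately show ?thesis using that by blast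
qed

lemma bounded_borel_const [simp]: "bounded_borel (\<lambda>x. c)"
  by (rule bounded_borelI[where B = "\<bar>c\<bar>"]) auto

lemma bounded_borel_diff: 
  assumes b: "bounded_borel b" and c: "bounded_borel c" shows "bounded_borel (\<lambda>x. b x - c x)"
proof -
  note [measurable] = bounded_borel_measurable[OF b] bounded_borel_measurable[OF c]
  obtain B where B: "\<And>x. \<bar>b x\<bar> \<le> B" using b by (auto simp: bounded_borel_def)
  obtain C where C: "\<And>x. \<bar>c x\<bar> \<le> C" using c by (auto simp: bounded_borel_def)
  have "\<bar>b x - c x\<bar> \<le> B + C" for x using B[of x] C[of x] by linarith
  then show ?thesis by (intro bounded_borelI) auto
qed

lemma bounded_borel_mult: 
  assumes b: "bounded_borel b" and c: "bounded_borel c" shows "bounded_borel (\<lambda>x. b x * c x)"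
proof -
  note [measurable] = bounded_borel_measurable[OF b] bounded_borel_measurable[OF c]
  obtain B where B: "B \<ge> 0" "\<And>x. \<bar>b x\<bar> \<le> B" using bounded_borelE[OF b] by blast
  obtain C where C: "\<And>x. \<bar>c x\<bar> \<le> C" using c by (auto simp: bounded_borel_def)
  have "\<bar>b x * c x\<bar> \<le> B * C" for x unfolding abs_mult using B C[of x] by (intro mult_mono) auto
  then show ?thesis by (intro bounded_borelI) auto
qed

lemma bounded_borel_square: "bounded_borel b \<Longrightarrow> bounded_borel (\<lambda>x. (b x)\<^sup>2)"
  unfolding power2_eq_square by (intro bounded_borel_mult)

lemma bounded_borel_shift:
  assumes b: "bounded_borel b" shows "bounded_borel (\<lambda>u. b (x + u))"
  using b by (auto simp: bounded_borel_def)

lemma bounded_borel_integrable: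
  assumes "prob_space M" "sets M = sets borel" "bounded_borel b"
  shows "integrable M b"
proof -
  interpret prob_space M by fact
  obtain B where B: "\<And>x. \<bar>b x\<bar> \<le> B" using assms by (auto simp: bounded_borel_def)
  have "b \<in> borel_measurable M" using assms(2,3) by (simp add: bounded_borel_def cong: measurable_cong_sets)
  then show ?thesis using B by (rule integrable_of_bounded)
qed

text \<open>
  The heat semigroup with generator half the Laplacian: the mean of \<open>b\<close> after adding centred Gaussian noise of variance \<open>t\<close>.
\<close>

definition heat :: "real \<Rightarrow> ('a::euclidean_space \<Rightarrow> real) \<Rightarrow> 'a \<Rightarrow> real" where
  "heat t b x = (\<integral>u. b (x + u) \<partial>gaussian 0 t)"

lemma heat_measurable [measurable]:
  fixes b :: "'a::euclidean_space \<Rightarrow> real"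
  assumes "t > 0" and [measurable]: "b \<in> borel_measurable borel"
  shows "heat t b \<in> borel_measurable borel"
proof -
  interpret prob_space "gaussian (0::'a) t" by (rule prob_space_gaussian[OF assms(1)])
  show ?thesis unfolding heat_def by measurable
qed

lemma heat_integrable:
  assumes "t > 0" "bounded_borel b"
  shows "integrable (gaussian 0 t) (\<lambda>u. b (x + u))"
  by (rule bounded_borel_integrable[OF prob_space_gaussian[OF assms(1)] _ bounded_borel_shift[OF assms(2)]]) simp

lemma abs_heat_le: "t > 0 \<Longrightarrow> (\<And>x. \<bar>b x\<bar> \<le> B) \<Longrightarrow> \<bar>heat t b x\<bar> \<le> B"
  unfolding heat_def by (intro abs_expectation_le prob_space_gaussian)

lemma heat_bounded_borel:
  assumes "t > 0" "bounded_borel b" shows "bounded_borel (heat t b)"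
proof -
  obtain B where "\<And>x. \<bar>b x\<bar> \<le> B" using assms by (auto simp: bounded_borel_def)
  then show ?thesis using assms by (intro bounded_borelI[where B = B] heat_measurable abs_heat_le) (auto simp: bounded_borel_def)
qed

lemma heat_const [simp]: "t > 0 \<Longrightarrow> heat t (\<lambda>x. c) = (\<lambda>x. c)"
  using prob_space.prob_space[OF prob_space_gaussian] by (auto simp: heat_def fun_eq_iff)

lemma heat_mono:
  assumes "t > 0" "bounded_borel b" "bounded_borel c" "\<And>x. b x \<le> c x"
  shows "heat t b x \<le> heat t c x"
  unfolding heat_def using assms by (intro integral_mono heat_integrable) auto

lemma heat_heat:
  fixes b :: "'a::euclidean_space \<Rightarrow> real"
  assumes st: "s > 0" "t > 0" and b: "bounded_borel b"
  shows "heat s (heat t b) = heat (s + t) b"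
proof
  fix x :: 'a
  obtain B where B: "\<And>x. \<bar>b x\<bar> \<le> B" using b by (auto simp: bounded_borel_def)
  note [measurable] = bounded_borel_measurable[OF b]
  have "heat (s + t) b x = (\<integral>w. b (x + w) \<partial>distr (gaussian 0 s \<Otimes>\<^sub>M gaussian 0 t) borel (\<lambda>(u, v). u + v))"
    unfolding heat_def distr_gaussian_add[OF st] ..
  also have "\<dots> = (\<integral>z. b (x + (fst z + snd z)) \<partial>(gaussian 0 s \<Otimes>\<^sub>M gaussian 0 t))"
    by (subst integral_distr) (auto simp: case_prod_beta)
  also have "\<dots> = (\<integral>u. \<integral>v. b (x + (u + v)) \<partial>gaussian 0 t \<partial>gaussian 0 s)"
    using st B by (subst expectation_pair) (auto intro!: prob_space_gaussian)
  also have "\<dots> = heat s (heat t b) x" by (simp add: heat_def add.assoc)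
  finally show "heat s (heat t b) x = heat (s + t) b x" ..
qed

text \<open>
  The conditional variance of \<open>b\<close> at the noisy position, given the starting point \<open>x\<close>.
\<close>

definition heat_var :: "real \<Rightarrow> ('a::euclidean_space \<Rightarrow> real) \<Rightarrow> 'a \<Rightarrow> real" where
  "heat_var t b x = heat t (\<lambda>y. (b y)\<^sup>2) x - (heat t b x)\<^sup>2"

lemma heat_var_bounded_borel: "t > 0 \<Longrightarrow> bounded_borel b \<Longrightarrow> bounded_borel (heat_var t b)"
  unfolding heat_var_def by (intro bounded_borel_diff bounded_borel_square heat_bounded_borel)

lemma heat_square_dist:
  fixes b :: "'a::euclidean_space \<Rightarrow> real"
  assumes t: "t > 0" and b: "bounded_borel b"
  shows "(\<integral>u. (b (x + u) - c)\<^sup>2 \<partial>gaussian 0 t) = heat_var t b x + (heat t b x - c)\<^sup>2"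
proof -
  interpret prob_space "gaussian (0::'a) t" by (rule prob_space_gaussian[OF t])
  have "(\<integral>u. (b (x + u) - c)\<^sup>2 \<partial>gaussian 0 t) = (\<integral>u. (b (x + u))\<^sup>2 - 2 * c * b (x + u) + c\<^sup>2 \<partial>gaussian 0 t)"
    by (intro Bochner_Integration.integral_cong) (auto simp: power2_diff)
  also have "\<dots> = heat t (\<lambda>y. (b y)\<^sup>2) x - 2 * c * heat t b x + c\<^sup>2"
    using heat_integrable[OF t bounded_borel_square[OF b]] heat_integrable[OF t b] prob_space
    by (simp add: heat_def)
  finally show ?thesis by (simp add: heat_var_def power2_diff)
qed

lemma heat_var_eq:
  assumes "t > 0" "bounded_borel b"
  shows "heat_var t b x = (\<integral>u. (b (x + u) - heat t b x)\<^sup>2 \<partial>gaussian 0 t)"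
  by (simp add: heat_square_dist[OF assms])

lemma heat_var_nonneg: "t > 0 \<Longrightarrow> bounded_borel b \<Longrightarrow> heat_var t b x \<ge> 0"
  by (simp add: heat_var_eq)

text \<open>
  Averaging commutes with translations, so the fluctuation of the average is the average of the
  fluctuations, and squaring is convex.
\<close>

lemma heat_var_heat_le:
  fixes b :: "'a::euclidean_space \<Rightarrow> real"
  assumes t: "t > 0" and b: "bounded_borel b"
  shows "heat_var t (heat t b) x \<le> heat t (heat_var t b) x"
proof -
  note hb = heat_bounded_borel[OF t b]
  note [measurable] = bounded_borel_measurable[OF b] bounded_borel_measurable[OF hb]
  interpret prob_space "gaussian (0::'a) t" by (rule prob_space_gaussian[OF t])
  obtain B where B: "B \<ge> 0" "\<And>x. \<bar>b x\<bar> \<le> B" using bounded_borelE[OF b] by blast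
  have hB: "\<bar>heat t b y\<bar> \<le> B" for y by (rule abs_heat_le[OF t B(2)])
  define F where "F u w = (b (x + w + u) - heat t b (x + w))\<^sup>2" for u w
  have FB: "\<bar>F u w\<bar> \<le> (2 * B)\<^sup>2" for u w
  proof -
    have "\<bar>b (x + w + u) - heat t b (x + w)\<bar> \<le> 2 * B" using B(2)[of "x + w + u"] hB[of "x + w"] by linarith
    then show ?thesis unfolding F_def using power_mono[of "\<bar>b (x + w + u) - heat t b (x + w)\<bar>" "2 * B" 2] by simp
  qed
  have Fm: "(\<lambda>(u, w). F u w) \<in> borel_measurable (gaussian 0 t \<Otimes>\<^sub>M gaussian 0 t)" unfolding F_def by measurable
  have eq: "heat t b (x + u) - heat t (heat t b) x = (\<integral>w. b (x + w + u) - heat t b (x + w) \<partial>gaussian 0 t)" for u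
  proof -
    have "integrable (gaussian 0 t) (\<lambda>w. b (x + w + u))"
      using heat_integrable[OF t b, of "x + u"] by (simp add: ac_simps)
    then show ?thesis
      using heat_integrable[OF t hb, of x] by (simp add: heat_def ac_simps)
  qed
  \<comment> \<open>Both sides integrate the squared increments over two independent Gaussian moves; Jensen acts in the outer one.\<close>
  have "(heat t b (x + u) - heat t (heat t b) x)\<^sup>2 \<le> (\<integral>w. F u w \<partial>gaussian 0 t)" for u
  proof -
    have "bounded_borel (\<lambda>w. b (x + w + u) - heat t b (x + w))"
      using bounded_borel_shift[OF b, of "x + u"] bounded_borel_shift[OF hb, of x]
      by (intro bounded_borel_diff) (auto simp: ac_simps)
    from bounded_borel_integrable[OF prob_space_gaussian[OF t, of 0] _ this]
      bounded_borel_integrable[OF prob_space_gaussian[OF t, of 0] _ bounded_borel_square[OF this]]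
    show ?thesis unfolding eq F_def
      using variance_positive[of "\<lambda>w. b (x + w + u) - heat t b (x + w)"] variance_eq by force
  qed
  then have "heat_var t (heat t b) x \<le> (\<integral>u. \<integral>w. F u w \<partial>gaussian 0 t \<partial>gaussian 0 t)"
    unfolding heat_var_eq[OF t hb]
  proof (intro integral_mono)
    show "integrable (gaussian 0 t) (\<lambda>u. (heat t b (x + u) - heat t (heat t b) x)\<^sup>2)"
      by (rule bounded_borel_integrable[OF prob_space_axioms _
            bounded_borel_square[OF bounded_borel_diff[OF bounded_borel_shift[OF hb] bounded_borel_const]]]) simp
    show "integrable (gaussian 0 t) (\<lambda>u. \<integral>w. F u w \<partial>gaussian 0 t)"
    proof (rule integrable_of_bounded[OF _ abs_expectation_le[OF prob_space_axioms FB]])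
      show "(\<lambda>u. \<integral>w. F u w \<partial>gaussian 0 t) \<in> borel_measurable (gaussian 0 t)"
        using Fm by (rule borel_measurable_lebesgue_integral)
    qed
  qed auto
  also have "\<dots> = (\<integral>w. \<integral>u. F u w \<partial>gaussian 0 t \<partial>gaussian 0 t)"
    by (rule expectation_swap[OF prob_space_axioms prob_space_axioms Fm FB])
  also have "\<dots> = heat t (heat_var t b) x"
    unfolding heat_def[of t "heat_var t b"] heat_var_eq[OF t b] F_def ..
  finally show ?thesis .
qed

text \<open>The law of a point of law \<open>\<mu>\<close> after adding independent Gaussian noise.\<close>

definition smear :: "'a::euclidean_space measure \<Rightarrow> real \<Rightarrow> 'a measure" where
  "smear \<mu> t = distr (\<mu> \<Otimes>\<^sub>M gaussian 0 t) borel (\<lambda>(x, u). x + u)"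

lemma sets_smear [measurable_cong, simp]: "sets (smear \<mu> t) = sets borel"
  by (simp add: smear_def)

lemma prob_space_smear:
  fixes \<mu> :: "'a::euclidean_space measure"
  assumes "t > 0" "prob_space \<mu>" and [measurable_cong]: "sets \<mu> = sets borel"
  shows "prob_space (smear \<mu> t)"
proof -
  interpret M: prob_space \<mu> by fact
  interpret N: prob_space "gaussian (0::'a) t" by (rule prob_space_gaussian[OF assms(1)])
  interpret pair_prob_space \<mu> "gaussian (0::'a) t" ..
  show ?thesis unfolding smear_def by (rule prob_space_distr) measurable
qed

lemma integral_smear:
  fixes \<mu> :: "'a::euclidean_space measure"
  assumes t: "t > 0" and mu: "prob_space \<mu>" and [measurable_cong]: "sets \<mu> = sets borel" and b: "bounded_borel b"
  shows "(\<integral>x. b x \<partial>smear \<mu> t) = (\<integral>x. heat t b x \<partial>\<mu>)"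
proof -
  note [measurable] = bounded_borel_measurable[OF b]
  obtain B where B: "\<And>x. \<bar>b x\<bar> \<le> B" using b by (auto simp: bounded_borel_def)
  have "(\<integral>x. b x \<partial>smear \<mu> t) = (\<integral>z. b (fst z + snd z) \<partial>(\<mu> \<Otimes>\<^sub>M gaussian 0 t))"
    unfolding smear_def by (subst integral_distr) (auto simp: case_prod_beta)
  also have "\<dots> = (\<integral>x. heat t b x \<partial>\<mu>)" unfolding heat_def
    using B by (subst expectation_pair[OF mu prob_space_gaussian[OF t]]) auto
  finally show ?thesis .
qed

lemma measure_eq_of_bounded_integrals:
  fixes \<mu> \<nu> :: "'a::euclidean_space measure"
  assumes "prob_space \<mu>" "prob_space \<nu>" and s: "sets \<mu> = sets borel" "sets \<nu> = sets borel"
    and eq: "\<And>b. bounded_borel b \<Longrightarrow> (\<integral>x. b x \<partial>\<mu>) = (\<integral>x. b x \<partial>\<nu>)"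
  shows "\<mu> = \<nu>"
proof (rule measure_eqI)
  interpret M: prob_space \<mu> by fact
  interpret N: prob_space \<nu> by fact
  fix A assume A: "A \<in> sets \<mu>"
  then have "bounded_borel (indicator A)" using s by (intro bounded_borelI[where B = 1]) (auto simp: indicator_def)
  from eq[OF this] have "measure \<mu> A = measure \<nu> A" using A s by simp
  then show "emeasure \<mu> A = emeasure \<nu> A" by (simp add: M.emeasure_eq_measure N.emeasure_eq_measure)
qed (simp add: s)

lemma smear_smear:
  fixes \<mu> :: "'a::euclidean_space measure"
  assumes st: "s > 0" "t > 0" and mu: "prob_space \<mu>" "sets \<mu> = sets borel"
  shows "smear (smear \<mu> s) t = smear \<mu> (s + t)"
proof (rule measure_eq_of_bounded_integrals)
  note pm = prob_space_smear[OF st(1) mu]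
  show "prob_space (smear (smear \<mu> s) t)" by (rule prob_space_smear[OF st(2) pm]) simp
  show "prob_space (smear \<mu> (s + t))" using st by (intro prob_space_smear mu) auto
  show "(\<integral>x. b x \<partial>smear (smear \<mu> s) t) = (\<integral>x. b x \<partial>smear \<mu> (s + t))" if b: "bounded_borel b" for b
  proof -
    have "(\<integral>x. b x \<partial>smear (smear \<mu> s) t) = (\<integral>x. heat t b x \<partial>smear \<mu> s)"
      by (rule integral_smear[OF st(2) pm _ b]) simp
    also have "\<dots> = (\<integral>x. heat s (heat t b) x \<partial>\<mu>)"
      by (rule integral_smear[OF st(1) mu heat_bounded_borel[OF st(2) b]])
    also have "\<dots> = (\<integral>x. b x \<partial>smear \<mu> (s + t))"
      unfolding heat_heat[OF st b] using st by (intro integral_smear[symmetric] mu b) auto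
    finally show ?thesis .
  qed
qed simp_all

section \<open>Likelihood ratios of shifted Gaussians\<close>

lemma gauss_nn_integral_exp_square:
  assumes t: "t > 0"
  shows "(\<integral>\<^sup>+u. ennreal (exp ((norm u)\<^sup>2 / (4 * t))) \<partial>gaussian (0::'a::euclidean_space) t) = ennreal (sqrt 2 ^ DIM('a))"
proof -
  have "(\<integral>\<^sup>+u. ennreal (exp ((norm u)\<^sup>2 / (4 * t))) \<partial>gaussian (0::'a) t)
      = (\<integral>\<^sup>+u. ennreal (gauss_density t (u - 0)) * ennreal (exp ((norm (u::'a))\<^sup>2 / (4 * t))) \<partial>lborel)"
    by (rule nn_integral_gaussian[OF t]) simp
  also have "\<dots> = (\<integral>\<^sup>+u. ennreal (sqrt 2 ^ DIM('a)) * ennreal (gauss_density (2 * t) (u::'a)) \<partial>lborel)"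
  proof (rule nn_integral_cong)
    fix u :: 'a
    have "sqrt (2 * pi * (2 * t)) = sqrt 2 * sqrt (2 * pi * t)"
      by (simp add: real_sqrt_mult)
    then have "sqrt (2 * pi * (2 * t)) ^ DIM('a) = sqrt 2 ^ DIM('a) * sqrt (2 * pi * t) ^ DIM('a)"
      by (simp only: power_mult_distrib)
    moreover have "- (norm u)\<^sup>2 / (2 * t) + (norm u)\<^sup>2 / (4 * t) = - (norm u)\<^sup>2 / (2 * (2 * t))" using t by (simp add: field_simps)
    then have "exp (- (norm u)\<^sup>2 / (2 * t)) * exp ((norm u)\<^sup>2 / (4 * t)) = exp (- (norm u)\<^sup>2 / (2 * (2 * t)))"
      by (simp only: mult_exp_exp)
    ultimately have "gauss_density t u * exp ((norm u)\<^sup>2 / (4 * t)) = sqrt 2 ^ DIM('a) * gauss_density (2 * t) u"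
      by (simp add: gauss_density_def)
    then show "ennreal (gauss_density t (u - 0)) * ennreal (exp ((norm u)\<^sup>2 / (4 * t)))
        = ennreal (sqrt 2 ^ DIM('a)) * ennreal (gauss_density (2 * t) u)"
      using t by (simp add: gauss_density_nonneg flip: ennreal_mult)
  qed
  also have "\<dots> = ennreal (sqrt 2 ^ DIM('a))"
    using t by (subst nn_integral_cmult) (auto simp: gauss_density_nn_integral)
  finally show ?thesis .
qed

lemma abs_exp_minus_one_le: "\<bar>exp a - 1\<bar> \<le> \<bar>a\<bar> * exp \<bar>a\<bar>" for a :: real
proof (cases "a \<ge> 0")
  case True
  have "1 - a \<le> exp (- a)" using exp_ge_add_one_self[of "- a"] by simp
  then have "exp a * (1 - a) \<le> 1" using mult_left_mono[of "1 - a" "exp (- a)" "exp a"] by (simp flip: exp_add)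
  then show ?thesis using True by (simp add: algebra_simps)
next
  case False
  have "1 - exp a \<le> - a" using exp_ge_add_one_self[of a] by linarith
  moreover have "- a * 1 \<le> - a * exp (- a)" using False by (intro mult_left_mono) auto
  moreover have "\<bar>exp a - 1\<bar> = 1 - exp a" "\<bar>a\<bar> * exp \<bar>a\<bar> = - a * exp (- a)" using False by simp_all
  ultimately show ?thesis by linarith
qed

lemma gauss_density_ratio:
  assumes "t > 0"
  shows "gauss_density t (u + v) = gauss_density t u * exp (- (2 * (u \<bullet> v) + (norm v)\<^sup>2) / (2 * t))"
proof -
  have "(norm (u + v))\<^sup>2 = (norm u)\<^sup>2 + 2 * (u \<bullet> v) + (norm v)\<^sup>2"
    unfolding power2_norm_eq_inner by (simp add: inner_add inner_commute)
  then have "- (norm (u + v))\<^sup>2 / (2 * t) = - (norm u)\<^sup>2 / (2 * t) + - (2 * (u \<bullet> v) + (norm v)\<^sup>2) / (2 * t)"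
    by (simp add: add_divide_distrib diff_divide_distrib)
  then have "exp (- (norm (u + v))\<^sup>2 / (2 * t)) = exp (- (norm u)\<^sup>2 / (2 * t)) * exp (- (2 * (u \<bullet> v) + (norm v)\<^sup>2) / (2 * t))"
    by (simp only: exp_add)
  then show ?thesis by (simp add: gauss_density_def)
qed

text \<open>
  The logarithm of the ratio is \<open>- (2 (u \<bullet> v) + (norm v)\<^sup>2) / (2 t)\<close>. When \<open>u\<close> and \<open>v\<close> are of their typical sizes
  \<open>sqrt t\<close> and \<open>sqrt \<delta>\<close> it is of order \<open>sqrt (\<delta> / t)\<close>. The exponentials leave room for atypical sizes and are
  still integrable against the two Gaussians.
\<close>

lemma gauss_ratio_cube_pointwise:
  fixes u v :: "'a::euclidean_space"
  assumes t: "t > 0" and d: "\<delta> > 0" and r: "24 * sqrt (\<delta> / t) \<le> 1"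
  shows "\<bar>gauss_density t (u + v) / gauss_density t u - 1\<bar> ^ 3
    \<le> 13824 * sqrt (\<delta> / t) ^ 3 * (exp ((norm u)\<^sup>2 / (4 * t)) * exp ((norm v)\<^sup>2 / (4 * \<delta>)))"
proof -
  define r where "r = sqrt (\<delta> / t)"
  define S where "S = (norm u)\<^sup>2 / t + (norm v)\<^sup>2 / \<delta>"
  define a where "a = - (2 * (u \<bullet> v) + (norm v)\<^sup>2) / (2 * t)"
  have r0: "r > 0" "24 * r \<le> 1" using t d r by (simp_all add: r_def)
  have S0: "S \<ge> 0" using t d by (simp add: S_def)
  have rsq: "r\<^sup>2 = \<delta> / t" using t d by (simp add: r_def)
  have aS: "\<bar>a\<bar> \<le> r * S"
  proof -
    define x where "x = norm u / sqrt t"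
    define y where "y = norm v / sqrt \<delta>"
    have xy: "x \<ge> 0" "y \<ge> 0" using t d by (simp_all add: x_def y_def)
    have x2: "x\<^sup>2 = (norm u)\<^sup>2 / t" and y2: "y\<^sup>2 = (norm v)\<^sup>2 / \<delta>" using t d by (simp_all add: x_def y_def power_divide)
    have "norm u * norm v / t = r * (x * y)"
      using t d by (simp add: r_def x_def y_def real_sqrt_divide field_simps)
    moreover have "2 * (x * y) \<le> x\<^sup>2 + y\<^sup>2" using sum_squares_bound[of x y] by simp
    then have "r * (2 * (x * y)) \<le> r * (x\<^sup>2 + y\<^sup>2)" using r0 by (intro mult_left_mono) auto
    moreover have "(norm v)\<^sup>2 / t = r\<^sup>2 * y\<^sup>2" using t d by (simp add: rsq y2)
    moreover have "r\<^sup>2 * y\<^sup>2 \<le> r * y\<^sup>2" using r0 by (intro mult_right_mono) (auto simp: power2_eq_square)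
    moreover have "0 \<le> r * x\<^sup>2" using r0 by simp
    moreover have "\<bar>a\<bar> \<le> norm u * norm v / t + (norm v)\<^sup>2 / t / 2"
    proof -
      have "\<bar>2 * (u \<bullet> v) + (norm v)\<^sup>2\<bar> \<le> 2 * (norm u * norm v) + (norm v)\<^sup>2"
        using Cauchy_Schwarz_ineq2[of u v] zero_le_power2[of "norm v"] by linarith
      then have "\<bar>a\<bar> \<le> (2 * (norm u * norm v) + (norm v)\<^sup>2) / (2 * t)"
        unfolding a_def using t by (simp add: divide_right_mono)
      then show ?thesis by (simp add: add_divide_distrib)
    qed
    ultimately show ?thesis unfolding S_def x2[symmetric] y2[symmetric] by (simp add: algebra_simps)
  qed
  have "gauss_density t (u + v) / gauss_density t u = exp a"
    unfolding gauss_density_ratio[OF t] a_def using gauss_density_pos[OF t, of u] by simp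
  then have "\<bar>gauss_density t (u + v) / gauss_density t u - 1\<bar> ^ 3 \<le> (\<bar>a\<bar> * exp \<bar>a\<bar>) ^ 3"
    using abs_exp_minus_one_le[of a] by (simp add: power_mono)
  also have "\<dots> \<le> (r * S * exp (S / 24)) ^ 3"
  proof -
    have "r * S \<le> S / 24" using r0 S0 mult_right_mono[of "24 * r" 1 S] by simp
    then have "\<bar>a\<bar> \<le> S / 24" using aS by linarith
    then show ?thesis using aS S0 r0 by (intro power_mono mult_mono) auto
  qed
  also have "\<dots> = r ^ 3 * S ^ 3 * exp (S / 8)"
    by (simp add: power_mult_distrib flip: exp_of_nat_mult)
  also have "\<dots> \<le> r ^ 3 * (13824 * exp (S / 8)) * exp (S / 8)"
  proof -
    have "S / 24 \<le> exp (S / 24)" using exp_ge_add_one_self[of "S / 24"] by linarith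
    then have "(S / 24) ^ 3 \<le> exp (S / 24) ^ 3" using S0 by (intro power_mono) auto
    then have "S ^ 3 \<le> 13824 * exp (S / 8)" by (simp add: power_divide flip: exp_of_nat_mult)
    then show ?thesis using r0 by (intro mult_right_mono mult_left_mono) auto
  qed
  also have "\<dots> = 13824 * r ^ 3 * exp (S / 4)" by (simp add: mult_exp_exp)
  also have "exp (S / 4) = exp ((norm u)\<^sup>2 / (4 * t)) * exp ((norm v)\<^sup>2 / (4 * \<delta>))"
    by (simp add: S_def mult_exp_exp add_divide_distrib mult.commute)
  finally show ?thesis by (simp add: r_def)
qed

text \<open>
  The third moment of the relative change of a Gaussian density under a Gaussian shift. It is the only source
  of the error terms, for the forward as well as for the backward steps; the sign \<open>s\<close> accommodates both.
\<close>

lemma gauss_ratio_cube_integral: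
  assumes t: "t > 0" and d: "\<delta> > 0" and r: "24 * sqrt (\<delta> / t) \<le> 1" and s: "\<bar>s\<bar> = 1"
  shows "(\<integral>\<^sup>+v. \<integral>\<^sup>+u. ennreal (\<bar>gauss_density t (u + s *\<^sub>R v) / gauss_density t u - 1\<bar> ^ 3)
      \<partial>gaussian 0 t \<partial>gaussian (0::'a::euclidean_space) \<delta>)
    \<le> ennreal (13824 * 2 ^ DIM('a) * sqrt (\<delta> / t) ^ 3)"
proof -
  define c where "c = 13824 * sqrt (\<delta> / t) ^ 3"
  have c0: "c \<ge> 0" using t d by (simp add: c_def)
  have "(\<integral>\<^sup>+v. \<integral>\<^sup>+u. ennreal (\<bar>gauss_density t (u + s *\<^sub>R v) / gauss_density t u - 1\<bar> ^ 3) \<partial>gaussian 0 t \<partial>gaussian (0::'a) \<delta>)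
     \<le> (\<integral>\<^sup>+v. \<integral>\<^sup>+u. ennreal c * (ennreal (exp ((norm v)\<^sup>2 / (4 * \<delta>))) * ennreal (exp ((norm u)\<^sup>2 / (4 * t)))) \<partial>gaussian (0::'a) t \<partial>gaussian (0::'a) \<delta>)"
  proof (intro nn_integral_mono)
    fix v u :: 'a
    have "norm (s *\<^sub>R v) = norm v" using s by simp
    then have "\<bar>gauss_density t (u + s *\<^sub>R v) / gauss_density t u - 1\<bar> ^ 3
      \<le> c * (exp ((norm v)\<^sup>2 / (4 * \<delta>)) * exp ((norm u)\<^sup>2 / (4 * t)))"
      using gauss_ratio_cube_pointwise[OF t d r, of u "s *\<^sub>R v"] by (simp only: c_def mult.commute)
    then show "ennreal (\<bar>gauss_density t (u + s *\<^sub>R v) / gauss_density t u - 1\<bar> ^ 3)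
      \<le> ennreal c * (ennreal (exp ((norm v)\<^sup>2 / (4 * \<delta>))) * ennreal (exp ((norm u)\<^sup>2 / (4 * t))))"
      using c0 by (simp flip: ennreal_mult)
  qed
  also have "\<dots> = ennreal c * (ennreal (sqrt 2 ^ DIM('a)) * ennreal (sqrt 2 ^ DIM('a)))"
    by (simp add: nn_integral_cmult nn_integral_multc gauss_nn_integral_exp_square[OF t] gauss_nn_integral_exp_square[OF d])
  also have "\<dots> = ennreal (13824 * 2 ^ DIM('a) * sqrt (\<delta> / t) ^ 3)"
    using c0 by (simp add: c_def mult_ac power_mult_distrib[symmetric] flip: ennreal_mult)
  finally show ?thesis .
qed

lemma gaussian_exp_square_integrable:
  assumes t: "t > 0"
  shows "integrable (gaussian (0::'a::euclidean_space) t) (\<lambda>u. exp ((norm u)\<^sup>2 / (4 * t)))"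
    and "(\<integral>u. exp ((norm u)\<^sup>2 / (4 * t)) \<partial>gaussian (0::'a) t) = sqrt 2 ^ DIM('a)"
proof -
  show *: "integrable (gaussian (0::'a) t) (\<lambda>u. exp ((norm u)\<^sup>2 / (4 * t)))"
    using gauss_nn_integral_exp_square[OF t, where 'a = 'a] by (intro integrableI_nonneg) auto
  show "(\<integral>u. exp ((norm u)\<^sup>2 / (4 * t)) \<partial>gaussian (0::'a) t) = sqrt 2 ^ DIM('a)"
    using gauss_nn_integral_exp_square[OF t, where 'a = 'a] nn_integral_eq_integral[OF *]
    by (simp add: integral_nonneg_AE)
qed

section \<open>Smoothness and gradient bounds for heat averages\<close>

lemma exp_minus_one_minus_le: "\<bar>exp a - 1 - a\<bar> \<le> a\<^sup>2 * exp \<bar>a\<bar>" for a :: real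
proof -
  have "1 - a \<le> exp (- a)" using exp_ge_add_one_self[of "- a"] by simp
  then have "exp a * (1 - a) \<le> 1" using mult_left_mono[of "1 - a" "exp (- a)" "exp a"] by (simp flip: exp_add)
  then have "exp a - 1 - a \<le> a * (exp a - 1)" by (simp add: algebra_simps)
  also have "\<dots> \<le> \<bar>a\<bar> * (\<bar>a\<bar> * exp \<bar>a\<bar>)"
    using mult_left_mono[OF abs_exp_minus_one_le[of a] abs_ge_zero[of a]] abs_ge_self[of "a * (exp a - 1)"]
    unfolding abs_mult by linarith
  finally have "exp a - 1 - a \<le> a\<^sup>2 * exp \<bar>a\<bar>" by (simp add: power2_eq_square abs_mult_self_eq flip: mult.assoc)
  moreover have "0 \<le> exp a - 1 - a" using exp_ge_add_one_self[of a] by linarith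
  ultimately show ?thesis by simp
qed

text \<open>
  The density, with respect to centred Gaussian noise of variance \<open>t\<close>, of the same noise translated by \<open>h\<close>
  (Cameron--Martin).
\<close>

definition shift_weight :: "real \<Rightarrow> 'a::euclidean_space \<Rightarrow> 'a \<Rightarrow> real" where
  "shift_weight t h u = exp ((u \<bullet> h) / t - (norm h)\<^sup>2 / (2 * t))"

lemma shift_weight_measurable [measurable]: "shift_weight t h \<in> borel_measurable borel"
  unfolding shift_weight_def by measurable

lemma gauss_density_shift_weight:
  assumes "t > 0" shows "gauss_density t (u - h) = gauss_density t u * shift_weight t h u"
proof -
  have "- (2 * (u \<bullet> - h) + (norm (- h))\<^sup>2) / (2 * t) = (u \<bullet> h) / t - (norm h)\<^sup>2 / (2 * t)"
    using assms by (simp add: field_simps)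
  then show ?thesis using gauss_density_ratio[OF assms, of u "- h"] by (simp add: shift_weight_def)
qed

lemma shift_weight_nn_integral:
  fixes f :: "'a::euclidean_space \<Rightarrow> ennreal"
  assumes t: "t > 0" and [measurable]: "f \<in> borel_measurable borel"
  shows "(\<integral>\<^sup>+u. f (h + u) \<partial>gaussian 0 t) = (\<integral>\<^sup>+u. f u * ennreal (shift_weight t h u) \<partial>gaussian 0 t)"
  unfolding nn_integral_gaussian_shift[OF t assms(2)]
  by (subst nn_integral_gaussian[OF t], simp, subst nn_integral_gaussian[OF t], simp)
     (simp add: gauss_density_shift_weight[OF t] gauss_density_nonneg[OF t] ennreal_mult' mult_ac)

lemma shift_weight_integrable:
  assumes t: "t > 0"
  shows "integrable (gaussian (0::'a::euclidean_space) t) (shift_weight t h)"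
    and "(\<integral>u. shift_weight t h u \<partial>gaussian (0::'a) t) = 1"
proof -
  interpret prob_space "gaussian (0::'a) t" by (rule prob_space_gaussian[OF t])
  have n: "(\<integral>\<^sup>+u. ennreal (shift_weight t h u) \<partial>gaussian (0::'a) t) = 1"
    using shift_weight_nn_integral[OF t, of "\<lambda>_. 1" h] emeasure_space_1 by simp
  show *: "integrable (gaussian (0::'a) t) (shift_weight t h)"
    using n by (intro integrableI_nonneg) (auto simp: shift_weight_def)
  show "(\<integral>u. shift_weight t h u \<partial>gaussian (0::'a) t) = 1"
  proof -
    have "AE u in gaussian (0::'a) t. 0 \<le> shift_weight t h u" by (simp add: shift_weight_def)
    from nn_integral_eq_integral[OF * this] integral_nonneg_AE[OF this] show ?thesis
      unfolding n by (simp add: ennreal_eq_1)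
  qed
qed

lemma heat_shift_weight:
  fixes b :: "'a::euclidean_space \<Rightarrow> real"
  assumes t: "t > 0" and b: "bounded_borel b"
  shows "heat t b (x + h) = (\<integral>u. b (x + u) * shift_weight t h u \<partial>gaussian 0 t)"
proof -
  note [measurable] = bounded_borel_measurable[OF b]
  have "density (gaussian 0 t) (\<lambda>u. ennreal (shift_weight t h u)) = distr (gaussian 0 t) borel (\<lambda>u. h + u)"
  proof (rule measure_eqI)
    fix A assume "A \<in> sets (density (gaussian (0::'a) t) (\<lambda>u. ennreal (shift_weight t h u)))"
    then have [measurable]: "A \<in> sets borel" by simp
    have "emeasure (distr (gaussian 0 t) borel (\<lambda>u. h + u)) A = (\<integral>\<^sup>+u. indicator A (h + u) \<partial>gaussian 0 t)"
      by (subst nn_integral_indicator[symmetric], simp, subst nn_integral_distr) auto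
    also have "\<dots> = emeasure (density (gaussian 0 t) (\<lambda>u. ennreal (shift_weight t h u))) A"
      by (subst shift_weight_nn_integral[OF t]) (auto simp: emeasure_density mult.commute)
    finally show "emeasure (density (gaussian 0 t) (\<lambda>u. ennreal (shift_weight t h u))) A
      = emeasure (distr (gaussian 0 t) borel (\<lambda>u. h + u)) A" ..
  qed simp
  note eq = this
  have "heat t b (x + h) = (\<integral>u. b (x + u) \<partial>distr (gaussian 0 t) borel (\<lambda>u. h + u))"
    by (subst integral_distr) (auto simp: heat_def add.assoc)
  also have "\<dots> = (\<integral>u. b (x + u) * shift_weight t h u \<partial>gaussian 0 t)"
    unfolding eq[symmetric] by (subst integral_density) (auto simp: shift_weight_def mult.commute)
  finally show ?thesis .
qed

lemma bounded_mult_integrable: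
  fixes g :: "'a::euclidean_space \<Rightarrow> real"
  assumes b: "bounded_borel b" and g: "integrable (gaussian 0 t) g"
  shows "integrable (gaussian 0 t) (\<lambda>u. b (x + u) * g u)"
proof -
  note [measurable] = bounded_borel_measurable[OF b]
  obtain B where B: "B \<ge> 0" "\<And>x. \<bar>b x\<bar> \<le> B" using bounded_borelE[OF b] by blast
  have "integrable (gaussian 0 t) (\<lambda>u. B * g u)" using g by simp
  moreover have "(\<lambda>u. b (x + u) * g u) \<in> borel_measurable (gaussian 0 t)"
    using borel_measurable_integrable[OF g] by measurable
  moreover have "AE u in gaussian 0 t. norm (b (x + u) * g u) \<le> norm (B * g u)"
    using B by (intro AE_I2) (auto simp: abs_mult intro!: mult_right_mono)
  ultimately show ?thesis by (rule Bochner_Integration.integrable_bound)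
qed

text \<open>
  The Chapman--Robbins argument: the increment is the covariance of \<open>b\<close> with \<open>shift_weight t h - 1\<close>, whose second
  moment is \<open>exp ((norm h)\<^sup>2 / t) - 1\<close>, and Cauchy--Schwarz applies.
\<close>

lemma heat_increment_le:
  fixes b :: "'a::euclidean_space \<Rightarrow> real"
  assumes t: "t > 0" and b: "bounded_borel b"
  shows "(heat t b (x + h) - heat t b x)\<^sup>2 \<le> heat_var t b x * (exp ((norm h)\<^sup>2 / t) - 1)"
proof (cases "h = 0")
  case False
  interpret prob_space "gaussian (0::'a) t" by (rule prob_space_gaussian[OF t])
  define m where "m = heat t b x"
  define g where "g = (\<lambda>u. shift_weight t h u - 1)"
  define E where "E = exp ((norm h)\<^sup>2 / t) - 1"
  define I where "I = heat t b (x + h) - heat t b x"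
  have bm: "bounded_borel (\<lambda>y. b y - m)" by (intro bounded_borel_diff b bounded_borel_const)
  have E0: "E > 0" using False t by (simp add: E_def)
  have gi: "integrable (gaussian 0 t) g" unfolding g_def by (intro Bochner_Integration.integrable_diff shift_weight_integrable(1)[OF t]) simp
  have sq: "(shift_weight t h u)\<^sup>2 = exp ((norm h)\<^sup>2 / t) * shift_weight t (2 *\<^sub>R h) u" for u
    by (simp add: shift_weight_def mult_exp_exp power2_eq_square field_simps)
  have g2: "(g u)\<^sup>2 = exp ((norm h)\<^sup>2 / t) * shift_weight t (2 *\<^sub>R h) u - 2 * shift_weight t h u + 1" for u
    unfolding g_def sq[symmetric] by (simp add: power2_diff)
  have g2i: "integrable (gaussian 0 t) (\<lambda>u. (g u)\<^sup>2)" unfolding g2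
    by (intro Bochner_Integration.integrable_diff Bochner_Integration.integrable_add integrable_mult_right shift_weight_integrable(1)[OF t]) simp
  have g2E: "(\<integral>u. (g u)\<^sup>2 \<partial>gaussian 0 t) = E"
    unfolding g2 E_def using prob_space by (simp add: shift_weight_integrable[OF t])
  have fi: "integrable (gaussian 0 t) (\<lambda>u. (b (x + u) - m)\<^sup>2)"
    using heat_integrable[OF t bounded_borel_square[OF bm]] .
  have fgi: "integrable (gaussian 0 t) (\<lambda>u. (b (x + u) - m) * g u)"
    using bounded_mult_integrable[OF bm gi] .
  have "(\<integral>u. (b (x + u) - m) * g u \<partial>gaussian 0 t)
     = (\<integral>u. b (x + u) * shift_weight t h u - b (x + u) - m * g u \<partial>gaussian 0 t)"
    by (intro Bochner_Integration.integral_cong) (auto simp: g_def algebra_simps)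
  also have "\<dots> = I"
    using bounded_mult_integrable[OF b shift_weight_integrable(1)[OF t, of h], of x] heat_integrable[OF t b, of x] gi
      shift_weight_integrable[OF t, of h] prob_space
    by (simp add: I_def heat_shift_weight[OF t b, of x h] heat_def[of t b x] g_def)
  finally have fgI: "(\<integral>u. (b (x + u) - m) * g u \<partial>gaussian 0 t) = I" .
  have V: "(\<integral>u. (b (x + u) - m)\<^sup>2 \<partial>gaussian 0 t) = heat_var t b x"
    by (simp add: heat_var_eq[OF t b] m_def)
  \<comment> \<open>Cauchy--Schwarz: subtract from \<open>b - m\<close> its projection onto \<open>g\<close>.\<close>
  have "0 \<le> (\<integral>u. (b (x + u) - m - I / E * g u)\<^sup>2 \<partial>gaussian 0 t)" by simp
  also have "\<dots> = (\<integral>u. (b (x + u) - m)\<^sup>2 - 2 * (I / E) * ((b (x + u) - m) * g u) + (I / E)\<^sup>2 * (g u)\<^sup>2 \<partial>gaussian 0 t)"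
    by (intro Bochner_Integration.integral_cong) (auto simp: power2_eq_square algebra_simps)
  also have "\<dots> = heat_var t b x - 2 * (I / E) * I + (I / E)\<^sup>2 * E"
    using fi fgi g2i by (simp add: fgI g2E V)
  also have "\<dots> = heat_var t b x - I\<^sup>2 / E" using E0 by (simp add: field_simps power2_eq_square)
  finally show ?thesis using E0 by (simp add: I_def E_def field_simps)
qed simp

text \<open>
  The directional derivative of \<open>heat t b\<close> at \<open>x\<close>, with the derivative moved to the Gaussian density.
\<close>

definition heat_deriv :: "real \<Rightarrow> ('a::euclidean_space \<Rightarrow> real) \<Rightarrow> 'a \<Rightarrow> 'a \<Rightarrow> real" where
  "heat_deriv t b x v = (\<integral>u. b (x + u) * ((u \<bullet> v) / t) \<partial>gaussian 0 t)"

lemma gaussian_norm_integrable: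
  assumes t: "t > 0"
  shows "integrable (gaussian (0::'a::euclidean_space) t) norm"
proof (rule Bochner_Integration.integrable_bound)
  show "integrable (gaussian (0::'a) t) (\<lambda>u. exp t * exp ((norm u)\<^sup>2 / (4 * t)))"
    using gaussian_exp_square_integrable(1)[OF t] by simp
  have "norm u \<le> exp t * exp ((norm u)\<^sup>2 / (4 * t))" for u :: 'a
  proof -
    have "0 \<le> (norm u - 2 * t)\<^sup>2 / (4 * t)" using t by simp
    also have "(norm u - 2 * t)\<^sup>2 / (4 * t) = (norm u)\<^sup>2 / (4 * t) + t - norm u"
      using t by (simp add: power2_diff field_simps power2_eq_square)
    finally have "norm u \<le> t + (norm u)\<^sup>2 / (4 * t)" by simp
    also have "\<dots> \<le> exp (t + (norm u)\<^sup>2 / (4 * t))" using exp_ge_add_one_self[of "t + (norm u)\<^sup>2 / (4 * t)"] by linarith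
    finally show ?thesis by (simp add: exp_add)
  qed
  then show "AE u in gaussian (0::'a) t. norm (norm u) \<le> norm (exp t * exp ((norm u)\<^sup>2 / (4 * t)))" by simp
qed simp

lemma gaussian_inner_integrable:
  assumes t: "t > 0"
  shows "integrable (gaussian (0::'a::euclidean_space) t) (\<lambda>u. (u \<bullet> v) / t)"
proof -
  have "integrable (gaussian (0::'a) t) (\<lambda>u. u \<bullet> v)"
  proof (rule Bochner_Integration.integrable_bound)
    show "integrable (gaussian (0::'a) t) (\<lambda>u. norm v * norm u)"
      by (intro integrable_mult_right) (rule gaussian_norm_integrable[OF t])
    show "AE u in gaussian (0::'a) t. norm (u \<bullet> v) \<le> norm (norm v * norm u)"
      using Cauchy_Schwarz_ineq2 by (intro AE_I2) (simp add: mult.commute)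
  qed simp
  then show ?thesis by simp
qed

lemma heat_deriv_linear:
  assumes t: "t > 0" and b: "bounded_borel b"
  shows "linear (heat_deriv t b x)"
proof (rule linearI)
  note bi = bounded_mult_integrable[OF b gaussian_inner_integrable[OF t]]
  show "heat_deriv t b x (v + w) = heat_deriv t b x v + heat_deriv t b x w" for v w
    unfolding heat_deriv_def
    by (subst Bochner_Integration.integral_add[OF bi bi, symmetric]) (simp add: inner_add_right add_divide_distrib distrib_left)
  show "heat_deriv t b x (c *\<^sub>R v) = c *\<^sub>R heat_deriv t b x v" for c v
    unfolding heat_deriv_def real_scaleR_def
    by (subst integral_mult_right_zero[symmetric]) (simp add: mult_ac)
qed

text \<open>
  A second-order Taylor bound that is uniform in \<open>h\<close> and integrable in \<open>u\<close>; it makes it possible to differentiate under the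
  integral sign without dominated convergence.
\<close>

lemma shift_weight_remainder:
  assumes t: "t > 0" and h: "norm h \<le> 1"
  shows "\<bar>shift_weight t h u - 1 - (u \<bullet> h) / t\<bar> \<le> (norm h)\<^sup>2 * (2 * exp (6 / t) * exp ((norm u)\<^sup>2 / (4 * t)) + 1 / (2 * t))"
proof -
  define a where "a = (u \<bullet> h) / t - (norm h)\<^sup>2 / (2 * t)"
  define X where "X = (norm u + 1) / t"
  have X0: "X \<ge> 0" using t by (simp add: X_def)
  have "\<bar>a\<bar> \<le> \<bar>u \<bullet> h\<bar> / t + (norm h)\<^sup>2 / (2 * t)"
    unfolding a_def using t abs_triangle_ineq4[of "(u \<bullet> h) / t" "(norm h)\<^sup>2 / (2 * t)"] by (simp add: abs_divide)
  also have "\<dots> \<le> norm u * norm h / t + norm h / t"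
  proof (intro add_mono)
    show "\<bar>u \<bullet> h\<bar> / t \<le> norm u * norm h / t" using t Cauchy_Schwarz_ineq2 by (intro divide_right_mono) auto
    have "norm h * norm h \<le> norm h * 1" using h by (intro mult_left_mono) auto
    also have "\<dots> \<le> 2 * norm h" by simp
    finally show "(norm h)\<^sup>2 / (2 * t) \<le> norm h / t" using t by (simp add: power2_eq_square field_simps)
  qed
  also have "\<dots> = norm h * X" by (simp add: X_def add_divide_distrib algebra_simps)
  finally have a1: "\<bar>a\<bar> \<le> norm h * X" .
  also have "\<dots> \<le> 1 * X" using h X0 by (intro mult_right_mono) auto
  finally have a2: "\<bar>a\<bar> \<le> X" by simp
  have "\<bar>exp a - 1 - a\<bar> \<le> a\<^sup>2 * exp \<bar>a\<bar>" by (rule exp_minus_one_minus_le)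
  also have "\<dots> \<le> (norm h * X)\<^sup>2 * exp X"
    using a1 a2 power_mono[OF a1, of 2] by (intro mult_mono) auto
  also have "\<dots> \<le> (norm h)\<^sup>2 * (2 * exp X * exp X)"
  proof -
    have "X\<^sup>2 \<le> 2 * exp X" using exp_lower_Taylor_quadratic[OF X0] X0 by linarith
    then have "(norm h)\<^sup>2 * (X\<^sup>2 * exp X) \<le> (norm h)\<^sup>2 * (2 * exp X * exp X)"
      by (intro mult_left_mono mult_right_mono) auto
    then show ?thesis by (simp add: power_mult_distrib mult_ac)
  qed
  also have "\<dots> \<le> (norm h)\<^sup>2 * (2 * exp (6 / t) * exp ((norm u)\<^sup>2 / (4 * t)))"
  proof -
    have "0 \<le> (norm u - 4)\<^sup>2 / (4 * t)" using t by simp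
    also have "(norm u - 4)\<^sup>2 / (4 * t) = (norm u)\<^sup>2 / (4 * t) + 6 / t - (X + X)"
      using t by (simp add: X_def power2_diff field_simps)
    finally have "exp (X + X) \<le> exp (6 / t + (norm u)\<^sup>2 / (4 * t))" by simp
    then have "exp X * exp X \<le> exp (6 / t) * exp ((norm u)\<^sup>2 / (4 * t))" by (simp only: exp_add)
    then show ?thesis by (simp add: mult_left_mono)
  qed
  finally have "\<bar>exp a - 1 - a\<bar> \<le> (norm h)\<^sup>2 * (2 * exp (6 / t) * exp ((norm u)\<^sup>2 / (4 * t)))" .
  moreover have "shift_weight t h u - 1 - (u \<bullet> h) / t = (exp a - 1 - a) - (norm h)\<^sup>2 * (1 / (2 * t))"
    by (simp add: shift_weight_def a_def)
  moreover have "0 \<le> (norm h)\<^sup>2 * (1 / (2 * t))" using t by simp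
  ultimately show ?thesis unfolding distrib_left by linarith
qed

text \<open>
  The constant does not depend on \<open>x\<close>. Averaging this estimate over \<open>x\<close> therefore differentiates iterated heat
  averages as well.
\<close>

lemma heat_taylor:
  fixes b :: "'a::euclidean_space \<Rightarrow> real"
  assumes t: "t > 0" and b: "b \<in> borel_measurable borel" and B: "\<And>x. \<bar>b x\<bar> \<le> B" and h: "norm h \<le> 1"
  shows "\<bar>heat t b (x + h) - heat t b x - heat_deriv t b x h\<bar>
    \<le> B * (2 * exp (6 / t) * sqrt 2 ^ DIM('a) + 1 / (2 * t)) * (norm h)\<^sup>2"
proof -
  interpret prob_space "gaussian (0::'a) t" by (rule prob_space_gaussian[OF t])
  have bb: "bounded_borel b" using b B by (rule bounded_borelI)
  have B0: "B \<ge> 0" using B[of 0] by linarith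
  note i1 = bounded_mult_integrable[OF bb shift_weight_integrable(1)[OF t, of h], of x]
  note i2 = bounded_mult_integrable[OF bb gaussian_inner_integrable[OF t, of h], of x]
  note i3 = heat_integrable[OF t bb, of x]
  define w where "w u = (norm h)\<^sup>2 * (2 * exp (6 / t) * exp ((norm u)\<^sup>2 / (4 * t)) + 1 / (2 * t))" for u :: 'a
  have wi: "integrable (gaussian 0 t) w" unfolding w_def using gaussian_exp_square_integrable(1)[OF t, where 'a = 'a] by simp
  have "heat t b (x + h) - heat t b x - heat_deriv t b x h
     = (\<integral>u. b (x + u) * shift_weight t h u - b (x + u) - b (x + u) * ((u \<bullet> h) / t) \<partial>gaussian 0 t)"
    unfolding heat_shift_weight[OF t bb] heat_deriv_def heat_def[of t b x] using i1 i2 i3 by simp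
  also have "\<bar>\<dots>\<bar> \<le> (\<integral>u. B * w u \<partial>gaussian 0 t)"
  proof (rule order_trans[OF integral_abs_bound], intro integral_mono)
    show "integrable (gaussian 0 t) (\<lambda>u. \<bar>b (x + u) * shift_weight t h u - b (x + u) - b (x + u) * ((u \<bullet> h) / t)\<bar>)"
      using i1 i2 i3 by (intro integrable_abs Bochner_Integration.integrable_diff)
    show "integrable (gaussian 0 t) (\<lambda>u. B * w u)" using wi by simp
    fix u
    have "b (x + u) * shift_weight t h u - b (x + u) - b (x + u) * ((u \<bullet> h) / t) = b (x + u) * (shift_weight t h u - 1 - (u \<bullet> h) / t)"
      by (simp add: algebra_simps)
    then show "\<bar>b (x + u) * shift_weight t h u - b (x + u) - b (x + u) * ((u \<bullet> h) / t)\<bar> \<le> B * w u"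
      using shift_weight_remainder[OF t h, of u] B B0 by (simp only: abs_mult w_def) (intro mult_mono, auto)
  qed
  also have "\<dots> = B * (2 * exp (6 / t) * sqrt 2 ^ DIM('a) + 1 / (2 * t)) * (norm h)\<^sup>2"
    unfolding w_def using gaussian_exp_square_integrable[OF t, where 'a = 'a] prob_space by (simp add: mult_ac)
  finally show ?thesis .
qed

lemma has_derivative_of_quadratic_remainder:
  fixes f :: "'a::euclidean_space \<Rightarrow> real"
  assumes L: "linear L" and R: "\<And>h. norm h \<le> 1 \<Longrightarrow> \<bar>f (x + h) - f x - L h\<bar> \<le> C * (norm h)\<^sup>2"
  shows "(f has_derivative L) (at x)"
  unfolding has_derivative_at
proof
  show "bounded_linear L" using L by (rule linear_conv_bounded_linear[THEN iffD1])
  show "((\<lambda>h. norm (f (x + h) - f x - L h) / norm h) \<longlongrightarrow> 0) (at 0)"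
  proof (rule tendsto_sandwich[of "\<lambda>_. 0" _ _ "\<lambda>h. C * norm h"])
    have "\<forall>\<^sub>F h in at (0::'a). norm h \<le> 1"
      unfolding eventually_at by (intro exI[of _ 1]) auto
    then show "\<forall>\<^sub>F h in at 0. norm (f (x + h) - f x - L h) / norm h \<le> C * norm h"
    proof eventually_elim
      case (elim h)
      then show ?case using R[OF elim] by (cases "h = 0") (auto simp: divide_le_eq power2_eq_square mult_ac)
    qed
    show "((\<lambda>h. C * norm h) \<longlongrightarrow> 0) (at (0::'a))" by (auto intro!: tendsto_eq_intros)
  qed auto
qed

lemma heat_has_derivative:
  assumes t: "t > 0" and b: "bounded_borel b"
  shows "(heat t b has_derivative heat_deriv t b x) (at x)"
proof -
  obtain B where B: "\<And>x. \<bar>b x\<bar> \<le> B" using b by (auto simp: bounded_borel_def)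
  show ?thesis
    by (rule has_derivative_of_quadratic_remainder[OF heat_deriv_linear[OF t b]])
       (rule heat_taylor[OF t bounded_borel_measurable[OF b] B])
qed

lemma heat_deriv_abs_le:
  fixes b :: "'a::euclidean_space \<Rightarrow> real"
  assumes t: "t > 0" and b: "bounded_borel b" and B: "\<And>x. \<bar>b x\<bar> \<le> B"
  shows "\<bar>heat_deriv t b x v\<bar> \<le> (\<integral>u. B * \<bar>(u \<bullet> v) / t\<bar> \<partial>gaussian 0 t)"
  unfolding heat_deriv_def
proof (rule order_trans[OF integral_abs_bound], intro integral_mono)
  show "integrable (gaussian 0 t) (\<lambda>u. \<bar>b (x + u) * ((u \<bullet> v) / t)\<bar>)"
    by (intro integrable_abs bounded_mult_integrable b gaussian_inner_integrable t)
  show "integrable (gaussian 0 t) (\<lambda>u. B * \<bar>(u \<bullet> v) / t\<bar>)"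
    by (intro integrable_mult_right integrable_abs gaussian_inner_integrable t)
  show "\<bar>b (x + u) * ((u \<bullet> v) / t)\<bar> \<le> B * \<bar>(u \<bullet> v) / t\<bar>" for u
    unfolding abs_mult[of "b (x + u)"] using B by (intro mult_right_mono) auto
qed

lemma heat_deriv_bounded_borel:
  fixes b :: "'a::euclidean_space \<Rightarrow> real"
  assumes t: "t > 0" and b: "bounded_borel b"
  shows "bounded_borel (\<lambda>x. heat_deriv t b x v)"
proof -
  interpret prob_space "gaussian (0::'a) t" by (rule prob_space_gaussian[OF t])
  note [measurable] = bounded_borel_measurable[OF b]
  obtain B where B: "\<And>x. \<bar>b x\<bar> \<le> B" using b by (auto simp: bounded_borel_def)
  have "(\<lambda>x. heat_deriv t b x v) \<in> borel_measurable borel" unfolding heat_deriv_def by measurable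
  then show ?thesis using heat_deriv_abs_le[OF t b B] by (rule bounded_borelI)
qed

text \<open>
  The derivative is again a heat average of a bounded function: half of the noise is spent on differentiating,
  the other half remains. Both sides are the derivative of \<open>heat t b\<close>, the right-hand one after writing
  \<open>heat t b = heat (t/2) (heat (t/2) b)\<close>.
\<close>

lemma heat_deriv_split:
  fixes b :: "'a::euclidean_space \<Rightarrow> real"
  assumes t: "t > 0" and b: "bounded_borel b"
  shows "heat_deriv t b x v = heat (t/2) (\<lambda>y. heat_deriv (t/2) b y v) x"
proof -
  define s where "s = t / 2"
  have s: "s > 0" "s + s = t" using t by (simp_all add: s_def)
  interpret prob_space "gaussian (0::'a) s" by (rule prob_space_gaussian[OF s(1)])
  obtain B where B: "\<And>x. \<bar>b x\<bar> \<le> B" using b by (auto simp: bounded_borel_def)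
  note db = heat_deriv_bounded_borel[OF s(1) b]
  note hb = heat_bounded_borel[OF s(1) b]
  define L where "L v = heat s (\<lambda>y. heat_deriv s b y v) x" for v
  define C where "C = B * (2 * exp (6 / s) * sqrt 2 ^ DIM('a) + 1 / (2 * s))"
  have "linear L"
  proof (rule linearI)
    note hi = heat_integrable[OF s(1) db]
    show "L (v + w) = L v + L w" for v w
      unfolding L_def heat_def linear_add[OF heat_deriv_linear[OF s(1) b]]
      by (rule Bochner_Integration.integral_add[OF hi hi])
    show "L (c *\<^sub>R v) = c *\<^sub>R L v" for c v
      unfolding L_def heat_def linear_scale[OF heat_deriv_linear[OF s(1) b]] by simp
  qed
  moreover have "\<bar>heat t b (x + h) - heat t b x - L h\<bar> \<le> C * (norm h)\<^sup>2" if h: "norm h \<le> 1" for h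
  proof -
    have "heat t b (x + h) - heat t b x - L h
      = (\<integral>u. heat s b (x + u + h) - heat s b (x + u) - heat_deriv s b (x + u) h \<partial>gaussian 0 s)"
      using heat_integrable[OF s(1) hb, of "x + h"] heat_integrable[OF s(1) hb, of x] heat_integrable[OF s(1) db, of x]
      unfolding s(2)[symmetric] heat_heat[OF s(1) s(1) b, symmetric] L_def heat_def[of s "heat s b"] heat_def[of s "\<lambda>y. heat_deriv s b y h"]
      by (simp add: ac_simps)
    also have "\<bar>\<dots>\<bar> \<le> C * (norm h)\<^sup>2"
      unfolding C_def by (intro abs_expectation_le prob_space_axioms heat_taylor s b h B bounded_borel_measurable)
    finally show ?thesis .
  qed
  ultimately have "(heat t b has_derivative L) (at x)" by (rule has_derivative_of_quadratic_remainder)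
  from has_derivative_unique[OF this heat_has_derivative[OF t b]] show ?thesis
    by (auto simp: L_def s_def fun_eq_iff)
qed

text \<open>
  By \<open>heat_deriv_split\<close> each derivative consumes half of the remaining noise, so there is always some left.
\<close>

lemma heat_times_differentiable:
  fixes b :: "'a::euclidean_space \<Rightarrow> real"
  assumes "t > 0" "bounded_borel b"
  shows "times_differentiable n (heat t b)"
  using assms
proof (induction n arbitrary: t b)
  case 0
  have "isCont (heat t b) x" for x using heat_has_derivative[OF 0] by (rule has_derivative_continuous)
  then show ?case by (simp add: continuous_at_imp_continuous_on)
next
  case (Suc n)
  have "frechet_derivative (heat t b) (at x) v = heat (t/2) (\<lambda>y. heat_deriv (t/2) b y v) x" for x v
    using frechet_derivative_at[OF heat_has_derivative[OF Suc.prems, of x]] heat_deriv_split[OF Suc.prems]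
    by metis
  moreover have "times_differentiable n (heat (t/2) (\<lambda>y. heat_deriv (t/2) b y v))" for v
    using Suc.prems by (intro Suc.IH heat_deriv_bounded_borel) auto
  moreover have "heat t b differentiable (at x)" for x
    using heat_has_derivative[OF Suc.prems, of x] by (auto simp: differentiable_def)
  ultimately show ?case by simp
qed

definition heat_grad :: "real \<Rightarrow> ('a::euclidean_space \<Rightarrow> real) \<Rightarrow> 'a \<Rightarrow> 'a" where
  "heat_grad t b x = (\<Sum>i\<in>Basis. heat_deriv t b x i *\<^sub>R i)"

lemma heat_GDERIV:
  fixes b :: "'a::euclidean_space \<Rightarrow> real"
  assumes t: "t > 0" and b: "bounded_borel b"
  shows "GDERIV (heat t b) x :> heat_grad t b x"
proof -
  have "heat_deriv t b x h = h \<bullet> heat_grad t b x" for h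
  proof -
    have "heat_deriv t b x h = heat_deriv t b x (\<Sum>i\<in>Basis. (h \<bullet> i) *\<^sub>R i)" by (simp add: euclidean_representation)
    also have "\<dots> = (\<Sum>i\<in>Basis. (h \<bullet> i) * heat_deriv t b x i)"
      using heat_deriv_linear[OF t b, of x] by (simp add: linear_sum linear_scale)
    also have "\<dots> = h \<bullet> heat_grad t b x" by (simp add: heat_grad_def inner_sum_right mult.commute)
    finally show ?thesis .
  qed
  then have "heat_deriv t b x = (\<lambda>h. h \<bullet> heat_grad t b x)" by (rule ext)
  then show ?thesis unfolding gderiv_def using heat_has_derivative[OF t b, of x] by simp
qed

text \<open>
  The infinitesimal form of \<open>heat_increment_le\<close>, for increments in the direction of the gradient itself.
\<close>

lemma heat_grad_le_heat_var:
  fixes b :: "'a::euclidean_space \<Rightarrow> real"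
  assumes t: "t > 0" and b: "bounded_borel b"
  shows "t * (norm (heat_grad t b x))\<^sup>2 \<le> heat_var t b x"
proof -
  define D where "D = heat_grad t b x"
  define N where "N = (norm D)\<^sup>2"
  define V where "V = heat_var t b x"
  define F where "F s = heat t b (x + s *\<^sub>R D)" for s :: real
  define s where "s n = inverse (real (Suc n))" for n
  have s: "s n > 0" "s \<longlonglongrightarrow> 0" for n
    unfolding s_def by (simp, rule LIMSEQ_inverse_real_of_nat)
  have V0: "V \<ge> 0" unfolding V_def by (rule heat_var_nonneg[OF t b])
  have "(F has_derivative (\<lambda>r. (r *\<^sub>R D) \<bullet> D)) (at 0)"
  proof -
    have 1: "((\<lambda>r::real. x + r *\<^sub>R D) has_derivative (\<lambda>r. r *\<^sub>R D)) (at 0)" by (auto intro!: derivative_eq_intros)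
    have 2: "(heat t b has_derivative (\<lambda>h. h \<bullet> D)) (at (x + 0 *\<^sub>R D))"
      using heat_GDERIV[OF t b, of x] by (simp add: gderiv_def D_def)
    show ?thesis using has_derivative_compose[OF 1 2] unfolding F_def .
  qed
  then have "(F has_real_derivative N) (at 0)"
    unfolding has_field_derivative_def
    by (rule has_derivative_eq_rhs) (auto simp: N_def power2_norm_eq_inner)
  then have "((\<lambda>h. (F h - F 0) / h) \<longlongrightarrow> N) (at 0)" by (simp add: DERIV_def)
  then have lim: "(\<lambda>n. (F (s n) - F 0) / s n) \<longlonglongrightarrow> N"
  proof (rule filterlim_compose)
    show "filterlim s (at 0) sequentially"
      using s by (intro filterlim_atI) (auto intro!: always_eventually simp: less_imp_neq[symmetric])
  qed
  have le: "((F (s n) - F 0) / s n)\<^sup>2 \<le> V * (N / t * exp ((s n)\<^sup>2 * (N / t)))" for n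
  proof -
    define z where "z = (s n)\<^sup>2 * (N / t)"
    have z0: "z \<ge> 0" using t by (simp add: z_def N_def)
    have "(F (s n) - F 0)\<^sup>2 \<le> V * (exp ((norm (s n *\<^sub>R D))\<^sup>2 / t) - 1)"
      unfolding F_def V_def using heat_increment_le[OF t b, of x "s n *\<^sub>R D"] by simp
    also have "(norm (s n *\<^sub>R D))\<^sup>2 / t = z" by (simp add: z_def N_def power_mult_distrib)
    also have "V * (exp z - 1) \<le> V * (z * exp z)"
      using abs_exp_minus_one_le[of z] z0 V0 by (intro mult_left_mono) auto
    also have "\<dots> = (s n)\<^sup>2 * (V * (N / t * exp z))" by (simp add: z_def)
    finally show ?thesis using s(1)[of n] by (simp add: power_divide z_def field_simps)
  qed
  have "(\<lambda>n. ((F (s n) - F 0) / s n)\<^sup>2) \<longlonglongrightarrow> N\<^sup>2" by (intro tendsto_intros lim)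
  moreover have "(\<lambda>n. V * (N / t * exp ((s n)\<^sup>2 * (N / t)))) \<longlonglongrightarrow> V * (N / t * exp (0\<^sup>2 * (N / t)))"
    by (intro tendsto_intros s)
  ultimately have "N\<^sup>2 \<le> V * (N / t * exp (0\<^sup>2 * (N / t)))"
    using le by (intro LIMSEQ_le) auto
  then have "N * (t * N) \<le> N * V" using t by (simp add: field_simps power2_eq_square)
  moreover have "N \<ge> 0" by (simp add: N_def)
  ultimately have "t * N \<le> V" using V0 by (cases "N = 0") auto
  then show ?thesis by (simp add: N_def V_def D_def)
qed

section \<open>Spectral gap along the noise\<close>

definition variance_wrt :: "'a measure \<Rightarrow> ('a \<Rightarrow> real) \<Rightarrow> real" where
  "variance_wrt \<mu> g = (\<integral>x. (g x)\<^sup>2 \<partial>\<mu>) - (\<integral>x. g x \<partial>\<mu>)\<^sup>2"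

text \<open>
  A spectral gap for one portion of noise of variance \<open>\<delta>\<close> added to a point of law \<open>\<mu>\<close>. Since the variance of \<open>\<psi>\<close> at
  the noisy point is the sum of the two quantities compared here, it says that conditioning on the starting point
  divides variances by at least \<open>1 + a\<close>. It is phrased with heat averages only, so that it makes sense for
  bounded \<open>\<psi>\<close> without any smoothness.
\<close>

definition heat_gap :: "real \<Rightarrow> real \<Rightarrow> 'a::euclidean_space measure \<Rightarrow> bool" where
  "heat_gap a \<delta> \<mu> \<longleftrightarrow> (\<forall>\<psi>. bounded_borel \<psi> \<longrightarrow> a * variance_wrt \<mu> (heat \<delta> \<psi>) \<le> (\<integral>x. heat_var \<delta> \<psi> x \<partial>\<mu>))"

lemma variance_wrt_centered:
  fixes \<mu> :: "'a::euclidean_space measure"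
  assumes "prob_space \<mu>" "sets \<mu> = sets borel" "bounded_borel g"
  shows "variance_wrt \<mu> g = (\<integral>x. (g x - (\<integral>y. g y \<partial>\<mu>))\<^sup>2 \<partial>\<mu>)"
proof -
  interpret prob_space \<mu> by fact
  show ?thesis unfolding variance_wrt_def
    using variance_eq[OF bounded_borel_integrable[OF assms] bounded_borel_integrable[OF assms(1,2) bounded_borel_square[OF assms(3)]]]
    by simp
qed

text \<open>
  Heat averages of bounded functions are admissible in the Poincare inequality, and their gradients are controlled by the local variance.
\<close>

lemma poincare_imp_heat_gap:
  fixes \<mu> :: "'a::euclidean_space measure"
  assumes mu: "prob_space \<mu>" "sets \<mu> = sets borel" and P: "poincare \<alpha> \<mu>" and a: "\<alpha> > 0" and d: "\<delta> > 0"
  shows "heat_gap (\<alpha> * \<delta>) \<delta> \<mu>"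
  unfolding heat_gap_def
proof (intro allI impI)
  fix \<psi> :: "'a \<Rightarrow> real" assume b: "bounded_borel \<psi>"
  interpret prob_space \<mu> by fact
  note hb = heat_bounded_borel[OF d b]
  note vb = heat_var_bounded_borel[OF d b]
  have vi: "integrable \<mu> (heat_var \<delta> \<psi>)" by (rule bounded_borel_integrable[OF mu vb])
  have "smooth (heat \<delta> \<psi>)" unfolding smooth_def by (intro allI heat_times_differentiable d b)
  moreover have "bounded (range (heat \<delta> \<psi>))" using hb by (auto simp: bounded_borel_def bounded_iff)
  ultimately have "ennreal (variance (heat \<delta> \<psi>)) \<le> ennreal (1 / \<alpha>) * (\<integral>\<^sup>+x. ennreal ((norm (heat_grad \<delta> \<psi> x))\<^sup>2) \<partial>\<mu>)"
    using P heat_GDERIV[OF d b] unfolding poincare_def by blast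
  also have "\<dots> \<le> ennreal (1 / \<alpha>) * (\<integral>\<^sup>+x. ennreal (1 / \<delta> * heat_var \<delta> \<psi> x) \<partial>\<mu>)"
    using heat_grad_le_heat_var[OF d b] d
    by (intro mult_left_mono nn_integral_mono ennreal_leI) (auto simp: field_simps)
  also have "(\<integral>\<^sup>+x. ennreal (1 / \<delta> * heat_var \<delta> \<psi> x) \<partial>\<mu>) = ennreal (\<integral>x. 1 / \<delta> * heat_var \<delta> \<psi> x \<partial>\<mu>)"
    using vi heat_var_nonneg[OF d b] d by (intro nn_integral_eq_integral) auto
  also have "ennreal (1 / \<alpha>) * \<dots> = ennreal (1 / \<alpha> * (\<integral>x. 1 / \<delta> * heat_var \<delta> \<psi> x \<partial>\<mu>))"
    using a by (subst ennreal_mult') auto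
  finally have "variance (heat \<delta> \<psi>) \<le> 1 / \<alpha> * (\<integral>x. 1 / \<delta> * heat_var \<delta> \<psi> x \<partial>\<mu>)"
    using heat_var_nonneg[OF d b] a d by (subst (asm) ennreal_le_iff) (auto intro!: integral_nonneg_AE)
  then have "variance (heat \<delta> \<psi>) \<le> 1 / \<alpha> * (1 / \<delta> * (\<integral>x. heat_var \<delta> \<psi> x \<partial>\<mu>))" by simp
  then show "\<alpha> * \<delta> * variance_wrt \<mu> (heat \<delta> \<psi>) \<le> (\<integral>x. heat_var \<delta> \<psi> x \<partial>\<mu>)"
    using a d unfolding variance_wrt_centered[OF mu hb] by (simp add: field_simps)
qed

lemma variance_wrt_smear:
  fixes \<mu> :: "'a::euclidean_space measure"
  assumes mu: "prob_space \<mu>" "sets \<mu> = sets borel" and d: "\<delta> > 0" and b: "bounded_borel \<psi>"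
  shows "variance_wrt (smear \<mu> \<delta>) \<psi> = (\<integral>x. heat_var \<delta> \<psi> x \<partial>\<mu>) + variance_wrt \<mu> (heat \<delta> \<psi>)"
proof -
  have "integrable \<mu> (heat \<delta> (\<lambda>x. (\<psi> x)\<^sup>2))" "integrable \<mu> (\<lambda>x. (heat \<delta> \<psi> x)\<^sup>2)"
    by (intro bounded_borel_integrable mu heat_bounded_borel bounded_borel_square d b)+
  then show ?thesis
    by (simp add: variance_wrt_def integral_smear[OF d mu] b bounded_borel_square heat_var_def)
qed

text \<open>
  The total variance at the second noisy point splits into a part that the gap already controls and one more
  local variance; both are bounded by the next local variance because these increase along the noise.
\<close>

lemma heat_gap_smear:
  fixes \<mu> :: "'a::euclidean_space measure"
  assumes mu: "prob_space \<mu>" "sets \<mu> = sets borel" and d: "\<delta> > 0" and a: "a \<ge> 0" and gap: "heat_gap a \<delta> \<mu>"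
  shows "heat_gap (a / (1 + a)) \<delta> (smear \<mu> \<delta>)"
  unfolding heat_gap_def
proof (intro allI impI)
  fix \<psi> :: "'a \<Rightarrow> real" assume b: "bounded_borel \<psi>"
  note hb = heat_bounded_borel[OF d b]
  have "a * variance_wrt (smear \<mu> \<delta>) (heat \<delta> \<psi>) = a * (\<integral>x. heat_var \<delta> (heat \<delta> \<psi>) x \<partial>\<mu>) + a * variance_wrt \<mu> (heat \<delta> (heat \<delta> \<psi>))"
    by (simp add: variance_wrt_smear[OF mu d hb] distrib_left)
  also have "\<dots> \<le> a * (\<integral>x. heat_var \<delta> (heat \<delta> \<psi>) x \<partial>\<mu>) + (\<integral>x. heat_var \<delta> (heat \<delta> \<psi>) x \<partial>\<mu>)"
    using gap hb unfolding heat_gap_def by (intro add_left_mono) blast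
  also have "\<dots> = (1 + a) * (\<integral>x. heat_var \<delta> (heat \<delta> \<psi>) x \<partial>\<mu>)" by (simp add: algebra_simps)
  also have "\<dots> \<le> (1 + a) * (\<integral>x. heat \<delta> (heat_var \<delta> \<psi>) x \<partial>\<mu>)"
    using a heat_var_heat_le[OF d b]
    by (intro mult_left_mono integral_mono bounded_borel_integrable mu heat_bounded_borel heat_var_bounded_borel d b) auto
  also have "(\<integral>x. heat \<delta> (heat_var \<delta> \<psi>) x \<partial>\<mu>) = (\<integral>x. heat_var \<delta> \<psi> x \<partial>smear \<mu> \<delta>)"
    by (rule integral_smear[OF d mu heat_var_bounded_borel[OF d b], symmetric])
  finally show "a / (1 + a) * variance_wrt (smear \<mu> \<delta>) (heat \<delta> \<psi>) \<le> (\<integral>x. heat_var \<delta> \<psi> x \<partial>smear \<mu> \<delta>)"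
    using a by (simp add: field_simps)
qed

text \<open>
  The best prediction of \<open>\<psi>\<close> at the noisy point from the starting point is its heat average, and the gap bounds
  the error of that prediction from below.
\<close>

lemma heat_gap_forward:
  fixes \<mu> :: "'a::euclidean_space measure"
  assumes mu: "prob_space \<mu>" "sets \<mu> = sets borel" and d: "\<delta> > 0" and a: "a \<ge> 0" and gap: "heat_gap a \<delta> \<mu>"
    and psi: "bounded_borel \<psi>" and phi: "bounded_borel \<phi>"
  shows "a / (1 + a) * variance_wrt (smear \<mu> \<delta>) \<psi> \<le> (\<integral>x. \<integral>v. (\<psi> (x + v) - \<phi> x)\<^sup>2 \<partial>gaussian 0 \<delta> \<partial>\<mu>)"
proof -
  note hb = heat_bounded_borel[OF d psi]
  have "a * variance_wrt (smear \<mu> \<delta>) \<psi> \<le> (1 + a) * (\<integral>x. heat_var \<delta> \<psi> x \<partial>\<mu>)"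
    using gap psi unfolding variance_wrt_smear[OF mu d psi] heat_gap_def by (simp add: algebra_simps)
  then have "a / (1 + a) * variance_wrt (smear \<mu> \<delta>) \<psi> \<le> (\<integral>x. heat_var \<delta> \<psi> x \<partial>\<mu>)"
    using a by (simp add: field_simps)
  also have "\<dots> \<le> (\<integral>x. heat_var \<delta> \<psi> x + (heat \<delta> \<psi> x - \<phi> x)\<^sup>2 \<partial>\<mu>)"
    by (intro integral_mono Bochner_Integration.integrable_add bounded_borel_integrable mu
        heat_var_bounded_borel bounded_borel_square bounded_borel_diff hb psi phi d) simp
  finally show ?thesis by (simp add: heat_square_dist[OF d psi])
qed

text \<open>
  The same bound for predicting the starting point from the noisy one. Maximal correlation is symmetric; here the symmetry
  appears as a completed square.
\<close>

lemma heat_gap_backward: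
  fixes \<mu> :: "'a::euclidean_space measure"
  assumes mu: "prob_space \<mu>" "sets \<mu> = sets borel" and d: "\<delta> > 0" and a: "a \<ge> 0" and gap: "heat_gap a \<delta> \<mu>"
    and psi: "bounded_borel \<psi>" and phi: "bounded_borel \<phi>"
  shows "a / (1 + a) * variance_wrt \<mu> \<psi> \<le> (\<integral>x. \<integral>v. (\<psi> x - \<phi> (x + v))\<^sup>2 \<partial>gaussian 0 \<delta> \<partial>\<mu>)"
proof -
  interpret prob_space \<mu> by fact
  define f where "f = heat \<delta> \<phi>"
  have fb: "bounded_borel f" unfolding f_def by (rule heat_bounded_borel[OF d phi])
  define f0 where "f0 x = f x - expectation f" for x
  define g0 where "g0 x = \<psi> x - expectation \<psi>" for x
  have b0: "bounded_borel f0" "bounded_borel g0" unfolding f0_def g0_def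
    by (intro bounded_borel_diff fb psi bounded_borel_const)+
  have fg: "bounded_borel (\<lambda>x. f x - \<psi> x)" by (intro bounded_borel_diff fb psi)
  have int: "integrable \<mu> (\<lambda>x. (f0 x)\<^sup>2)" "integrable \<mu> (\<lambda>x. (g0 x)\<^sup>2)" "integrable \<mu> (\<lambda>x. (f0 x - g0 x)\<^sup>2)"
    by (intro bounded_borel_integrable mu bounded_borel_square bounded_borel_diff b0)+
  have "a / (1 + a) * variance_wrt \<mu> \<psi> = (\<integral>x. a / (1 + a) * (g0 x)\<^sup>2 \<partial>\<mu>)"
    by (simp add: variance_wrt_centered[OF mu psi] g0_def)
  also have "\<dots> \<le> (\<integral>x. a * (f0 x)\<^sup>2 + (f0 x - g0 x)\<^sup>2 \<partial>\<mu>)"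
  proof (intro integral_mono)
    fix x
    \<comment> \<open>The square that vanishes for the extremal pair.\<close>
    have "0 \<le> ((1 + a) * f0 x - g0 x)\<^sup>2 / (1 + a)" using a by simp
    also have "\<dots> = a * (f0 x)\<^sup>2 + (f0 x - g0 x)\<^sup>2 - a / (1 + a) * (g0 x)\<^sup>2"
      using a by (simp add: power2_eq_square field_simps)
    finally show "a / (1 + a) * (g0 x)\<^sup>2 \<le> a * (f0 x)\<^sup>2 + (f0 x - g0 x)\<^sup>2" by simp
  qed (use int in auto)
  also have "\<dots> = a * variance_wrt \<mu> f + variance_wrt \<mu> (\<lambda>x. f x - \<psi> x)"
  proof -
    have "expectation (\<lambda>x. f x - \<psi> x) = expectation f - expectation \<psi>"
      by (intro Bochner_Integration.integral_diff bounded_borel_integrable mu fb psi)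
    then have eq: "f x - \<psi> x - expectation (\<lambda>x. f x - \<psi> x) = f0 x - g0 x" for x by (simp add: f0_def g0_def)
    have "variance_wrt \<mu> f = (\<integral>x. (f0 x)\<^sup>2 \<partial>\<mu>)" unfolding variance_wrt_centered[OF mu fb] f0_def ..
    moreover have "variance_wrt \<mu> (\<lambda>x. f x - \<psi> x) = (\<integral>x. (f0 x - g0 x)\<^sup>2 \<partial>\<mu>)"
      unfolding variance_wrt_centered[OF mu fg] eq ..
    ultimately show ?thesis using int by simp
  qed
  also have "\<dots> \<le> (\<integral>x. heat_var \<delta> \<phi> x \<partial>\<mu>) + (\<integral>x. (f x - \<psi> x)\<^sup>2 \<partial>\<mu>)"
    using gap phi unfolding heat_gap_def f_def variance_wrt_def[of \<mu> "\<lambda>x. heat \<delta> \<phi> x - \<psi> x"] by (intro add_mono) auto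
  also have "\<dots> = (\<integral>x. heat_var \<delta> \<phi> x + (f x - \<psi> x)\<^sup>2 \<partial>\<mu>)"
    by (intro Bochner_Integration.integral_add[symmetric] bounded_borel_integrable mu heat_var_bounded_borel
        d phi bounded_borel_square fg)
  also have "\<dots> = (\<integral>x. \<integral>v. (\<psi> x - \<phi> (x + v))\<^sup>2 \<partial>gaussian 0 \<delta> \<partial>\<mu>)"
    using heat_square_dist[OF d phi] by (simp add: f_def power2_commute)
  finally show ?thesis .
qed

section \<open>Small forward steps\<close>

text \<open>
  Jensen for the cube, in a form that is also meaningful if the right-hand side is infinite.
\<close>

lemma (in prob_space) cube_expectation_le:
  assumes "integrable M F" "\<And>x. 0 \<le> F x"
  shows "ennreal ((\<integral>x. F x \<partial>M) ^ 3) \<le> (\<integral>\<^sup>+x. ennreal (F x ^ 3) \<partial>M)"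
proof -
  define E where "E = expectation F"
  have E0: "E \<ge> 0" unfolding E_def using assms by (intro integral_nonneg_AE) auto
  have pt: "E ^ 3 + 3 * E\<^sup>2 * F x \<le> F x ^ 3 + 3 * E ^ 3" for x
  proof -
    have "F x ^ 3 + 3 * E ^ 3 - (E ^ 3 + 3 * E\<^sup>2 * F x) = (F x - E)\<^sup>2 * (F x + 2 * E)"
      by (simp add: power2_eq_square power3_eq_cube algebra_simps)
    moreover have "\<dots> \<ge> 0" using E0 assms(2)[of x] by simp
    ultimately show ?thesis by linarith
  qed
  have "ennreal (E ^ 3) + ennreal (3 * E ^ 3) = (\<integral>\<^sup>+x. ennreal (E ^ 3 + 3 * E\<^sup>2 * F x) \<partial>M)"
  proof -
    have "(\<integral>\<^sup>+x. ennreal (E ^ 3 + 3 * E\<^sup>2 * F x) \<partial>M) = ennreal (\<integral>x. E ^ 3 + 3 * E\<^sup>2 * F x \<partial>M)"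
      using assms E0 by (intro nn_integral_eq_integral) auto
    also have "(\<integral>x. E ^ 3 + 3 * E\<^sup>2 * F x \<partial>M) = E ^ 3 + 3 * E ^ 3"
      using assms by (simp add: prob_space E_def[symmetric] power2_eq_square power3_eq_cube)
    finally show ?thesis using E0 by (simp flip: ennreal_plus)
  qed
  also have "\<dots> \<le> (\<integral>\<^sup>+x. ennreal (F x ^ 3) + ennreal (3 * E ^ 3) \<partial>M)"
    using pt E0 assms(2) by (intro nn_integral_mono) (simp flip: ennreal_plus)
  also have "\<dots> = (\<integral>\<^sup>+x. ennreal (F x ^ 3) \<partial>M) + ennreal (3 * E ^ 3)"
    using borel_measurable_integrable[OF assms(1)] by (subst nn_integral_add) (auto simp: emeasure_space_1)
  finally show ?thesis unfolding E_def[symmetric]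
    using ennreal_add_left_cancel_le[of "ennreal (3 * E ^ 3)"] by (simp add: add.commute)
qed

text \<open>
  Conditional expectations are bounded in \<open>L\<^sup>3\<close>. Therefore \<open>H\<close>, the conditional expectation of \<open>G\<close>, may be replaced by
  another function \<open>\<xi>\<close> of the conditioning variable that is easier to compare with \<open>G\<close>. The orthogonality is
  to the function that duality pairs with \<open>H - \<xi>\<close>.
\<close>

lemma (in prob_space) projection_cube_le:
  assumes [measurable]: "G \<in> borel_measurable M" "H \<in> borel_measurable M" "\<xi> \<in> borel_measurable M"
    and B: "\<And>x. \<bar>G x\<bar> \<le> B" "\<And>x. \<bar>H x\<bar> \<le> B" "\<And>x. \<bar>\<xi> x\<bar> \<le> (B::real)"
    and orth: "expectation (\<lambda>x. (G x - H x) * (\<bar>\<xi> x - H x\<bar> * (\<xi> x - H x))) = 0"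
  shows "expectation (\<lambda>x. \<bar>G x - H x\<bar> ^ 3) \<le> 8 * expectation (\<lambda>x. \<bar>G x - \<xi> x\<bar> ^ 3)"
proof -
  define a where "a x = \<bar>G x - \<xi> x\<bar>" for x
  define b where "b x = \<bar>\<xi> x - H x\<bar>" for x
  have [measurable]: "a \<in> borel_measurable M" "b \<in> borel_measurable M" unfolding a_def b_def by simp_all
  have D: "\<bar>G x - H x\<bar> \<le> 2 * B" "a x \<le> 2 * B" "b x \<le> 2 * B" "0 \<le> a x" "0 \<le> b x" for x
    using B(1)[of x] B(2)[of x] B(3)[of x] by (auto simp: a_def b_def)
  have B0: "B \<ge> 0" using B(1)[of undefined] by linarith
  have pow: "y ^ 3 \<le> (2 * B) ^ 3" if "0 \<le> y" "y \<le> 2 * B" for y using that by (intro power_mono) auto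
  have ia: "integrable M (\<lambda>x. a x ^ 3)" and ib: "integrable M (\<lambda>x. b x ^ 3)" and id: "integrable M (\<lambda>x. \<bar>G x - H x\<bar> ^ 3)"
    using D pow by (auto intro!: integrable_of_bounded[where B = "(2 * B) ^ 3"])
  have prod: "\<bar>y\<bar> * z\<^sup>2 \<le> 2 * B * (2 * B)\<^sup>2" if "\<bar>y\<bar> \<le> 2 * B" "0 \<le> z" "z \<le> 2 * B" for y z
    using that B0 by (intro mult_mono power_mono) auto
  have iab: "integrable M (\<lambda>x. a x * (b x)\<^sup>2)"
    using D prod[of "a _" "b _"] by (intro integrable_of_bounded[where B = "2 * B * (2 * B)\<^sup>2"]) (auto simp: abs_mult)
  have io: "integrable M (\<lambda>x. (G x - H x) * (\<bar>\<xi> x - H x\<bar> * (\<xi> x - H x)))"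
  proof (rule integrable_of_bounded[where B = "2 * B * (2 * B)\<^sup>2"])
    show "\<bar>(G x - H x) * (\<bar>\<xi> x - H x\<bar> * (\<xi> x - H x))\<bar> \<le> 2 * B * (2 * B)\<^sup>2" for x
      using prod[of "G x - H x" "b x"] D[of x] by (simp add: b_def abs_mult power2_eq_square)
  qed simp
  have "expectation (\<lambda>x. b x ^ 3 - a x * (b x)\<^sup>2) \<le> expectation (\<lambda>x. (G x - H x) * (\<bar>\<xi> x - H x\<bar> * (\<xi> x - H x)))"
  proof (rule integral_mono)
    fix x
    have "(G x - H x) * (\<bar>\<xi> x - H x\<bar> * (\<xi> x - H x)) = (G x - \<xi> x) * (\<bar>\<xi> x - H x\<bar> * (\<xi> x - H x)) + b x * \<bar>\<xi> x - H x\<bar>\<^sup>2"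
      by (simp add: b_def power2_eq_square algebra_simps)
    moreover have "\<bar>(G x - \<xi> x) * (\<bar>\<xi> x - H x\<bar> * (\<xi> x - H x))\<bar> = a x * (b x)\<^sup>2"
      by (simp add: a_def b_def abs_mult power2_eq_square)
    moreover have "b x * \<bar>\<xi> x - H x\<bar>\<^sup>2 = b x ^ 3" by (simp add: b_def power2_eq_square power3_eq_cube)
    ultimately show "b x ^ 3 - a x * (b x)\<^sup>2 \<le> (G x - H x) * (\<bar>\<xi> x - H x\<bar> * (\<xi> x - H x))" by linarith
  qed (use ib iab io in auto)
  then have "expectation (\<lambda>x. b x ^ 3) \<le> expectation (\<lambda>x. a x * (b x)\<^sup>2)"
    using ib iab orth by simp
  also have "\<dots> \<le> expectation (\<lambda>x. a x ^ 3 / 3 + 2 * b x ^ 3 / 3)"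
  proof (rule integral_mono)
    fix x
    have "a x ^ 3 + 2 * b x ^ 3 - 3 * (a x * (b x)\<^sup>2) = (a x - b x)\<^sup>2 * (a x + 2 * b x)"
      by (simp add: power2_eq_square power3_eq_cube algebra_simps)
    moreover have "\<dots> \<ge> 0" using D[of x] by simp
    ultimately show "a x * (b x)\<^sup>2 \<le> a x ^ 3 / 3 + 2 * b x ^ 3 / 3" by linarith
  qed (use ia ib iab in auto)
  also have "\<dots> = expectation (\<lambda>x. a x ^ 3) / 3 + 2 * expectation (\<lambda>x. b x ^ 3) / 3" using ia ib by simp
  finally have ba: "expectation (\<lambda>x. b x ^ 3) \<le> expectation (\<lambda>x. a x ^ 3)" by simp
  have "expectation (\<lambda>x. \<bar>G x - H x\<bar> ^ 3) \<le> expectation (\<lambda>x. 4 * (a x ^ 3 + b x ^ 3))"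
  proof (rule integral_mono)
    fix x
    have "\<bar>G x - H x\<bar> ^ 3 \<le> (a x + b x) ^ 3" unfolding a_def b_def by (intro power_mono) auto
    also have "\<dots> \<le> 4 * (a x ^ 3 + b x ^ 3)"
    proof -
      have "4 * (a x ^ 3 + b x ^ 3) - (a x + b x) ^ 3 = 3 * ((a x - b x)\<^sup>2 * (a x + b x))"
        by (simp add: power2_eq_square power3_eq_cube algebra_simps)
      moreover have "\<dots> \<ge> 0" using D[of x] by simp
      ultimately show ?thesis by linarith
    qed
    finally show "\<bar>G x - H x\<bar> ^ 3 \<le> 4 * (a x ^ 3 + b x ^ 3)" .
  qed (use ia ib id in auto)
  also have "\<dots> = 4 * (expectation (\<lambda>x. a x ^ 3) + expectation (\<lambda>x. b x ^ 3))" using ia ib by simp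
  also have "\<dots> \<le> 8 * expectation (\<lambda>x. a x ^ 3)" using ba by simp
  finally show ?thesis by (simp add: a_def)
qed

text \<open>Jensen for conditional expectations: a Renyi divergence cannot increase.\<close>

lemma (in prob_space) exp_renyi_projection_le:
  assumes [measurable]: "G \<in> borel_measurable M" "H \<in> borel_measurable M"
    and G: "\<And>x. m \<le> G x" "\<And>x. G x \<le> (K::real)"
    and H: "\<And>x. m \<le> H x" "\<And>x. H x \<le> K"
    and m: "0 < m" and q: "2 \<le> q"
    and orth: "expectation (\<lambda>x. (G x - H x) * H x powr (q - 1)) = 0"
  shows "exp_renyi q M H \<le> exp_renyi q M G"
proof -
  have Gpos: "G x > 0" and Hpos: "H x > 0" for x using G(1)[of x] H(1)[of x] m by linarith+
  note intG = integrable_powr_of_bounds[OF assms(1) m G]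
  note intH = integrable_powr_of_bounds[OF assms(2) m H]
  have intGH: "integrable M (\<lambda>x. (G x - H x) * H x powr (q - 1))"
  proof (rule integrable_of_bounded[where B = "K * K powr (q - 1)"])
    fix x
    have "\<bar>G x - H x\<bar> \<le> K" using G[of x] H[of x] m by (auto simp: abs_le_iff)
    then show "\<bar>(G x - H x) * H x powr (q - 1)\<bar> \<le> K * K powr (q - 1)"
      unfolding abs_mult using H m q by (intro mult_mono powr_bounds[where m = m]) auto
  qed simp
  have "expectation (\<lambda>x. H x powr q) = expectation (\<lambda>x. H x powr q + q * ((G x - H x) * H x powr (q - 1)))"
    using intH[of q] intGH q orth by simp
  also have "\<dots> \<le> expectation (\<lambda>x. G x powr q)"
    using intG[of q] intH[of q] intGH q powr_ge_tangent[OF Gpos Hpos, of q]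
    by (intro integral_mono) (auto simp: mult_ac)
  finally show ?thesis unfolding exp_renyi_def using q
    by (intro powr_mono2 integral_nonneg_AE) auto
qed

lemma exp_renyi_cong_integral:
  "(\<integral>x. g x powr q \<partial>\<mu>) = (\<integral>x. h x powr q \<partial>\<nu>) \<Longrightarrow> exp_renyi q \<mu> g = exp_renyi q \<nu> h"
  by (simp add: exp_renyi_def)

lemma integral_pair_fst:
  fixes \<mu> :: "'a::euclidean_space measure"
  assumes mu: "prob_space \<mu>" "sets \<mu> = sets borel" and d: "\<delta> > 0" and b: "bounded_borel b"
  shows "(\<integral>z. b (fst z) \<partial>(\<mu> \<Otimes>\<^sub>M gaussian (0::'a) \<delta>)) = (\<integral>x. b x \<partial>\<mu>)"
proof -
  note [measurable] = bounded_borel_measurable[OF b]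
  note [measurable_cong] = mu(2)
  interpret prob_space "gaussian (0::'a) \<delta>" by (rule prob_space_gaussian[OF d])
  obtain B where B: "\<And>x. \<bar>b x\<bar> \<le> B" using b by (auto simp: bounded_borel_def)
  show ?thesis
    using expectation_pair[OF mu(1) prob_space_axioms, of "\<lambda>z. b (fst z)" B] B
    by (simp add: prob_space[unfolded space_gaussian])
qed

lemma integral_pair_sum:
  fixes \<mu> :: "'a::euclidean_space measure"
  assumes mu: "prob_space \<mu>" "sets \<mu> = sets borel" and d: "\<delta> > 0" and b: "bounded_borel b"
  shows "(\<integral>z. b (fst z + snd z) \<partial>(\<mu> \<Otimes>\<^sub>M gaussian 0 \<delta>)) = (\<integral>x. b x \<partial>smear \<mu> \<delta>)"
proof -
  note [measurable] = bounded_borel_measurable[OF b]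
  note [measurable_cong] = mu(2)
  show ?thesis unfolding smear_def by (subst integral_distr) (auto simp: case_prod_beta)
qed

lemma bounded_borel_powr:
  assumes "bounded_borel g" "\<And>x. m \<le> g x" "0 < m" "0 \<le> r"
  shows "bounded_borel (\<lambda>x. g x powr r)"
proof -
  obtain B where B: "\<And>x. \<bar>g x\<bar> \<le> B" using assms by (auto simp: bounded_borel_def)
  have "\<bar>g x powr r\<bar> \<le> B powr r" for x
    using assms(2)[of x] assms(3,4) B[of x] by (intro powr_bounds) auto
  then show ?thesis using bounded_borel_measurable[OF assms(1)] by (intro bounded_borelI) auto
qed

lemma shift_weight_cube_integral:
  assumes t: "t > 0" and d: "\<delta> > 0" and r: "24 * sqrt (\<delta> / t) \<le> 1"
  shows "(\<integral>\<^sup>+v. \<integral>\<^sup>+u. ennreal (\<bar>shift_weight t v u - 1\<bar> ^ 3) \<partial>gaussian 0 t \<partial>gaussian (0::'a::euclidean_space) \<delta>)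
    \<le> ennreal (13824 * 2 ^ DIM('a) * sqrt (\<delta> / t) ^ 3)"
proof -
  have "gauss_density t (u + (- 1) *\<^sub>R v) / gauss_density t u = shift_weight t v u" for u v :: 'a
    using gauss_density_shift_weight[OF t, of u v] gauss_density_pos[OF t, of u] by simp
  then show ?thesis using gauss_ratio_cube_integral[OF t d r, of "- 1", where 'a = 'a] by simp
qed

text \<open>
  Compare the two averages as integrals against the same Gaussian, with the shift expressed as a weight.
\<close>

lemma heat_increment_cube:
  fixes g :: "'a::euclidean_space \<Rightarrow> real"
  assumes T: "T > 0" and [measurable]: "g \<in> borel_measurable borel" and K: "\<And>x. \<bar>g x\<bar> \<le> K"
  shows "ennreal (\<bar>heat T g (x + v) - heat T g x\<bar> ^ 3) \<le> ennreal (K ^ 3) * (\<integral>\<^sup>+u. ennreal (\<bar>shift_weight T v u - 1\<bar> ^ 3) \<partial>gaussian 0 T)"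
proof -
  interpret prob_space "gaussian (0::'a) T" by (rule prob_space_gaussian[OF T])
  have b: "bounded_borel g" using assms(2) K by (rule bounded_borelI)
  have K0: "K \<ge> 0" using K[of 0] by linarith
  have wi: "integrable (gaussian 0 T) (\<lambda>u. shift_weight T v u - 1)"
    by (intro Bochner_Integration.integrable_diff shift_weight_integrable(1)[OF T]) simp
  note gi = bounded_mult_integrable[OF b wi, of x]
  have "heat T g (x + v) - heat T g x = (\<integral>u. g (x + u) * (shift_weight T v u - 1) \<partial>gaussian 0 T)"
    unfolding heat_shift_weight[OF T b] heat_def[of T g x]
    using bounded_mult_integrable[OF b shift_weight_integrable(1)[OF T, of v], of x] heat_integrable[OF T b, of x]
    by (simp add: right_diff_distrib)
  also have "\<bar>\<dots>\<bar> \<le> (\<integral>u. \<bar>g (x + u) * (shift_weight T v u - 1)\<bar> \<partial>gaussian 0 T)" by (rule integral_abs_bound)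
  also have "\<dots> \<le> (\<integral>u. K * \<bar>shift_weight T v u - 1\<bar> \<partial>gaussian 0 T)"
    using K by (intro integral_mono integrable_abs integrable_mult_right gi wi) (auto simp: abs_mult intro!: mult_right_mono)
  finally have "\<bar>heat T g (x + v) - heat T g x\<bar> \<le> K * (\<integral>u. \<bar>shift_weight T v u - 1\<bar> \<partial>gaussian 0 T)" by simp
  then have "\<bar>heat T g (x + v) - heat T g x\<bar> ^ 3 \<le> (K * (\<integral>u. \<bar>shift_weight T v u - 1\<bar> \<partial>gaussian 0 T)) ^ 3"
    by (intro power_mono) auto
  then have "ennreal (\<bar>heat T g (x + v) - heat T g x\<bar> ^ 3) \<le> ennreal (K ^ 3) * ennreal ((\<integral>u. \<bar>shift_weight T v u - 1\<bar> \<partial>gaussian 0 T) ^ 3)"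
    using K0 by (simp add: power_mult_distrib ennreal_leI flip: ennreal_mult)
  also have "\<dots> \<le> ennreal (K ^ 3) * (\<integral>\<^sup>+u. ennreal (\<bar>shift_weight T v u - 1\<bar> ^ 3) \<partial>gaussian 0 T)"
    using wi by (intro mult_left_mono cube_expectation_le) auto
  finally show ?thesis .
qed

lemma integral_le_of_nn_integral_le:
  assumes "prob_space M" "f \<in> borel_measurable M" "\<And>x. 0 \<le> f x" "(\<integral>\<^sup>+x. ennreal (f x) \<partial>M) \<le> ennreal c" "0 \<le> c"
  shows "(\<integral>x. f x \<partial>M) \<le> c"
proof -
  have "integrable M f" using assms by (intro integrableI_nonneg) (auto simp: le_less_trans[OF assms(4)])
  then have "ennreal (\<integral>x. f x \<partial>M) = (\<integral>\<^sup>+x. ennreal (f x) \<partial>M)" using assms by (intro nn_integral_eq_integral[symmetric]) auto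
  with assms show ?thesis by (metis ennreal_le_iff)
qed

lemma heat_bounds:
  fixes g :: "'a::euclidean_space \<Rightarrow> real"
  assumes t: "t > 0" and b: "bounded_borel g" and "\<And>x. m \<le> g x" "\<And>x. g x \<le> K"
  shows "m \<le> heat t g x" "heat t g x \<le> K"
  using heat_mono[OF t bounded_borel_const[of m] b assms(3), of x]
    heat_mono[OF t b bounded_borel_const[of K] assms(4), of x] t by auto

text \<open>
  \<open>small_step_contraction\<close> on the product of \<open>\<mu>\<close> and a portion of noise: \<open>G\<close> is the density \<open>heat T g\<close> at the noisy
  point and \<open>H\<close> its conditional mean given the starting point. For the cubic error \<open>\<xi>\<close> is \<open>heat T g\<close> at the
  starting point. The previous smoothing \<open>T\<close> has to dominate \<open>\<delta>\<close>.
\<close>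

lemma heat_forward_step:
  fixes \<mu> :: "'a::euclidean_space measure"
  assumes mu: "prob_space \<mu>" "sets \<mu> = sets borel" and d: "\<delta> > 0" and a: "a \<ge> 0" and gap: "heat_gap a \<delta> \<mu>"
    and T: "T > 0" and r: "24 * sqrt (\<delta> / T) \<le> 1"
    and gm: "g \<in> borel_measurable borel" and g: "\<And>x. m \<le> g x" "\<And>x. g x \<le> K" and m: "0 < m" and q: "2 \<le> q"
    and one: "(\<integral>x. heat (T + \<delta>) g x \<partial>\<mu>) = 1"
    and C: "C \<ge> 0" "\<And>a b. a \<in> {m..K} \<Longrightarrow> b \<in> {m..K} \<Longrightarrow>
      a powr q - b powr q - q * b powr (q - 1) * (a - b)
      \<ge> (2 * (q - 1) / q) * (a powr (q/2) - b powr (q/2))\<^sup>2 - C * \<bar>a - b\<bar> ^ 3"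
  shows "exp_renyi q \<mu> (heat (T + \<delta>) g) - 1
    \<le> (1 - (2/q) * (a / (1 + a))) * (exp_renyi q (smear \<mu> \<delta>) (heat T g) - 1)
      + C * (8 * (K ^ 3 * (13824 * 2 ^ DIM('a) * sqrt (\<delta> / T) ^ 3)))"
proof -
  note [measurable] = gm
  note [measurable_cong] = mu(2)
  define M where "M = \<mu> \<Otimes>\<^sub>M gaussian (0::'a) \<delta>"
  have [measurable_cong]: "sets M = sets (borel \<Otimes>\<^sub>M borel)" unfolding M_def by (intro sets_pair_measure_cong mu) simp
  interpret mu: prob_space \<mu> by fact
  interpret ga: prob_space "gaussian (0::'a) \<delta>" by (rule prob_space_gaussian[OF d])
  interpret pp: pair_prob_space \<mu> "gaussian (0::'a) \<delta>" ..
  interpret prob_space M unfolding M_def by (rule pp.prob_space_axioms)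
  have K0: "K \<ge> 0" "\<bar>g x\<bar> \<le> K" for x using g(1)[of x] g(2)[of x] m by auto
  have gb: "bounded_borel g" using gm K0(2) by (rule bounded_borelI)
  define k where "k = heat T g"
  define h where "h = heat (T + \<delta>) g"
  have kb: "bounded_borel k" and hb: "bounded_borel h" unfolding k_def h_def using T d by (intro heat_bounded_borel gb; simp)+
  have kB: "m \<le> k x" "k x \<le> K" and hB: "m \<le> h x" "h x \<le> K" for x
    unfolding k_def h_def using heat_bounds[OF _ gb g] T d by auto
  have hk: "h = heat \<delta> k" unfolding h_def k_def using heat_heat[OF d T gb] by (simp add: add.commute)
  note [measurable] = bounded_borel_measurable[OF kb] bounded_borel_measurable[OF hb]
  define G where "G z = k (fst z + snd z)" for z
  define H where "H z = h (fst z)" for z :: "'a \<times> 'a"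
  define \<xi> where "\<xi> z = k (fst z)" for z :: "'a \<times> 'a"
  have meas [measurable]: "G \<in> borel_measurable M" "H \<in> borel_measurable M" "\<xi> \<in> borel_measurable M"
    unfolding G_def H_def \<xi>_def by measurable
  note fstI = integral_pair_fst[OF mu d, folded M_def] and sumI = integral_pair_sum[OF mu d, folded M_def]
  have orth: "expectation (\<lambda>z. (G z - H z) * \<phi> (fst z)) = 0" if phi: "bounded_borel \<phi>" for \<phi>
  proof -
    note [measurable] = bounded_borel_measurable[OF phi]
    obtain B where B: "B \<ge> 0" "\<And>x. \<bar>\<phi> x\<bar> \<le> B" using bounded_borelE[OF phi] by blast
    have "expectation (\<lambda>z. (G z - H z) * \<phi> (fst z)) = (\<integral>x. \<integral>v. (k (x + v) - h x) * \<phi> x \<partial>gaussian 0 \<delta> \<partial>\<mu>)"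
      unfolding M_def
    proof (subst expectation_pair[OF mu(1) ga.prob_space_axioms])
      show "\<bar>(G z - H z) * \<phi> (fst z)\<bar> \<le> (2 * K) * B" for z
        unfolding abs_mult G_def H_def using kB[of "fst z + snd z"] hB[of "fst z"] B K0 m by (intro mult_mono) auto
    qed (auto simp: G_def H_def)
    also have "\<dots> = 0"
    proof -
      have "(\<integral>v. k (x + v) - h x \<partial>gaussian 0 \<delta>) = 0" for x
        using heat_integrable[OF d kb, of x] ga.prob_space by (simp add: hk heat_def)
      then show ?thesis by simp
    qed
    finally show ?thesis .
  qed
  have hp: "bounded_borel (\<lambda>x. h x powr r)" and kp: "bounded_borel (\<lambda>x. k x powr r)" if "0 \<le> r" for r
    using bounded_borel_powr[OF hb hB(1) m that] bounded_borel_powr[OF kb kB(1) m that] by auto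
  have E1: "exp_renyi q M G = exp_renyi q (smear \<mu> \<delta>) k"
    using q by (intro exp_renyi_cong_integral) (simp add: G_def sumI[OF kp])
  have E2: "exp_renyi q M H = exp_renyi q \<mu> h"
    using q by (intro exp_renyi_cong_integral) (simp add: H_def fstI[OF hp])
  have "exp_renyi q M H - 1 \<le> (1 - (2/q) * (a / (1 + a))) * (exp_renyi q M G - 1)
      + C * (8 * (K ^ 3 * (13824 * 2 ^ DIM('a) * sqrt (\<delta> / T) ^ 3)))"
  proof (rule small_step_contraction[where m = m and K = K])
    show "expectation G = 1" "expectation H = 1"
      using one integral_smear[OF d mu kb] by (simp_all add: G_def[abs_def] H_def[abs_def] sumI[OF kb] fstI[OF hb] hk[symmetric] h_def[symmetric])
    show "expectation (\<lambda>x. (G x - H x) * H x powr (q - 1)) = 0"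
      using orth[OF hp[of "q - 1"]] q by (simp add: H_def)
    show "a / (1 + a) * (expectation (\<lambda>x. G x powr q) - (expectation (\<lambda>x. G x powr (q / 2)))\<^sup>2)
        \<le> expectation (\<lambda>x. (G x powr (q / 2) - H x powr (q / 2))\<^sup>2)"
    proof -
      have sq: "(k x powr (q/2))\<^sup>2 = k x powr q" for x
        using kB(1)[of x] m by (simp add: powr_powr powr_realpow[symmetric] flip: powr_numeral)
      have "expectation (\<lambda>x. G x powr q) - (expectation (\<lambda>x. G x powr (q / 2)))\<^sup>2 = variance_wrt (smear \<mu> \<delta>) (\<lambda>x. k x powr (q/2))"
        using q by (simp add: variance_wrt_def sq G_def sumI[OF kp])
      moreover have "expectation (\<lambda>x. (G x powr (q / 2) - H x powr (q / 2))\<^sup>2)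
         = (\<integral>x. \<integral>v. (k (x + v) powr (q/2) - h x powr (q/2))\<^sup>2 \<partial>gaussian 0 \<delta> \<partial>\<mu>)"
        unfolding M_def
      proof (subst expectation_pair[OF mu(1) ga.prob_space_axioms])
        fix z
        have "\<bar>k (fst z + snd z) powr (q/2)\<bar> \<le> K powr (q/2)" "\<bar>h (fst z) powr (q/2)\<bar> \<le> K powr (q/2)"
          using kB hB m q by (intro powr_bounds[where m = m]; simp)+
        then have "\<bar>G z powr (q/2) - H z powr (q/2)\<bar> \<le> 2 * K powr (q/2)" unfolding G_def H_def by linarith
        then have "\<bar>G z powr (q/2) - H z powr (q/2)\<bar>\<^sup>2 \<le> (2 * K powr (q/2))\<^sup>2" by (intro power_mono) auto
        then show "\<bar>(G z powr (q/2) - H z powr (q/2))\<^sup>2\<bar> \<le> (2 * K powr (q/2))\<^sup>2" by simp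
      qed (auto simp: G_def H_def)
      ultimately show ?thesis
        using heat_gap_forward[OF mu d a gap kp[of "q/2"] hp[of "q/2"]] q by simp
    qed
    show "expectation (\<lambda>x. \<bar>G x - H x\<bar> ^ 3) \<le> 8 * (K ^ 3 * (13824 * 2 ^ DIM('a) * sqrt (\<delta> / T) ^ 3))"
    proof -
      define \<phi> where "\<phi> x = \<bar>k x - h x\<bar> * (k x - h x)" for x
      have "bounded_borel \<phi>"
      proof (rule bounded_borelI)
        show "\<bar>\<phi> x\<bar> \<le> K * K" for x unfolding \<phi>_def abs_mult
          using kB[of x] hB[of x] m by (intro mult_mono) auto
      qed (simp add: \<phi>_def[abs_def])
      from orth[OF this] have o: "expectation (\<lambda>x. (G x - H x) * (\<bar>\<xi> x - H x\<bar> * (\<xi> x - H x))) = 0"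
        by (simp add: \<phi>_def \<xi>_def H_def)
      have "expectation (\<lambda>x. \<bar>G x - H x\<bar> ^ 3) \<le> 8 * expectation (\<lambda>x. \<bar>G x - \<xi> x\<bar> ^ 3)"
      proof (rule projection_cube_le[where B = K, OF meas _ _ _ o])
        have "\<bar>k x\<bar> \<le> K" "\<bar>h x\<bar> \<le> K" for x using kB[of x] hB[of x] m by auto
        then show "\<bar>G z\<bar> \<le> K" "\<bar>H z\<bar> \<le> K" "\<bar>\<xi> z\<bar> \<le> K" for z by (simp_all add: G_def H_def \<xi>_def)
      qed
      moreover have "expectation (\<lambda>x. \<bar>G x - \<xi> x\<bar> ^ 3) \<le> K ^ 3 * (13824 * 2 ^ DIM('a) * sqrt (\<delta> / T) ^ 3)"
      proof (rule integral_le_of_nn_integral_le[OF prob_space_axioms])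
        have "(\<integral>\<^sup>+z. ennreal (\<bar>G z - \<xi> z\<bar> ^ 3) \<partial>M) = (\<integral>\<^sup>+x. \<integral>\<^sup>+v. ennreal (\<bar>k (x + v) - k x\<bar> ^ 3) \<partial>gaussian 0 \<delta> \<partial>\<mu>)"
          unfolding M_def by (subst ga.nn_integral_fst[symmetric]) (auto simp: G_def \<xi>_def)
        also have "\<dots> \<le> (\<integral>\<^sup>+x. \<integral>\<^sup>+v. ennreal (K ^ 3) * (\<integral>\<^sup>+u. ennreal (\<bar>shift_weight T v u - 1\<bar> ^ 3) \<partial>gaussian 0 T) \<partial>gaussian (0::'a) \<delta> \<partial>\<mu>)"
        proof (rule nn_integral_mono, rule nn_integral_mono)
          fix x v
          show "ennreal (\<bar>k (x + v) - k x\<bar> ^ 3) \<le> ennreal (K ^ 3) * (\<integral>\<^sup>+u. ennreal (\<bar>shift_weight T v u - 1\<bar> ^ 3) \<partial>gaussian 0 T)"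
            using heat_increment_cube[OF T gm K0(2), of x v] unfolding k_def .
        qed
        also have "\<dots> \<le> (\<integral>\<^sup>+x. ennreal (K ^ 3 * (13824 * 2 ^ DIM('a) * sqrt (\<delta> / T) ^ 3)) \<partial>\<mu>)"
        proof (intro nn_integral_mono)
          interpret gT: prob_space "gaussian (0::'a) T" by (rule prob_space_gaussian[OF T])
          have "(\<integral>\<^sup>+v. ennreal (K ^ 3) * (\<integral>\<^sup>+u. ennreal (\<bar>shift_weight T v u - 1\<bar> ^ 3) \<partial>gaussian 0 T) \<partial>gaussian (0::'a) \<delta>)
             = ennreal (K ^ 3) * (\<integral>\<^sup>+v. (\<integral>\<^sup>+u. ennreal (\<bar>shift_weight T v u - 1\<bar> ^ 3) \<partial>gaussian 0 T) \<partial>gaussian (0::'a) \<delta>)"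
            unfolding shift_weight_def by (intro nn_integral_cmult) measurable
          also have "\<dots> \<le> ennreal (K ^ 3) * ennreal (13824 * 2 ^ DIM('a) * sqrt (\<delta> / T) ^ 3)"
            by (intro mult_left_mono shift_weight_cube_integral T d r) simp
          finally show "(\<integral>\<^sup>+v. ennreal (K ^ 3) * (\<integral>\<^sup>+u. ennreal (\<bar>shift_weight T v u - 1\<bar> ^ 3) \<partial>gaussian 0 T) \<partial>gaussian (0::'a) \<delta>)
             \<le> ennreal (K ^ 3 * (13824 * 2 ^ DIM('a) * sqrt (\<delta> / T) ^ 3))"
            using K0 by (simp add: ennreal_mult')
        qed
        also have "\<dots> = ennreal (K ^ 3 * (13824 * 2 ^ DIM('a) * sqrt (\<delta> / T) ^ 3))" using mu.emeasure_space_1 by simp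
        finally show "(\<integral>\<^sup>+z. ennreal (\<bar>G z - \<xi> z\<bar> ^ 3) \<partial>M) \<le> ennreal (K ^ 3 * (13824 * 2 ^ DIM('a) * sqrt (\<delta> / T) ^ 3))" .
      qed (use K0 T d in auto)
      ultimately show ?thesis by linarith
    qed
    show "0 \<le> a / (1 + a)" using a by simp
  qed (use meas kB hB m q C in \<open>auto simp: G_def H_def\<close>)
  then show ?thesis by (simp add: E1 E2 k_def h_def)
qed

section \<open>Posterior means and small backward steps\<close>

text \<open>
  For \<open>h = 1\<close> this is the Lebesgue density of \<open>smear \<mu> t\<close>; in general it is that of the measure with density \<open>h\<close> after adding noise.
\<close>

definition smoothed :: "real \<Rightarrow> 'a::euclidean_space measure \<Rightarrow> ('a \<Rightarrow> real) \<Rightarrow> 'a \<Rightarrow> real" where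
  "smoothed t \<mu> h y = (\<integral>x. h x * gauss_density t (y - x) \<partial>\<mu>)"

text \<open>
  The conditional expectation of \<open>h\<close> at the starting point of law \<open>\<mu>\<close>, given the noisy position \<open>y\<close>.
\<close>

definition posterior_mean :: "real \<Rightarrow> 'a::euclidean_space measure \<Rightarrow> ('a \<Rightarrow> real) \<Rightarrow> 'a \<Rightarrow> real" where
  "posterior_mean t \<mu> h y = smoothed t \<mu> h y / smoothed t \<mu> (\<lambda>_. 1) y"

lemma heat_lborel:
  fixes b :: "'a::euclidean_space \<Rightarrow> real"
  assumes t: "t > 0" and [measurable]: "b \<in> borel_measurable borel"
  shows "heat t b x = (\<integral>y. gauss_density t (y - x) * b y \<partial>lborel)"
proof -
  have "heat t b x = (\<integral>y. b y \<partial>distr (gaussian 0 t) borel (\<lambda>u. x + u))"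
    by (subst integral_distr) (auto simp: heat_def)
  also have "\<dots> = (\<integral>y. gauss_density t (y - x) * b y \<partial>lborel)"
    unfolding distr_gaussian_shift[OF t] unfolding gaussian_eq_density
    by (subst integral_density) (auto simp: gauss_density_nonneg[OF t])
  finally show ?thesis .
qed

context
  fixes \<mu> :: "'a::euclidean_space measure" and t :: real
  assumes mu: "prob_space \<mu>" "sets \<mu> = sets borel" and t: "t > 0"
begin

interpretation prob_space \<mu> by (rule mu)

lemma gauss_weight_integrable:
  assumes h: "bounded_borel h"
  shows "integrable \<mu> (\<lambda>x. h x * gauss_density t (y - x))"
proof -
  note [measurable_cong] = mu(2)
  have "bounded_borel (\<lambda>x. gauss_density t (y - x))"
  proof (rule bounded_borelI)
    show "\<bar>gauss_density t (y - x)\<bar> \<le> 1 / sqrt (2 * pi * t) ^ DIM('a)" for x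
      using gauss_density_le[OF t, of "y - x"] gauss_density_nonneg[OF t, of "y - x"] by simp
  qed simp
  then show ?thesis by (intro bounded_borel_integrable mu bounded_borel_mult h)
qed

lemma smoothed_measurable:
  assumes h: "bounded_borel h" shows "smoothed t \<mu> h \<in> borel_measurable borel"
proof -
  note [measurable_cong] = mu(2)
  note [measurable] = bounded_borel_measurable[OF h]
  show ?thesis unfolding smoothed_def by measurable
qed

lemma smoothed_one_pos: "smoothed t \<mu> (\<lambda>_. 1) y > 0"
proof -
  note [measurable_cong] = mu(2)
  have "(\<integral>x. 0 \<partial>\<mu>) < (\<integral>x. 1 * gauss_density t (y - x) \<partial>\<mu>)"
    using gauss_weight_integrable[of "\<lambda>_. 1" y] gauss_density_pos[OF t]
    by (intro integral_less_AE_space) (auto simp: emeasure_space_1)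
  then show ?thesis by (simp add: smoothed_def)
qed

lemma posterior_mean_bounds:
  assumes h: "bounded_borel h" and hb: "\<And>x. m \<le> h x" "\<And>x. h x \<le> K"
  shows "m \<le> posterior_mean t \<mu> h y" "posterior_mean t \<mu> h y \<le> K"
proof -
  note [measurable_cong] = mu(2)
  have "(\<integral>x. m * gauss_density t (y - x) \<partial>\<mu>) \<le> smoothed t \<mu> h y" "smoothed t \<mu> h y \<le> (\<integral>x. K * gauss_density t (y - x) \<partial>\<mu>)"
    unfolding smoothed_def
    by (rule integral_mono[OF gauss_weight_integrable[OF bounded_borel_const] gauss_weight_integrable[OF h]]
          integral_mono[OF gauss_weight_integrable[OF h] gauss_weight_integrable[OF bounded_borel_const]],
        rule mult_right_mono[OF _ gauss_density_nonneg[OF t]], rule hb)+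
  then have "m * smoothed t \<mu> (\<lambda>_. 1) y \<le> smoothed t \<mu> h y" "smoothed t \<mu> h y \<le> K * smoothed t \<mu> (\<lambda>_. 1) y"
    by (simp_all add: smoothed_def)
  then show "m \<le> posterior_mean t \<mu> h y" "posterior_mean t \<mu> h y \<le> K"
    using smoothed_one_pos[of y] by (simp_all add: posterior_mean_def field_simps)
qed

lemma posterior_mean_measurable:
  assumes h: "bounded_borel h" shows "posterior_mean t \<mu> h \<in> borel_measurable borel"
proof -
  note [measurable_cong] = mu(2)
  note [measurable] = smoothed_measurable[OF h] smoothed_measurable[OF bounded_borel_const[of 1]]
  show ?thesis unfolding posterior_mean_def by measurable
qed

lemma posterior_mean_bounded_borel:
  assumes h: "bounded_borel h" shows "bounded_borel (posterior_mean t \<mu> h)"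
proof -
  note [measurable_cong] = mu(2)
  obtain B where B: "\<And>x. \<bar>h x\<bar> \<le> B" using h by (auto simp: bounded_borel_def)
  then have "- B \<le> h x" "h x \<le> B" for x by (auto simp: abs_le_iff minus_le_iff)
  from posterior_mean_bounds[OF h this] have "\<bar>posterior_mean t \<mu> h y\<bar> \<le> B" for y
    by (simp add: abs_le_iff minus_le_iff)
  then show ?thesis using posterior_mean_measurable[OF h] by (intro bounded_borelI)
qed

text \<open>Fubini, with the Gaussian density as a symmetric kernel.\<close>

lemma heat_smoothed_duality:
  assumes h: "bounded_borel h" and b: "bounded_borel b"
  shows "(\<integral>x. h x * heat t b x \<partial>\<mu>) = (\<integral>y. b y * smoothed t \<mu> h y \<partial>lborel)"
proof -
  note [measurable_cong] = mu(2)
  note [measurable] = bounded_borel_measurable[OF h] bounded_borel_measurable[OF b]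
  interpret pair_sigma_finite \<mu> lborel ..
  obtain B where B: "B \<ge> 0" "\<And>x. \<bar>b x\<bar> \<le> B" using bounded_borelE[OF b] by blast
  obtain H where H: "H \<ge> 0" "\<And>x. \<bar>h x\<bar> \<le> H" using bounded_borelE[OF h] by blast
  have gi: "integrable (\<mu> \<Otimes>\<^sub>M lborel) (\<lambda>(x, y). gauss_density t (y - x))"
  proof (rule integrableI_nonneg)
    have "(\<integral>\<^sup>+z. ennreal (case z of (x, y) \<Rightarrow> gauss_density t (y - x)) \<partial>(\<mu> \<Otimes>\<^sub>M lborel))
        = (\<integral>\<^sup>+x. \<integral>\<^sup>+y. ennreal (gauss_density t (- x + y)) \<partial>lborel \<partial>\<mu>)"
      by (subst lborel.nn_integral_fst[symmetric]) auto
    also have "\<dots> = 1"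
      by (subst nn_integral_lborel_translate) (auto simp: gauss_density_nn_integral[OF t] emeasure_space_1)
    finally show "(\<integral>\<^sup>+z. ennreal (case z of (x, y) \<Rightarrow> gauss_density t (y - x)) \<partial>(\<mu> \<Otimes>\<^sub>M lborel)) < \<infinity>" by simp
  qed (auto simp: gauss_density_nonneg[OF t])
  have "integrable (\<mu> \<Otimes>\<^sub>M lborel) (\<lambda>(x, y). h x * (gauss_density t (y - x) * b y))"
  proof (rule Bochner_Integration.integrable_bound)
    show "integrable (\<mu> \<Otimes>\<^sub>M lborel) (\<lambda>z. H * B * (case z of (x, y) \<Rightarrow> gauss_density t (y - x)))"
      using gi by simp
    show "AE z in \<mu> \<Otimes>\<^sub>M lborel. norm (case z of (x, y) \<Rightarrow> h x * (gauss_density t (y - x) * b y))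
       \<le> norm (H * B * (case z of (x, y) \<Rightarrow> gauss_density t (y - x)))"
    proof (intro AE_I2)
      fix z :: "'a \<times> 'a"
      obtain x y where z: "z = (x, y)" by (cases z)
      have "\<bar>h x\<bar> * \<bar>b y\<bar> * gauss_density t (y - x) \<le> H * B * gauss_density t (y - x)"
        using B H gauss_density_nonneg[OF t] by (intro mult_right_mono mult_mono) auto
      then show "norm (case z of (x, y) \<Rightarrow> h x * (gauss_density t (y - x) * b y))
        \<le> norm (H * B * (case z of (x, y) \<Rightarrow> gauss_density t (y - x)))"
        using B H gauss_density_nonneg[OF t, of "y - x"] by (simp add: z abs_mult mult_ac)
    qed
  qed simp
  from Fubini_integral[OF this]
  have F: "(\<integral>x. \<integral>y. h x * (gauss_density t (y - x) * b y) \<partial>lborel \<partial>\<mu>) = (\<integral>y. \<integral>x. h x * (gauss_density t (y - x) * b y) \<partial>\<mu> \<partial>lborel)"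
    by simp
  have e1: "(\<integral>y. h x * (gauss_density t (y - x) * b y) \<partial>lborel) = h x * heat t b x" for x
    by (simp add: heat_lborel[OF t])
  have e2: "(\<integral>x. h x * (gauss_density t (y - x) * b y) \<partial>\<mu>) = b y * smoothed t \<mu> h y" for y
    unfolding smoothed_def by (subst integral_mult_right_zero[symmetric]) (simp add: mult_ac)
  show ?thesis using F unfolding e1 e2 .
qed

text \<open>
  The defining property of a conditional expectation: \<open>posterior_mean\<close> is the adjoint of \<open>heat\<close>.
\<close>

lemma posterior_mean_duality:
  assumes h: "bounded_borel h" and b: "bounded_borel b"
  shows "(\<integral>y. posterior_mean t \<mu> h y * b y \<partial>smear \<mu> t) = (\<integral>x. h x * heat t b x \<partial>\<mu>)"
proof -
  note [measurable_cong] = mu(2)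
  have pb: "bounded_borel (\<lambda>y. posterior_mean t \<mu> h y * b y)"
    by (intro bounded_borel_mult posterior_mean_bounded_borel h b)
  have "(\<integral>y. posterior_mean t \<mu> h y * b y \<partial>smear \<mu> t) = (\<integral>x. 1 * heat t (\<lambda>y. posterior_mean t \<mu> h y * b y) x \<partial>\<mu>)"
    by (simp add: integral_smear[OF t mu pb])
  also have "\<dots> = (\<integral>y. (posterior_mean t \<mu> h y * b y) * smoothed t \<mu> (\<lambda>_. 1) y \<partial>lborel)"
    by (rule heat_smoothed_duality[OF bounded_borel_const pb])
  also have "\<dots> = (\<integral>y. b y * smoothed t \<mu> h y \<partial>lborel)"
    using smoothed_one_pos by (intro Bochner_Integration.integral_cong) (auto simp: posterior_mean_def less_imp_neq[symmetric])
  also have "\<dots> = (\<integral>x. h x * heat t b x \<partial>\<mu>)" by (rule heat_smoothed_duality[OF h b, symmetric])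
  finally show ?thesis .
qed

lemma nn_smoothed_one: "(\<integral>\<^sup>+x. ennreal (gauss_density t (y - x)) \<partial>\<mu>) = ennreal (smoothed t \<mu> (\<lambda>_. 1) y)"
  using gauss_weight_integrable[OF bounded_borel_const[of 1], of y] gauss_density_nonneg[OF t]
  unfolding smoothed_def by (subst nn_integral_eq_integral) auto

lemma smear_eq_density: "smear \<mu> t = density lborel (\<lambda>y. ennreal (smoothed t \<mu> (\<lambda>_. 1) y))"
proof (rule measure_eqI)
  note [measurable_cong] = mu(2)
  note [measurable] = smoothed_measurable[OF bounded_borel_const[of 1]]
  interpret g: prob_space "gaussian (0::'a) t" by (rule prob_space_gaussian[OF t])
  interpret pair_sigma_finite \<mu> lborel ..
  fix A assume "A \<in> sets (smear \<mu> t)"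
  then have [measurable]: "A \<in> sets borel" by simp
  have "emeasure (smear \<mu> t) A = (\<integral>\<^sup>+z. indicator A (fst z + snd z) \<partial>(\<mu> \<Otimes>\<^sub>M gaussian 0 t))"
    unfolding smear_def by (subst nn_integral_indicator[symmetric], simp, subst nn_integral_distr) (auto simp: case_prod_beta)
  also have "\<dots> = (\<integral>\<^sup>+x. \<integral>\<^sup>+u. indicator A (x + u) \<partial>gaussian 0 t \<partial>\<mu>)"
    by (subst g.nn_integral_fst[symmetric]) auto
  also have "\<dots> = (\<integral>\<^sup>+x. \<integral>\<^sup>+y. ennreal (gauss_density t (y - x)) * indicator A y \<partial>lborel \<partial>\<mu>)"
    by (subst nn_integral_gaussian_shift[OF t], simp, subst nn_integral_gaussian[OF t]) auto
  also have "\<dots> = (\<integral>\<^sup>+y. \<integral>\<^sup>+x. ennreal (gauss_density t (y - x)) * indicator A y \<partial>\<mu> \<partial>lborel)"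
    by (rule Fubini'[symmetric]) simp
  also have "\<dots> = (\<integral>\<^sup>+y. ennreal (smoothed t \<mu> (\<lambda>_. 1) y) * indicator A y \<partial>lborel)"
    by (simp add: nn_integral_multc nn_smoothed_one)
  also have "\<dots> = emeasure (density lborel (\<lambda>y. ennreal (smoothed t \<mu> (\<lambda>_. 1) y))) A"
    by (simp add: emeasure_density)
  finally show "emeasure (smear \<mu> t) A = emeasure (density lborel (\<lambda>y. ennreal (smoothed t \<mu> (\<lambda>_. 1) y))) A" .
qed simp

text \<open>
  Moving \<open>y\<close> by \<open>v\<close> changes the numerator and the denominator of the posterior mean by at most the relative change of the
  Gaussian density, averaged over the posterior at \<open>y\<close>. Multiplied by the density of \<open>y\<close> the posterior becomes the
  joint law, so nothing about \<open>\<mu>\<close> enters the resulting error.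
\<close>

lemma posterior_mean_increment_cube:
  assumes hm: "h \<in> borel_measurable borel" and K: "\<And>x. \<bar>h x\<bar> \<le> K"
  shows "ennreal (\<bar>posterior_mean t \<mu> h (y + v) - posterior_mean t \<mu> h y\<bar> ^ 3) * ennreal (smoothed t \<mu> (\<lambda>_. 1) y)
    \<le> ennreal ((2 * K) ^ 3) * (\<integral>\<^sup>+x. ennreal (gauss_density t (y - x))
          * ennreal (\<bar>gauss_density t (y - x + v) / gauss_density t (y - x) - 1\<bar> ^ 3) \<partial>\<mu>)"
proof -
  note [measurable_cong] = mu(2)
  note [measurable] = hm
  have h: "bounded_borel h" using hm K by (rule bounded_borelI)
  have K0: "K \<ge> 0" using K[of 0] by linarith
  define s where "s = smoothed t \<mu> (\<lambda>_. 1) y"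
  define P where "P = density \<mu> (\<lambda>x. ennreal (gauss_density t (y - x) / s))"
  define R where "R x = \<bar>gauss_density t (y - x + v) / gauss_density t (y - x) - 1\<bar>" for x
  have [measurable]: "R \<in> borel_measurable borel" unfolding R_def by measurable
  have s0: "s > 0" unfolding s_def by (rule smoothed_one_pos)
  have g0: "gauss_density t z > 0" for z :: 'a by (rule gauss_density_pos[OF t])
  interpret P: prob_space P
  proof
    have "emeasure P (space P) = (\<integral>\<^sup>+x. ennreal (gauss_density t (y - x)) * ennreal (1 / s) \<partial>\<mu>)"
      unfolding P_def using s0 g0 by (subst emeasure_density) (auto simp: less_imp_le simp flip: ennreal_mult intro!: nn_integral_cong)
    also have "\<dots> = ennreal s * ennreal (1 / s)"
      by (subst nn_integral_multc) (auto simp: nn_smoothed_one s_def)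
    also have "\<dots> = 1" using s0 by (simp flip: ennreal_mult)
    finally show "emeasure P (space P) = 1" .
  qed
  have Rg: "gauss_density t (y - x) * R x = \<bar>gauss_density t (y + v - x) - gauss_density t (y - x)\<bar>" for x
  proof -
    have "gauss_density t (y - x) * R x = \<bar>gauss_density t (y - x) * (gauss_density t (y - x + v) / gauss_density t (y - x) - 1)\<bar>"
      unfolding R_def abs_mult using g0[of "y - x"] by simp
    also have "\<dots> = \<bar>gauss_density t (y + v - x) - gauss_density t (y - x)\<bar>"
      using g0[of "y - x"] by (simp add: right_diff_distrib algebra_simps)
    finally show ?thesis .
  qed
  note gi = gauss_weight_integrable[OF bounded_borel_const[of 1], simplified]
  have RgI: "integrable \<mu> (\<lambda>x. gauss_density t (y - x) * R x)"
    unfolding Rg by (intro integrable_abs Bochner_Integration.integrable_diff gi)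
  have RP: "integrable P R" and RPe: "(\<integral>x. R x \<partial>P) = (\<integral>x. gauss_density t (y - x) * R x \<partial>\<mu>) / s"
    unfolding P_def using RgI s0 g0
    by (subst integrable_density integral_density; force simp: less_imp_le)+
  define D where "D = (\<integral>x. gauss_density t (y - x) * R x \<partial>\<mu>)"
  have D0: "D \<ge> 0" unfolding D_def using g0 by (intro integral_nonneg_AE) (auto simp: R_def less_imp_le)
  have inc: "\<bar>smoothed t \<mu> f (y + v) - smoothed t \<mu> f y\<bar> \<le> B * D" if f: "bounded_borel f" and B: "\<And>x. \<bar>f x\<bar> \<le> B" for f B
  proof -
    have "smoothed t \<mu> f (y + v) - smoothed t \<mu> f y = (\<integral>x. f x * gauss_density t (y + v - x) - f x * gauss_density t (y - x) \<partial>\<mu>)"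
      unfolding smoothed_def by (intro Bochner_Integration.integral_diff[symmetric] gauss_weight_integrable f)
    also have "\<bar>\<dots>\<bar> \<le> (\<integral>x. \<bar>f x * gauss_density t (y + v - x) - f x * gauss_density t (y - x)\<bar> \<partial>\<mu>)" by (rule integral_abs_bound)
    also have "\<dots> \<le> (\<integral>x. B * (gauss_density t (y - x) * R x) \<partial>\<mu>)"
    proof (intro integral_mono integrable_abs Bochner_Integration.integrable_diff gauss_weight_integrable f integrable_mult_right RgI)
      show "\<bar>f x * gauss_density t (y + v - x) - f x * gauss_density t (y - x)\<bar> \<le> B * (gauss_density t (y - x) * R x)" for x
        unfolding Rg right_diff_distrib[symmetric] abs_mult using B by (intro mult_right_mono) auto
    qed
    finally show ?thesis by (simp add: D_def)
  qed
  define n where "n = smoothed t \<mu> h y"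
  define n' where "n' = smoothed t \<mu> h (y + v)"
  define s' where "s' = smoothed t \<mu> (\<lambda>_. 1) (y + v)"
  have s'0: "s' > 0" unfolding s'_def by (rule smoothed_one_pos)
  have "\<bar>n' - n\<bar> \<le> K * D" unfolding n_def n'_def by (rule inc[OF h K])
  moreover have "\<bar>s' - s\<bar> \<le> 1 * D" unfolding s_def s'_def by (rule inc[OF bounded_borel_const]) simp
  moreover have "\<bar>n' / s'\<bar> \<le> K"
  proof -
    have "- K \<le> h x" "h x \<le> K" for x using K[of x] by auto
    from posterior_mean_bounds[OF h this, of "y + v"] show ?thesis by (simp add: posterior_mean_def n'_def s'_def abs_le_iff)
  qed
  ultimately have "\<bar>n' - n\<bar> \<le> K * D" "\<bar>n' / s'\<bar> * \<bar>s' - s\<bar> \<le> K * (1 * D)"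
    using D0 K0 by - (assumption, rule mult_mono, simp_all)
  then have diff_le: "\<bar>(n' - n) - (n' / s') * (s' - s)\<bar> \<le> K * D + K * (1 * D)"
    using abs_triangle_ineq4[of "n' - n" "(n' / s') * (s' - s)"] unfolding abs_mult by linarith
  have diff_eq: "n' / s' - n / s = ((n' - n) - (n' / s') * (s' - s)) / s"
    using s0 s'0 by (simp add: field_simps)
  have "\<bar>n' / s' - n / s\<bar> \<le> 2 * K * (\<integral>x. R x \<partial>P)"
  proof -
    have "(\<integral>x. R x \<partial>P) = D / s" unfolding RPe D_def ..
    then show ?thesis unfolding diff_eq using s0 diff_le divide_right_mono[of "\<bar>(n' - n) - (n' / s') * (s' - s)\<bar>" "2 * K * D" s]
      by (simp add: abs_divide mult_ac)
  qed
  then have cubed: "\<bar>n' / s' - n / s\<bar> ^ 3 \<le> (2 * K * (\<integral>x. R x \<partial>P)) ^ 3" by (intro power_mono) auto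
  have "ennreal (\<bar>n' / s' - n / s\<bar> ^ 3) \<le> ennreal ((2 * K) ^ 3) * ennreal ((\<integral>x. R x \<partial>P) ^ 3)"
  proof -
    have "0 \<le> (\<integral>x. R x \<partial>P)" by (intro integral_nonneg_AE) (auto simp: R_def)
    then show ?thesis
      using K0 cubed by (simp add: power_mult_distrib ennreal_leI flip: ennreal_mult)
  qed
  also have "\<dots> \<le> ennreal ((2 * K) ^ 3) * (\<integral>\<^sup>+x. ennreal (R x ^ 3) \<partial>P)"
    by (intro mult_left_mono P.cube_expectation_le RP) (simp_all add: R_def)
  also have "(\<integral>\<^sup>+x. ennreal (R x ^ 3) \<partial>P) = (\<integral>\<^sup>+x. ennreal (gauss_density t (y - x)) * ennreal (R x ^ 3) * ennreal (1 / s) \<partial>\<mu>)"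
    unfolding P_def using s0 g0
    by (subst nn_integral_density) (auto simp: less_imp_le R_def simp flip: ennreal_mult intro!: nn_integral_cong)
  also have "\<dots> = (\<integral>\<^sup>+x. ennreal (gauss_density t (y - x)) * ennreal (R x ^ 3) \<partial>\<mu>) * ennreal (1 / s)"
    by (rule nn_integral_multc) measurable
  finally have "ennreal (\<bar>n' / s' - n / s\<bar> ^ 3) * ennreal s
     \<le> ennreal ((2 * K) ^ 3) * ((\<integral>\<^sup>+x. ennreal (gauss_density t (y - x)) * ennreal (R x ^ 3) \<partial>\<mu>) * ennreal (1 / s)) * ennreal s"
    by (intro mult_right_mono) auto
  also have "\<dots> = ennreal ((2 * K) ^ 3) * (\<integral>\<^sup>+x. ennreal (gauss_density t (y - x)) * ennreal (R x ^ 3) \<partial>\<mu>) * (ennreal (1 / s) * ennreal s)"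
    by (simp only: mult_ac)
  also have "ennreal (1 / s) * ennreal s = 1" using s0 by (simp flip: ennreal_mult)
  finally show ?thesis
    by (simp add: n_def n'_def s_def s'_def R_def posterior_mean_def)
qed

end

text \<open>
  The mirror image of \<open>heat_forward_step\<close>: now the information is the noisier position, \<open>G\<close> is the posterior mean at the less noisy
  one, and \<open>\<xi>\<close> is the same posterior mean evaluated at the noisier one. Noise of variance \<open>t\<close> that is already
  present has to dominate \<open>\<delta>\<close>.
\<close>

lemma heat_backward_step:
  fixes \<mu> :: "'a::euclidean_space measure"
  assumes mu: "prob_space \<mu>" "sets \<mu> = sets borel" and t: "t > 0" and d: "\<delta> > 0"
    and a: "a \<ge> 0" and gap: "heat_gap a \<delta> (smear \<mu> t)"
    and r: "24 * sqrt (\<delta> / t) \<le> 1"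
    and gm: "h \<in> borel_measurable borel" and h: "\<And>x. m \<le> h x" "\<And>x. h x \<le> K" and m: "0 < m" and q: "2 \<le> q"
    and one: "(\<integral>x. h x \<partial>\<mu>) = 1"
    and C: "C \<ge> 0" "\<And>a b. a \<in> {m..K} \<Longrightarrow> b \<in> {m..K} \<Longrightarrow>
      a powr q - b powr q - q * b powr (q - 1) * (a - b)
      \<ge> (2 * (q - 1) / q) * (a powr (q/2) - b powr (q/2))\<^sup>2 - C * \<bar>a - b\<bar> ^ 3"
  shows "exp_renyi q (smear \<mu> (t + \<delta>)) (posterior_mean (t + \<delta>) \<mu> h) - 1
    \<le> (1 - (2/q) * (a / (1 + a))) * (exp_renyi q (smear \<mu> t) (posterior_mean t \<mu> h) - 1)
      + C * (8 * ((2 * K) ^ 3 * (13824 * 2 ^ DIM('a) * sqrt (\<delta> / t) ^ 3)))"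
proof -
  note [measurable] = gm
  note [measurable_cong] = mu(2)
  define \<nu> where "\<nu> = smear \<mu> t"
  have nu: "prob_space \<nu>" "sets \<nu> = sets borel" unfolding \<nu>_def by (rule prob_space_smear[OF t mu]) simp
  note [measurable_cong] = nu(2)
  have td: "t + \<delta> > 0" using t d by simp
  define M where "M = \<nu> \<Otimes>\<^sub>M gaussian (0::'a) \<delta>"
  have sM: "sets M = sets (borel \<Otimes>\<^sub>M borel)" unfolding M_def by (intro sets_pair_measure_cong nu) simp
  have mM: "f \<in> borel_measurable M" if "f \<in> borel_measurable (borel \<Otimes>\<^sub>M borel)" for f :: "'a \<times> 'a \<Rightarrow> real"
    using that by (simp add: measurable_cong_sets[OF sM refl])
  interpret mu: prob_space \<mu> by fact
  interpret nu: prob_space \<nu> by fact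
  interpret ga: prob_space "gaussian (0::'a) \<delta>" by (rule prob_space_gaussian[OF d])
  interpret pp: pair_prob_space \<nu> "gaussian (0::'a) \<delta>" ..
  interpret prob_space M unfolding M_def by (rule pp.prob_space_axioms)
  have K0: "K \<ge> 0" "\<bar>h x\<bar> \<le> K" for x using h(1)[of x] h(2)[of x] m by auto
  have hb: "bounded_borel h" using gm K0(2) by (rule bounded_borelI)
  define k where "k = posterior_mean t \<mu> h"
  define l where "l = posterior_mean (t + \<delta>) \<mu> h"
  have kb: "bounded_borel k" and lb: "bounded_borel l" unfolding k_def l_def
    by (rule posterior_mean_bounded_borel[OF mu t hb], rule posterior_mean_bounded_borel[OF mu td hb])
  have kB: "m \<le> k x" "k x \<le> K" and lB: "m \<le> l x" "l x \<le> K" for x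
    unfolding k_def l_def using posterior_mean_bounds[OF mu t hb h] posterior_mean_bounds[OF mu td hb h] by auto
  note [measurable] = bounded_borel_measurable[OF kb] bounded_borel_measurable[OF lb]
  define G where "G z = k (fst z)" for z :: "'a \<times> 'a"
  define H where "H z = l (fst z + snd z)" for z
  define \<xi> where "\<xi> z = k (fst z + snd z)" for z
  have meas [measurable]: "G \<in> borel_measurable M" "H \<in> borel_measurable M" "\<xi> \<in> borel_measurable M"
    unfolding G_def H_def \<xi>_def by (rule mM; measurable)+
  have sm: "smear \<nu> \<delta> = smear \<mu> (t + \<delta>)" unfolding \<nu>_def by (rule smear_smear[OF t d mu])
  note fstI = integral_pair_fst[OF nu d, folded M_def] and sumI = integral_pair_sum[OF nu d, folded M_def, unfolded sm]
  have orth: "expectation (\<lambda>z. (G z - H z) * \<phi> (fst z + snd z)) = 0" if phi: "bounded_borel \<phi>" for \<phi>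
  proof -
    note [measurable] = bounded_borel_measurable[OF phi]
    have lp: "bounded_borel (\<lambda>x. l x * \<phi> x)" by (intro bounded_borel_mult lb phi)
    obtain B where B: "B \<ge> 0" "\<And>x. \<bar>\<phi> x\<bar> \<le> B" using bounded_borelE[OF phi] by blast
    have bd: "\<bar>G z * \<phi> (fst z + snd z)\<bar> \<le> K * B" "\<bar>H z * \<phi> (fst z + snd z)\<bar> \<le> K * B" for z
      unfolding abs_mult G_def H_def using kB[of "fst z"] lB[of "fst z + snd z"] B K0 m by (intro mult_mono; auto)+
    have i: "integrable M (\<lambda>z. G z * \<phi> (fst z + snd z))" "integrable M (\<lambda>z. H z * \<phi> (fst z + snd z))"
      by - (rule integrable_of_bounded[OF _ bd(1)], rule mM, simp add: G_def,
            rule integrable_of_bounded[OF _ bd(2)], rule mM, simp add: H_def)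
    have "expectation (\<lambda>z. G z * \<phi> (fst z + snd z)) = (\<integral>x. \<integral>v. k x * \<phi> (x + v) \<partial>gaussian 0 \<delta> \<partial>\<nu>)"
      unfolding M_def using bd(1) by (subst expectation_pair[OF nu(1) ga.prob_space_axioms]) (auto simp: G_def)
    also have "\<dots> = (\<integral>x. k x * heat \<delta> \<phi> x \<partial>\<nu>)" by (simp add: heat_def)
    also have "\<dots> = (\<integral>x. h x * heat t (heat \<delta> \<phi>) x \<partial>\<mu>)"
      unfolding k_def \<nu>_def by (rule posterior_mean_duality[OF mu t hb heat_bounded_borel[OF d phi]])
    also have "\<dots> = (\<integral>x. h x * heat (t + \<delta>) \<phi> x \<partial>\<mu>)" unfolding heat_heat[OF t d phi] ..
    also have "\<dots> = (\<integral>y. l y * \<phi> y \<partial>smear \<mu> (t + \<delta>))"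
      unfolding l_def by (rule posterior_mean_duality[OF mu td hb phi, symmetric])
    also have "\<dots> = expectation (\<lambda>z. H z * \<phi> (fst z + snd z))" unfolding H_def by (rule sumI[OF lp, symmetric])
    finally show ?thesis using i by (simp add: left_diff_distrib)
  qed
  have lp: "bounded_borel (\<lambda>x. l x powr r)" and kp: "bounded_borel (\<lambda>x. k x powr r)" if "0 \<le> r" for r
    using bounded_borel_powr[OF lb lB(1) m that] bounded_borel_powr[OF kb kB(1) m that] by auto
  have E1: "exp_renyi q M G = exp_renyi q \<nu> k"
    using q by (intro exp_renyi_cong_integral) (simp add: G_def fstI[OF kp])
  have E2: "exp_renyi q M H = exp_renyi q (smear \<mu> (t + \<delta>)) l"
    using q by (intro exp_renyi_cong_integral) (simp add: H_def sumI[OF lp])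
  have "exp_renyi q M H - 1 \<le> (1 - (2/q) * (a / (1 + a))) * (exp_renyi q M G - 1)
      + C * (8 * ((2 * K) ^ 3 * (13824 * 2 ^ DIM('a) * sqrt (\<delta> / t) ^ 3)))"
  proof (rule small_step_contraction[where m = m and K = K])
    have "(\<integral>x. k x \<partial>\<nu>) = 1" "(\<integral>x. l x \<partial>smear \<mu> (t + \<delta>)) = 1"
      unfolding k_def l_def \<nu>_def
      using posterior_mean_duality[OF mu t hb bounded_borel_const[of 1]] posterior_mean_duality[OF mu td hb bounded_borel_const[of 1]] one t td
      by simp_all
    then show "expectation G = 1" "expectation H = 1"
      by (simp_all add: G_def[abs_def] H_def[abs_def] fstI[OF kb] sumI[OF lb])
    show "expectation (\<lambda>x. (G x - H x) * H x powr (q - 1)) = 0"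
      using orth[OF lp[of "q - 1"]] q by (simp add: H_def)
    show "a / (1 + a) * (expectation (\<lambda>x. G x powr q) - (expectation (\<lambda>x. G x powr (q / 2)))\<^sup>2)
        \<le> expectation (\<lambda>x. (G x powr (q / 2) - H x powr (q / 2))\<^sup>2)"
    proof -
      have sq: "(k x powr (q/2))\<^sup>2 = k x powr q" for x
        using kB(1)[of x] m by (simp add: powr_powr powr_realpow[symmetric] flip: powr_numeral)
      have "expectation (\<lambda>x. G x powr q) - (expectation (\<lambda>x. G x powr (q / 2)))\<^sup>2 = variance_wrt \<nu> (\<lambda>x. k x powr (q/2))"
        using q by (simp add: variance_wrt_def sq G_def fstI[OF kp])
      moreover have "expectation (\<lambda>x. (G x powr (q / 2) - H x powr (q / 2))\<^sup>2)
         = (\<integral>x. \<integral>v. (k x powr (q/2) - l (x + v) powr (q/2))\<^sup>2 \<partial>gaussian 0 \<delta> \<partial>\<nu>)"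
        unfolding M_def
      proof (subst expectation_pair[OF nu(1) ga.prob_space_axioms])
        fix z
        have "\<bar>k (fst z) powr (q/2)\<bar> \<le> K powr (q/2)" "\<bar>l (fst z + snd z) powr (q/2)\<bar> \<le> K powr (q/2)"
          using kB lB m q by (intro powr_bounds[where m = m]; simp)+
        then have "\<bar>G z powr (q/2) - H z powr (q/2)\<bar> \<le> 2 * K powr (q/2)" unfolding G_def H_def by linarith
        then have "\<bar>G z powr (q/2) - H z powr (q/2)\<bar>\<^sup>2 \<le> (2 * K powr (q/2))\<^sup>2" by (intro power_mono) auto
        then show "\<bar>(G z powr (q/2) - H z powr (q/2))\<^sup>2\<bar> \<le> (2 * K powr (q/2))\<^sup>2" by simp
      qed (auto simp: G_def H_def)
      ultimately show ?thesis
        using heat_gap_backward[OF nu d a gap[folded \<nu>_def] kp[of "q/2"] lp[of "q/2"]] q by simp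
    qed
    show "expectation (\<lambda>x. \<bar>G x - H x\<bar> ^ 3) \<le> 8 * ((2 * K) ^ 3 * (13824 * 2 ^ DIM('a) * sqrt (\<delta> / t) ^ 3))"
    proof -
      define \<phi> where "\<phi> x = \<bar>k x - l x\<bar> * (k x - l x)" for x
      have "bounded_borel \<phi>"
      proof (rule bounded_borelI)
        show "\<bar>\<phi> x\<bar> \<le> K * K" for x unfolding \<phi>_def abs_mult
          using kB[of x] lB[of x] m by (intro mult_mono) auto
      qed (simp add: \<phi>_def[abs_def])
      from orth[OF this] have o: "expectation (\<lambda>x. (G x - H x) * (\<bar>\<xi> x - H x\<bar> * (\<xi> x - H x))) = 0"
        by (simp add: \<phi>_def \<xi>_def H_def)
      have "expectation (\<lambda>x. \<bar>G x - H x\<bar> ^ 3) \<le> 8 * expectation (\<lambda>x. \<bar>G x - \<xi> x\<bar> ^ 3)"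
      proof (rule projection_cube_le[where B = K, OF meas _ _ _ o])
        have "\<bar>k x\<bar> \<le> K" "\<bar>l x\<bar> \<le> K" for x using kB[of x] lB[of x] m by auto
        then show "\<bar>G z\<bar> \<le> K" "\<bar>H z\<bar> \<le> K" "\<bar>\<xi> z\<bar> \<le> K" for z by (simp_all add: G_def H_def \<xi>_def)
      qed
      moreover have "expectation (\<lambda>x. \<bar>G x - \<xi> x\<bar> ^ 3) \<le> (2 * K) ^ 3 * (13824 * 2 ^ DIM('a) * sqrt (\<delta> / t) ^ 3)"
      proof (rule integral_le_of_nn_integral_le[OF prob_space_axioms])
        interpret lm: pair_sigma_finite \<mu> lborel ..
        note [measurable] = smoothed_measurable[OF mu t bounded_borel_const[of 1]]
        define R where "R u v = \<bar>gauss_density t (u + v) / gauss_density t u - 1\<bar> ^ 3" for u v :: 'a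
        have [measurable]: "(\<lambda>(u, v). R u v) \<in> borel_measurable (borel \<Otimes>\<^sub>M borel)" unfolding R_def by measurable
        have step: "(\<integral>\<^sup>+y. ennreal (\<bar>k y - k (y + v)\<bar> ^ 3) \<partial>\<nu>)
            \<le> ennreal ((2 * K) ^ 3) * (\<integral>\<^sup>+u. ennreal (R u v) \<partial>gaussian 0 t)" for v
        proof -
          have "(\<integral>\<^sup>+y. ennreal (\<bar>k y - k (y + v)\<bar> ^ 3) \<partial>\<nu>)
             = (\<integral>\<^sup>+y. ennreal (smoothed t \<mu> (\<lambda>_. 1) y) * ennreal (\<bar>k y - k (y + v)\<bar> ^ 3) \<partial>lborel)"
            unfolding \<nu>_def smear_eq_density[OF mu t] by (subst nn_integral_density) auto
          also have "\<dots> \<le> (\<integral>\<^sup>+y. ennreal ((2 * K) ^ 3) * (\<integral>\<^sup>+x. ennreal (gauss_density t (y - x)) * ennreal (R (y - x) v) \<partial>\<mu>) \<partial>lborel)"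
            using posterior_mean_increment_cube[OF mu t gm K0(2), of _ v]
            by (intro nn_integral_mono) (simp add: k_def R_def abs_minus_commute mult.commute)
          also have "\<dots> = ennreal ((2 * K) ^ 3) * (\<integral>\<^sup>+y. \<integral>\<^sup>+x. ennreal (gauss_density t (y - x)) * ennreal (R (y - x) v) \<partial>\<mu> \<partial>lborel)"
            by (rule nn_integral_cmult) measurable
          also have "(\<integral>\<^sup>+y. \<integral>\<^sup>+x. ennreal (gauss_density t (y - x)) * ennreal (R (y - x) v) \<partial>\<mu> \<partial>lborel)
             = (\<integral>\<^sup>+x. \<integral>\<^sup>+y. ennreal (gauss_density t (y - x)) * ennreal (R (y - x) v) \<partial>lborel \<partial>\<mu>)"
            by (rule lm.Fubini') measurable
          also have "\<dots> = (\<integral>\<^sup>+x. (\<integral>\<^sup>+u. ennreal (R u v) \<partial>gaussian 0 t) \<partial>\<mu>)"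
          proof (rule nn_integral_cong)
            fix x
            have "(\<integral>\<^sup>+y. ennreal (gauss_density t (- x + y)) * ennreal (R (- x + y) v) \<partial>lborel)
              = (\<integral>\<^sup>+y. ennreal (gauss_density t y) * ennreal (R y v) \<partial>lborel)"
              by (rule nn_integral_lborel_translate) measurable
            also have "\<dots> = (\<integral>\<^sup>+u. ennreal (R u v) \<partial>gaussian 0 t)"
              by (subst nn_integral_gaussian[OF t]) auto
            finally show "(\<integral>\<^sup>+y. ennreal (gauss_density t (y - x)) * ennreal (R (y - x) v) \<partial>lborel) = (\<integral>\<^sup>+u. ennreal (R u v) \<partial>gaussian 0 t)"
              by (simp add: add.commute)
          qed
          also have "\<dots> = (\<integral>\<^sup>+u. ennreal (R u v) \<partial>gaussian 0 t)" by (simp add: mu.emeasure_space_1)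
          finally show ?thesis .
        qed
        have "(\<integral>\<^sup>+z. ennreal (\<bar>G z - \<xi> z\<bar> ^ 3) \<partial>M) = (\<integral>\<^sup>+v. \<integral>\<^sup>+y. ennreal (\<bar>k y - k (y + v)\<bar> ^ 3) \<partial>\<nu> \<partial>gaussian 0 \<delta>)"
          unfolding M_def by (subst pp.nn_integral_snd[symmetric]) (auto simp: G_def \<xi>_def)
        also have "\<dots> \<le> (\<integral>\<^sup>+v. ennreal ((2 * K) ^ 3) * (\<integral>\<^sup>+u. ennreal (R u v) \<partial>gaussian 0 t) \<partial>gaussian 0 \<delta>)"
          by (intro nn_integral_mono step)
        also have "\<dots> = ennreal ((2 * K) ^ 3) * (\<integral>\<^sup>+v. (\<integral>\<^sup>+u. ennreal (R u v) \<partial>gaussian 0 t) \<partial>gaussian 0 \<delta>)"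
        proof -
          interpret gt: prob_space "gaussian (0::'a) t" by (rule prob_space_gaussian[OF t])
          show ?thesis by (rule nn_integral_cmult) measurable
        qed
        also have "\<dots> \<le> ennreal ((2 * K) ^ 3) * ennreal (13824 * 2 ^ DIM('a) * sqrt (\<delta> / t) ^ 3)"
          unfolding R_def using gauss_ratio_cube_integral[OF t d r, of 1, where 'a = 'a] by (intro mult_left_mono) simp_all
        also have "\<dots> = ennreal ((2 * K) ^ 3 * (13824 * 2 ^ DIM('a) * sqrt (\<delta> / t) ^ 3))"
          by (rule ennreal_mult'[symmetric]) (use K0 in simp)
        finally show "(\<integral>\<^sup>+z. ennreal (\<bar>G z - \<xi> z\<bar> ^ 3) \<partial>M) \<le> ennreal ((2 * K) ^ 3 * (13824 * 2 ^ DIM('a) * sqrt (\<delta> / t) ^ 3))" .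
      qed (use K0 t d in auto)
      ultimately show ?thesis by linarith
    qed
    show "0 \<le> a / (1 + a)" using a by simp
  qed (use meas kB lB m q C in \<open>auto simp: G_def H_def\<close>)
  then show ?thesis by (simp add: E1 E2 k_def l_def \<nu>_def)
qed

lemma exp_renyi_heat_le:
  fixes \<mu> :: "'a::euclidean_space measure"
  assumes mu: "prob_space \<mu>" "sets \<mu> = sets borel" and t: "t > 0"
    and gm: "g \<in> borel_measurable borel" and g: "\<And>x. m \<le> g x" "\<And>x. g x \<le> K" and m: "0 < m" and q: "2 \<le> q"
  shows "exp_renyi q \<mu> (heat t g) \<le> exp_renyi q (smear \<mu> t) g"
proof -
  have "\<bar>g x\<bar> \<le> K" for x using g(1)[of x] g(2)[of x] m by auto
  then have gb: "bounded_borel g" using gm by (intro bounded_borelI)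
  have hB: "m \<le> heat t g x" "heat t g x \<le> K" for x using heat_bounds[OF t gb g] by auto
  have hb: "bounded_borel (heat t g)" by (rule heat_bounded_borel[OF t gb])
  have gq: "bounded_borel (\<lambda>x. g x powr q)" using q by (intro bounded_borel_powr[OF gb g(1) m]) auto
  have hq: "bounded_borel (\<lambda>x. heat t g x powr q)" using q by (intro bounded_borel_powr[OF hb hB(1) m]) auto
  interpret prob_space "gaussian (0::'a) t" by (rule prob_space_gaussian[OF t])
  have "heat t g x powr q \<le> heat t (\<lambda>x. g x powr q) x" for x
  proof -
    define b where "b = heat t g x"
    have b0: "b > 0" using hB(1)[of x] m by (simp add: b_def)
    have "b powr q = (\<integral>u. b powr q + q * b powr (q - 1) * (g (x + u) - b) \<partial>gaussian 0 t)"
      using heat_integrable[OF t gb, of x] prob_space by (simp add: b_def heat_def)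
    also have "\<dots> \<le> (\<integral>u. g (x + u) powr q \<partial>gaussian 0 t)"
    proof (rule integral_mono)
      show "b powr q + q * b powr (q - 1) * (g (x + u) - b) \<le> g (x + u) powr q" for u
        using g(1)[of "x + u"] m b0 q by (intro powr_ge_tangent) auto
    qed (use heat_integrable[OF t gb, of x] heat_integrable[OF t gq, of x] in auto)
    finally show ?thesis by (simp add: heat_def b_def)
  qed
  then have "(\<integral>x. heat t g x powr q \<partial>\<mu>) \<le> (\<integral>x. heat t (\<lambda>x. g x powr q) x \<partial>\<mu>)"
    by (intro integral_mono bounded_borel_integrable mu hq heat_bounded_borel t gq)
  also have "\<dots> = (\<integral>x. g x powr q \<partial>smear \<mu> t)" by (rule integral_smear[OF t mu gq, symmetric])
  finally show ?thesis unfolding exp_renyi_def using q by (intro powr_mono2 integral_nonneg_AE) auto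
qed

lemma exp_renyi_posterior_mean_le:
  fixes \<mu> :: "'a::euclidean_space measure"
  assumes mu: "prob_space \<mu>" "sets \<mu> = sets borel" and t: "t > 0"
    and hm: "h \<in> borel_measurable borel" and h: "\<And>x. m \<le> h x" "\<And>x. h x \<le> K" and m: "0 < m" and q: "2 \<le> q"
  shows "exp_renyi q (smear \<mu> t) (posterior_mean t \<mu> h) \<le> exp_renyi q \<mu> h"
proof -
  note [measurable] = hm
  note [measurable_cong] = mu(2)
  define M where "M = \<mu> \<Otimes>\<^sub>M gaussian (0::'a) t"
  interpret mu: prob_space \<mu> by fact
  interpret ga: prob_space "gaussian (0::'a) t" by (rule prob_space_gaussian[OF t])
  interpret pp: pair_prob_space \<mu> "gaussian (0::'a) t" ..
  interpret prob_space M unfolding M_def by (rule pp.prob_space_axioms)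
  have sM: "sets M = sets (borel \<Otimes>\<^sub>M borel)" unfolding M_def by (intro sets_pair_measure_cong mu) simp
  have mM: "f \<in> borel_measurable M" if "f \<in> borel_measurable (borel \<Otimes>\<^sub>M borel)" for f :: "'a \<times> 'a \<Rightarrow> real"
    using that by (simp add: measurable_cong_sets[OF sM refl])
  have K0: "K \<ge> 0" "\<bar>h x\<bar> \<le> K" for x using h(1)[of x] h(2)[of x] m by auto
  have hb: "bounded_borel h" using hm K0(2) by (rule bounded_borelI)
  define k where "k = posterior_mean t \<mu> h"
  have kb: "bounded_borel k" unfolding k_def by (rule posterior_mean_bounded_borel[OF mu t hb])
  have kB: "m \<le> k x" "k x \<le> K" for x unfolding k_def using posterior_mean_bounds[OF mu t hb h] by auto
  note [measurable] = bounded_borel_measurable[OF kb]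
  have hp: "bounded_borel (\<lambda>x. h x powr r)" and kp: "bounded_borel (\<lambda>x. k x powr r)" if "0 \<le> r" for r
    using bounded_borel_powr[OF hb h(1) m that] bounded_borel_powr[OF kb kB(1) m that] by auto
  have kq: "bounded_borel (\<lambda>x. k x powr (q - 1))" using kp[of "q - 1"] q by simp
  have kkq: "bounded_borel (\<lambda>x. k x * k x powr (q - 1))" by (intro bounded_borel_mult kb kq)
  note fstI = integral_pair_fst[OF mu t, folded M_def] and sumI = integral_pair_sum[OF mu t, folded M_def]
  obtain B where B: "B \<ge> 0" "\<And>x. \<bar>k x powr (q - 1)\<bar> \<le> B" using bounded_borelE[OF kq] by blast
  have bd: "\<bar>h (fst z) * k (fst z + snd z) powr (q - 1)\<bar> \<le> K * B" "\<bar>k (fst z + snd z) * k (fst z + snd z) powr (q - 1)\<bar> \<le> K * B" for z :: "'a \<times> 'a"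
    unfolding abs_mult using kB[of "fst z + snd z"] h[of "fst z"] B K0 m by (intro mult_mono; auto)+
  have i: "integrable M (\<lambda>z. h (fst z) * k (fst z + snd z) powr (q - 1))" "integrable M (\<lambda>z. k (fst z + snd z) * k (fst z + snd z) powr (q - 1))"
    by - (rule integrable_of_bounded[OF _ bd(1)], rule mM, simp,
          rule integrable_of_bounded[OF _ bd(2)], rule mM, simp)
  have "exp_renyi q M (\<lambda>z. k (fst z + snd z)) \<le> exp_renyi q M (\<lambda>z. h (fst z))"
  proof (rule exp_renyi_projection_le[where m = m and K = K])
    have "expectation (\<lambda>z. h (fst z) * k (fst z + snd z) powr (q - 1)) = (\<integral>x. \<integral>u. h x * k (x + u) powr (q - 1) \<partial>gaussian 0 t \<partial>\<mu>)"
      unfolding M_def using bd(1) by (subst expectation_pair[OF mu(1) ga.prob_space_axioms]) auto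
    also have "\<dots> = (\<integral>x. h x * heat t (\<lambda>y. k y powr (q - 1)) x \<partial>\<mu>)" by (simp add: heat_def)
    also have "\<dots> = (\<integral>y. k y * k y powr (q - 1) \<partial>smear \<mu> t)"
      using posterior_mean_duality[OF mu t hb kq] unfolding k_def by simp
    also have "\<dots> = expectation (\<lambda>z. k (fst z + snd z) * k (fst z + snd z) powr (q - 1))" by (rule sumI[OF kkq, symmetric])
    finally show "expectation (\<lambda>x. (h (fst x) - k (fst x + snd x)) * k (fst x + snd x) powr (q - 1)) = 0"
      using i by (simp add: left_diff_distrib)
  qed (use h kB m q in \<open>auto intro!: mM\<close>)
  moreover have "exp_renyi q M (\<lambda>z. k (fst z + snd z)) = exp_renyi q (smear \<mu> t) k"
    using q by (intro exp_renyi_cong_integral) (simp add: sumI[OF kp])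
  moreover have "exp_renyi q M (\<lambda>z. h (fst z)) = exp_renyi q \<mu> h"
    using q by (intro exp_renyi_cong_integral) (simp add: fstI[OF hp])
  ultimately show ?thesis by (simp add: k_def)
qed

section \<open>Subdivision and the limit of vanishing mesh\<close>

text \<open>
  The law at time \<open>t\<close>; time \<open>0\<close> is treated separately because \<open>gaussian 0 0\<close> is not a point mass.
\<close>

definition flow :: "'a::euclidean_space measure \<Rightarrow> real \<Rightarrow> 'a measure" where
  "flow \<mu> t = (if t = 0 then \<mu> else smear \<mu> t)"

lemma flow_prob:
  assumes "prob_space \<mu>" "sets \<mu> = sets borel" "0 \<le> t"
  shows "prob_space (flow \<mu> t)" "sets (flow \<mu> t) = sets borel"
  using assms prob_space_smear[of t \<mu>] by (auto simp: flow_def)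

lemma smear_flow:
  assumes "prob_space \<mu>" "sets \<mu> = sets borel" "0 \<le> s" "0 < t"
  shows "smear (flow \<mu> s) t = flow \<mu> (s + t)"
  using assms smear_smear[of s t \<mu>] by (auto simp: flow_def)

text \<open>
  The map \<open>a \<mapsto> a / (1 + a)\<close> adds \<open>1\<close> to \<open>1 / a\<close>, so the gap decays harmonically along the grid.
\<close>

lemma heat_gap_flow:
  fixes \<mu> :: "'a::euclidean_space measure"
  assumes mu: "prob_space \<mu>" "sets \<mu> = sets borel" and d: "\<delta> > 0" and al: "\<alpha> > 0"
    and gap: "heat_gap (\<alpha> * \<delta>) \<delta> \<mu>"
  shows "heat_gap (\<alpha> * \<delta> / (1 + \<alpha> * (real n * \<delta>))) \<delta> (flow \<mu> (real n * \<delta>))"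
proof (induction n)
  case 0
  then show ?case using gap by (simp add: flow_def)
next
  case (Suc n)
  define a where "a = \<alpha> * \<delta> / (1 + \<alpha> * (real n * \<delta>))"
  have n0: "0 \<le> real n * \<delta>" "0 < 1 + \<alpha> * (real n * \<delta>)" using d al by (simp_all add: add_pos_nonneg)
  have a0: "a \<ge> 0" using n0 d al by (simp add: a_def)
  have "heat_gap (a / (1 + a)) \<delta> (smear (flow \<mu> (real n * \<delta>)) \<delta>)"
    using Suc.IH by (intro heat_gap_smear flow_prob mu d a0 n0) (simp add: a_def)
  moreover have "smear (flow \<mu> (real n * \<delta>)) \<delta> = flow \<mu> (real (Suc n) * \<delta>)"
    unfolding smear_flow[OF mu n0(1) d] by (simp add: algebra_simps)
  moreover have "a / (1 + a) = \<alpha> * \<delta> / (1 + \<alpha> * (real (Suc n) * \<delta>))"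
  proof -
    define w where "w = 1 + \<alpha> * (real n * \<delta>)"
    define y where "y = \<alpha> * \<delta>"
    have "w > 0" "y > 0" using n0 al d by (simp_all add: w_def y_def)
    then have "(y / w) / (1 + y / w) = y / (w + y)" by (simp add: field_simps)
    moreover have "1 + \<alpha> * (real (Suc n) * \<delta>) = w + y" by (simp add: w_def y_def algebra_simps)
    moreover have "a = y / w" by (simp add: a_def w_def y_def)
    ultimately show ?thesis by (simp add: y_def)
  qed
  ultimately show ?case by simp
qed

text \<open>
  Up to the constant \<open>\<alpha>\<close> the reciprocal of the spectral gap at the \<open>i\<close>-th grid point.
\<close>

definition gap_weight :: "real \<Rightarrow> real \<Rightarrow> nat \<Rightarrow> real" where
  "gap_weight \<alpha> \<delta> i = 1 + \<alpha> * (real i * \<delta>)"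

text \<open>
  The factor accumulated between two grid points. It is a quotient of consecutive weights, so products of it
  telescope.
\<close>

definition decay :: "real \<Rightarrow> real \<Rightarrow> real \<Rightarrow> nat \<Rightarrow> nat \<Rightarrow> real" where
  "decay q \<alpha> \<delta> i j = (gap_weight \<alpha> \<delta> i / gap_weight \<alpha> \<delta> j) powr (2/q)"

context
  fixes q \<alpha> \<delta> :: real
  assumes q: "2 \<le> q" and al: "0 < \<alpha>" and d: "0 < \<delta>"
begin

lemma gap_weight_pos: "gap_weight \<alpha> \<delta> i > 0"
  unfolding gap_weight_def using al d by (intro add_pos_nonneg) auto

lemma gap_weight_mono: "i \<le> j \<Longrightarrow> gap_weight \<alpha> \<delta> i \<le> gap_weight \<alpha> \<delta> j"
  unfolding gap_weight_def using al d by simp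

lemma decay_nonneg: "0 \<le> decay q \<alpha> \<delta> i j"
  by (simp add: decay_def)

lemma decay_le_one:
  assumes "i \<le> j" shows "decay q \<alpha> \<delta> i j \<le> 1"
proof -
  have "gap_weight \<alpha> \<delta> i / gap_weight \<alpha> \<delta> j \<le> 1"
    using gap_weight_mono[OF assms] gap_weight_pos[of j] by simp
  then have "decay q \<alpha> \<delta> i j \<le> 1 powr (2/q)"
    unfolding decay_def using q gap_weight_pos by (intro powr_mono2) (auto simp: less_imp_le)
  then show ?thesis by simp
qed

lemma decay_self: "decay q \<alpha> \<delta> i i = 1"
  using gap_weight_pos[of i] by (simp add: decay_def)

lemma decay_trans: "decay q \<alpha> \<delta> i j * decay q \<alpha> \<delta> j k = decay q \<alpha> \<delta> i k"
  using gap_weight_pos[of i] gap_weight_pos[of j] gap_weight_pos[of k]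
  by (simp add: decay_def powr_mult[symmetric])

text \<open>
  From \<open>1 - z \<le> exp (- z)\<close> and \<open>ln (1 + z) \<le> z\<close>; the shift of the indices by one pays for the direction of these
  inequalities and disappears in the limit.
\<close>

lemma step_factor_le_decay:
  assumes a: "a = \<alpha> * \<delta> / gap_weight \<alpha> \<delta> i"
  shows "1 - (2/q) * (a / (1 + a)) \<le> decay q \<alpha> \<delta> (Suc i) (Suc (Suc i))"
proof -
  define x where "x = gap_weight \<alpha> \<delta> (Suc i)"
  define y where "y = \<alpha> * \<delta>"
  have x0: "x > 0" unfolding x_def by (rule gap_weight_pos)
  have y0: "y > 0" using al d by (simp add: y_def)
  have xi: "x = gap_weight \<alpha> \<delta> i + y" "gap_weight \<alpha> \<delta> (Suc (Suc i)) = x + y"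
    by (simp_all add: x_def y_def gap_weight_def algebra_simps)
  have b: "a / (1 + a) = y / x"
    unfolding a xi(1) y_def[symmetric] using gap_weight_pos[of i] y0 by (simp add: field_simps)
  have "1 - (2/q) * (y / x) \<le> exp (- ((2/q) * (y / x)))"
    using exp_ge_add_one_self[of "- ((2/q) * (y / x))"] by simp
  also have "\<dots> \<le> exp ((2/q) * ln (x / (x + y)))"
  proof -
    have "ln (1 + y / x) \<le> y / x" using x0 y0 by (intro ln_add_one_self_le_self) auto
    moreover have "ln (x / (x + y)) = - ln (1 + y / x)"
      using x0 y0 by (subst ln_inverse[symmetric]) (auto simp: field_simps intro!: arg_cong[where f = ln])
    ultimately have "- (y / x) \<le> ln (x / (x + y))" by simp
    then have "(2/q) * (- (y / x)) \<le> (2/q) * ln (x / (x + y))" using q by (intro mult_left_mono) auto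
    then show ?thesis by simp
  qed
  also have "\<dots> = decay q \<alpha> \<delta> (Suc i) (Suc (Suc i))"
    using x0 y0 by (simp add: decay_def xi(2) x_def[symmetric] powr_def)
  finally show ?thesis unfolding b .
qed

text \<open>
  The backward half step moves to larger times; the errors add up because all later factors are at most \<open>1\<close>.
\<close>

lemma telescope_up:
  assumes step: "\<And>i. m \<le> i \<Longrightarrow> i < n \<Longrightarrow> u (Suc i) \<le> decay q \<alpha> \<delta> (Suc i) (Suc (Suc i)) * u i + e"
    and e: "0 \<le> e" and mn: "m \<le> n"
  shows "u n \<le> decay q \<alpha> \<delta> (Suc m) (Suc n) * u m + real (n - m) * e"
  using mn step
proof (induction n rule: dec_induct)
  case base
  then show ?case by (simp add: decay_self)
next
  case (step n)
  define D where "D = decay q \<alpha> \<delta> (Suc n) (Suc (Suc n))"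
  have D: "0 \<le> D" "D \<le> 1" unfolding D_def by (auto intro: decay_nonneg decay_le_one)
  have "u n \<le> decay q \<alpha> \<delta> (Suc m) (Suc n) * u m + real (n - m) * e"
    by (rule step.IH) (use step.prems in auto)
  then have "D * u n \<le> D * (decay q \<alpha> \<delta> (Suc m) (Suc n) * u m + real (n - m) * e)" using D by (intro mult_left_mono)
  also have "\<dots> = decay q \<alpha> \<delta> (Suc m) (Suc (Suc n)) * u m + D * (real (n - m) * e)"
    by (simp add: D_def distrib_left decay_trans[of "Suc m" "Suc n" "Suc (Suc n)", symmetric] mult_ac)
  also have "\<dots> \<le> decay q \<alpha> \<delta> (Suc m) (Suc (Suc n)) * u m + 1 * (real (n - m) * e)"
    using D e by (intro add_left_mono mult_right_mono) auto
  finally have "u (Suc n) \<le> decay q \<alpha> \<delta> (Suc m) (Suc (Suc n)) * u m + real (n - m) * e + e"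
    using step.prems[of n] step.hyps unfolding D_def by simp
  moreover have "real (Suc n - m) * e = real (n - m) * e + e" using step.hyps by (simp add: Suc_diff_le algebra_simps)
  ultimately show ?case by simp
qed

text \<open>The forward half step moves to smaller times.\<close>

lemma telescope_down:
  assumes step: "\<And>i. i < n \<Longrightarrow> v i \<le> decay q \<alpha> \<delta> (Suc i) (Suc (Suc i)) * v (Suc i) + e"
    and e: "0 \<le> e"
  shows "v 0 \<le> decay q \<alpha> \<delta> 1 (Suc n) * v n + real n * e"
  using step
proof (induction n)
  case 0
  then show ?case by (simp add: decay_self)
next
  case (Suc n)
  define D where "D = decay q \<alpha> \<delta> 1 (Suc n)"
  have D: "0 \<le> D" "D \<le> 1" unfolding D_def by (auto intro: decay_nonneg decay_le_one)
  have "v 0 \<le> D * v n + real n * e" unfolding D_def by (rule Suc.IH) (use Suc.prems in auto)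
  also have "\<dots> \<le> D * (decay q \<alpha> \<delta> (Suc n) (Suc (Suc n)) * v (Suc n) + e) + real n * e"
    using D Suc.prems[of n] by (intro add_right_mono mult_left_mono) auto
  also have "\<dots> = decay q \<alpha> \<delta> 1 (Suc (Suc n)) * v (Suc n) + D * e + real n * e"
    by (simp add: D_def distrib_left decay_trans[of "Suc 0" "Suc n" "Suc (Suc n)", symmetric] mult_ac)
  also have "\<dots> \<le> decay q \<alpha> \<delta> 1 (Suc (Suc n)) * v (Suc n) + 1 * e + real n * e"
    using D e by (intro add_right_mono add_left_mono mult_right_mono) auto
  finally show ?case by (simp add: algebra_simps)
qed

end

lemma exp_renyi_ge_one:
  fixes \<mu> :: "'a::euclidean_space measure"
  assumes mu: "prob_space \<mu>" "sets \<mu> = sets borel"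
    and gm: "g \<in> borel_measurable borel" and g: "\<And>x. m \<le> g x" "\<And>x. g x \<le> K" and m: "0 < m" and q: "2 \<le> q"
    and one: "(\<integral>x. g x \<partial>\<mu>) = 1"
  shows "1 \<le> exp_renyi q \<mu> g"
proof -
  interpret prob_space \<mu> by fact
  have "g \<in> borel_measurable \<mu>" using gm mu(2) by (simp cong: measurable_cong_sets)
  from half_moment_interpolation(2)[OF this g m q one] show ?thesis
    unfolding exp_renyi_def using q by (intro ge_one_powr_ge_zero) auto
qed

text \<open>
  The grid has \<open>k j\<close> points, of which \<open>j\<close>, a fraction \<open>1 / k\<close>, are given up to obtain some initial smoothing. Letting
  \<open>j\<close> tend to infinity first removes the discretisation error, which is \<open>k j\<close> times \<open>j powr (- 3 / 2)\<close>; then \<open>k\<close> tends to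
  infinity. The threshold \<open>576 = 24\<^sup>2\<close> is the one under which \<open>gauss_ratio_cube_pointwise\<close> applies.
\<close>

lemma le_of_vanishing_mesh_error:
  fixes U V E \<alpha> \<eta> q :: real and \<phi> :: "real \<Rightarrow> real"
  assumes le: "\<And>k j. 1 \<le> k \<Longrightarrow> 576 \<le> j \<Longrightarrow> U \<le> \<phi> (inverse (real k)) * V + real (k * j) * (E * sqrt (1 / real j) ^ 3)"
    and cont: "isCont \<phi> 0"
  shows "U \<le> \<phi> 0 * V"
proof -
  have "U \<le> \<phi> (inverse (real (Suc k))) * V" for k
  proof -
    have lim: "(\<lambda>j. \<phi> (inverse (real (Suc k))) * V + real (Suc k) * E * sqrt (1 / real j)) \<longlonglongrightarrow> \<phi> (inverse (real (Suc k))) * V + real (Suc k) * E * sqrt 0"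
      by (intro tendsto_intros lim_1_over_n)
    have "U \<le> \<phi> (inverse (real (Suc k))) * V + real (Suc k) * E * sqrt (1 / real j)" if "576 \<le> j" for j
    proof -
      have j: "0 \<le> 1 / real j" "0 < real j" using that by auto
      have "real j * sqrt (1 / real j) ^ 3 = real j * (sqrt (1 / real j) * sqrt (1 / real j)) * sqrt (1 / real j)"
        by (simp only: power3_eq_cube mult.assoc)
      also have "\<dots> = sqrt (1 / real j)" using j by (simp only: real_sqrt_mult_self abs_of_nonneg) simp
      finally have "real (Suc k) * E * (real j * sqrt (1 / real j) ^ 3) = real (Suc k) * E * sqrt (1 / real j)"
        by (rule arg_cong)
      then have eq: "real (Suc k * j) * (E * sqrt (1 / real j) ^ 3) = real (Suc k) * E * sqrt (1 / real j)"
        by (simp only: of_nat_mult mult.assoc mult.left_commute)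
      have "1 \<le> Suc k" by simp
      from le[OF this that] show ?thesis unfolding eq .
    qed
    then have "U \<le> \<phi> (inverse (real (Suc k))) * V + real (Suc k) * E * sqrt 0"
      by (intro LIMSEQ_le_const[OF lim]) blast
    then show ?thesis by simp
  qed
  moreover have "(\<lambda>k. \<phi> (inverse (real (Suc k))) * V) \<longlonglongrightarrow> \<phi> 0 * V"
    by (intro tendsto_intros isCont_tendsto_compose[OF cont] LIMSEQ_inverse_real_of_nat)
  ultimately show ?thesis by (intro LIMSEQ_le_const) auto
qed

text \<open>
  The first half step, from \<open>X\<close> to \<open>Y\<close>: follow the posterior mean while the noise grows from \<open>0\<close> to \<open>\<eta>\<close>.
\<close>

lemma posterior_mean_contraction:
  fixes \<mu> :: "'a::euclidean_space measure"
  assumes mu: "prob_space \<mu>" "sets \<mu> = sets borel" and al: "\<alpha> > 0" and eta: "\<eta> > 0"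
    and gap: "\<And>\<delta>. \<delta> > 0 \<Longrightarrow> heat_gap (\<alpha> * \<delta>) \<delta> \<mu>"
    and hm: "h \<in> borel_measurable borel" and h: "\<And>x. m \<le> h x" "\<And>x. h x \<le> K" and m: "0 < m" and q: "2 \<le> q"
    and one: "(\<integral>x. h x \<partial>\<mu>) = 1"
  shows "exp_renyi q (smear \<mu> \<eta>) (posterior_mean \<eta> \<mu> h) - 1 \<le> (1 / (1 + \<alpha> * \<eta>)) powr (2/q) * (exp_renyi q \<mu> h - 1)"
proof -
  have mK: "m \<le> K" using h[of 0] by linarith
  obtain C where C: "C \<ge> 0" "\<And>a b. a \<in> {m..K} \<Longrightarrow> b \<in> {m..K} \<Longrightarrow>
      a powr q - b powr q - q * b powr (q - 1) * (a - b)
      \<ge> (2 * (q - 1) / q) * (a powr (q/2) - b powr (q/2))\<^sup>2 - C * \<bar>a - b\<bar> ^ 3"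
    using powr_defect_ge_square_minus_cube[OF m mK q] by blast
  define E where "E = C * (8 * ((2 * K) ^ 3 * (13824 * 2 ^ DIM('a))))"
  have E0: "E \<ge> 0" using C(1) m mK by (simp add: E_def)
  define \<phi> where "\<phi> x = ((1 + 2 * \<alpha> * \<eta> * x) / (1 + \<alpha> * \<eta>)) powr (2/q)" for x
  have ae: "\<alpha> * \<eta> > 0" using al eta by simp
  have "exp_renyi q (smear \<mu> \<eta>) (posterior_mean \<eta> \<mu> h) - 1 \<le> \<phi> 0 * (exp_renyi q \<mu> h - 1)"
  proof (rule le_of_vanishing_mesh_error)
    show "isCont \<phi> 0" unfolding \<phi>_def using ae by (intro continuous_intros) auto
    fix k j :: nat assume k: "1 \<le> k" and j: "576 \<le> j"
    define N where "N = k * j"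
    define \<delta> where "\<delta> = \<eta> / real N"
    have N0: "N > 0" using k j by (simp add: N_def)
    have jN: "j \<le> N" using k by (simp add: N_def)
    have d: "\<delta> > 0" using eta N0 by (simp add: \<delta>_def)
    have Nd: "real N * \<delta> = \<eta>" using N0 by (simp add: \<delta>_def)
    define u where "u i = exp_renyi q (smear \<mu> (real i * \<delta>)) (posterior_mean (real i * \<delta>) \<mu> h) - 1" for i
    define e where "e = E * sqrt (1 / real j) ^ 3"
    have e0: "e \<ge> 0" using E0 by (simp add: e_def)
    have "\<bar>h x\<bar> \<le> K" for x using h(1)[of x] h(2)[of x] m by auto
    then have hb: "bounded_borel h" using hm by (intro bounded_borelI)
    have u0: "u i \<ge> 0" if "i > 0" for i
    proof -
      have t: "real i * \<delta> > 0" using that d by simp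
      have "1 \<le> exp_renyi q (smear \<mu> (real i * \<delta>)) (posterior_mean (real i * \<delta>) \<mu> h)"
        by (rule exp_renyi_ge_one[where m = m and K = K, OF prob_space_smear[OF t mu] _ posterior_mean_measurable[OF mu t hb]
              posterior_mean_bounds(1)[OF mu t hb h] posterior_mean_bounds(2)[OF mu t hb h] m q])
          (use posterior_mean_duality[OF mu t hb bounded_borel_const[of 1]] one t in auto)
      then show ?thesis by (simp add: u_def)
    qed
    have step: "u (Suc i) \<le> decay q \<alpha> \<delta> (Suc i) (Suc (Suc i)) * u i + e" if ij: "j \<le> i" for i
    proof -
      have i0: "i > 0" using ij j by linarith
      have t: "real i * \<delta> > 0" using i0 d by simp
      define a where "a = \<alpha> * \<delta> / gap_weight \<alpha> \<delta> i"
      have a0: "a \<ge> 0" unfolding a_def using al d gap_weight_pos[OF q al d, of i] by simp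
      have gi: "heat_gap a \<delta> (smear \<mu> (real i * \<delta>))"
        using heat_gap_flow[OF mu d al gap[OF d], of i] i0 d by (simp add: a_def gap_weight_def flow_def)
      have r: "\<delta> / (real i * \<delta>) = 1 / real i" using d by simp
      have s: "sqrt (1 / real i) \<le> sqrt (1 / real j)" using ij j by (simp add: frac_le)
      have "sqrt (1 / real j) \<le> sqrt (1 / 576)" using j by (intro real_sqrt_le_mono frac_le) auto
      also have "sqrt (1 / 576) = 1 / (24::real)" by (rule real_sqrt_unique) (auto simp: power2_eq_square)
      finally have "24 * sqrt (\<delta> / (real i * \<delta>)) \<le> 1" unfolding r using s by linarith
      from heat_backward_step[OF mu t d a0 gi this hm h m q one C]
      have "u (Suc i) \<le> (1 - (2/q) * (a / (1 + a))) * u i + E * sqrt (1 / real i) ^ 3"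
        unfolding r by (simp add: u_def E_def algebra_simps)
      also have "\<dots> \<le> decay q \<alpha> \<delta> (Suc i) (Suc (Suc i)) * u i + e"
        unfolding e_def using s E0 u0[OF i0]
        by (intro add_mono mult_right_mono mult_left_mono power_mono step_factor_le_decay[OF q al d a_def]) auto
      finally show ?thesis .
    qed
    \<comment> \<open>The first \<open>j\<close> grid points are skipped: with little noise the posterior mean need not be regular.\<close>
    have "u N \<le> decay q \<alpha> \<delta> (Suc j) (Suc N) * u j + real (N - j) * e"
      by (rule telescope_up[OF q al d step e0 jN])
    also have "\<dots> \<le> \<phi> (inverse (real k)) * (exp_renyi q \<mu> h - 1) + real N * e"
    proof (intro add_mono mult_mono)
      have w1: "gap_weight \<alpha> \<delta> (Suc j) \<le> 1 + 2 * \<alpha> * \<eta> * inverse (real k)"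
      proof -
        have "real (Suc j) * \<delta> \<le> (2 * real j) * \<delta>" using j d by (intro mult_right_mono) auto
        also have "\<dots> = 2 * \<eta> * inverse (real k)" using k j by (simp add: \<delta>_def N_def field_simps)
        finally have "\<alpha> * (real (Suc j) * \<delta>) \<le> \<alpha> * (2 * \<eta> * inverse (real k))" using al by (intro mult_left_mono) auto
        then show ?thesis by (simp add: gap_weight_def mult_ac)
      qed
      have w2: "1 + \<alpha> * \<eta> \<le> gap_weight \<alpha> \<delta> (Suc N)"
        unfolding gap_weight_def Nd[symmetric] using al d by simp
      show "decay q \<alpha> \<delta> (Suc j) (Suc N) \<le> \<phi> (inverse (real k))"
        unfolding decay_def \<phi>_def using w1 w2 q ae gap_weight_pos[OF q al d, of "Suc j"]
        by (intro powr_mono2 frac_le divide_nonneg_nonneg) (auto simp: less_imp_le)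
      have "posterior_mean (real j * \<delta>) \<mu> h = posterior_mean (real j * \<delta>) \<mu> h" ..
      show "u j \<le> exp_renyi q \<mu> h - 1"
        unfolding u_def using j d by (intro diff_right_mono exp_renyi_posterior_mean_le[OF mu _ hm h m q]) auto
      show "0 \<le> u j" using j by (intro u0) auto
    qed (use e0 in \<open>auto simp: \<phi>_def\<close>)
    finally show "exp_renyi q (smear \<mu> \<eta>) (posterior_mean \<eta> \<mu> h) - 1
        \<le> \<phi> (inverse (real k)) * (exp_renyi q \<mu> h - 1) + real (k * j) * (E * sqrt (1 / real j) ^ 3)"
      by (simp add: u_def Nd e_def N_def[symmetric])
  qed
  then show ?thesis by (simp add: \<phi>_def)
qed

text \<open>
  The second half step, from \<open>Y\<close> back to \<open>X\<close>: the heat average is taken over portions of noise, starting from the full noise level.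
\<close>

lemma heat_contraction:
  fixes \<mu> :: "'a::euclidean_space measure"
  assumes mu: "prob_space \<mu>" "sets \<mu> = sets borel" and al: "\<alpha> > 0" and eta: "\<eta> > 0"
    and gap: "\<And>\<delta>. \<delta> > 0 \<Longrightarrow> heat_gap (\<alpha> * \<delta>) \<delta> \<mu>"
    and gm: "g \<in> borel_measurable borel" and g: "\<And>x. m \<le> g x" "\<And>x. g x \<le> K" and m: "0 < m" and q: "2 \<le> q"
    and one: "(\<integral>x. g x \<partial>smear \<mu> \<eta>) = 1"
  shows "exp_renyi q \<mu> (heat \<eta> g) - 1 \<le> (1 / (1 + \<alpha> * \<eta>)) powr (2/q) * (exp_renyi q (smear \<mu> \<eta>) g - 1)"
proof -
  have mK: "m \<le> K" using g[of 0] by linarith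
  obtain C where C: "C \<ge> 0" "\<And>a b. a \<in> {m..K} \<Longrightarrow> b \<in> {m..K} \<Longrightarrow>
      a powr q - b powr q - q * b powr (q - 1) * (a - b)
      \<ge> (2 * (q - 1) / q) * (a powr (q/2) - b powr (q/2))\<^sup>2 - C * \<bar>a - b\<bar> ^ 3"
    using powr_defect_ge_square_minus_cube[OF m mK q] by blast
  define E where "E = C * (8 * (K ^ 3 * (13824 * 2 ^ DIM('a))))"
  have E0: "E \<ge> 0" using C(1) m mK by (simp add: E_def)
  define \<phi> where "\<phi> x = ((1 + \<alpha> * \<eta> * x) / (1 + \<alpha> * \<eta> * (1 - x))) powr (2/q)" for x
  have ae: "\<alpha> * \<eta> > 0" using al eta by simp
  have "exp_renyi q \<mu> (heat \<eta> g) - 1 \<le> \<phi> 0 * (exp_renyi q (smear \<mu> \<eta>) g - 1)"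
  proof (rule le_of_vanishing_mesh_error)
    show "isCont \<phi> 0" unfolding \<phi>_def using ae by (intro continuous_intros) auto
    fix k j :: nat assume k: "1 \<le> k" and j: "576 \<le> j"
    define N where "N = k * j"
    \<comment> \<open>The last \<open>j\<close> portions of noise next to \<open>g\<close> are not refined: there \<open>g\<close> is not smooth yet.\<close>
    define n where "n = N - j"
    define \<delta> where "\<delta> = \<eta> / real N"
    have N0: "N > 0" using k j by (simp add: N_def)
    have jN: "j \<le> N" using k by (simp add: N_def)
    have d: "\<delta> > 0" using eta N0 by (simp add: \<delta>_def)
    have Nd: "real N * \<delta> = \<eta>" using N0 by (simp add: \<delta>_def)
    define v where "v i = exp_renyi q (flow \<mu> (real i * \<delta>)) (heat (real (N - i) * \<delta>) g) - 1" for i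
    define e where "e = E * sqrt (1 / real j) ^ 3"
    have e0: "e \<ge> 0" using E0 by (simp add: e_def)
    have "\<bar>g x\<bar> \<le> K" for x using g(1)[of x] g(2)[of x] m by auto
    then have gb: "bounded_borel g" using gm by (intro bounded_borelI)
    have fl: "smear (flow \<mu> (real i * \<delta>)) (real (N - i) * \<delta>) = smear \<mu> \<eta>" if "i < N" for i
    proof -
      have "real i * \<delta> + real (N - i) * \<delta> = \<eta>" using that Nd by (simp add: of_nat_diff algebra_simps)
      then show ?thesis using that d eta smear_flow[OF mu, of "real i * \<delta>" "real (N - i) * \<delta>"] by (simp add: flow_def)
    qed
    have mean: "(\<integral>x. heat (real (N - i) * \<delta>) g x \<partial>flow \<mu> (real i * \<delta>)) = 1" if i: "i < N" for i
    proof -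
      have t: "real (N - i) * \<delta> > 0" using i d by simp
      have s: "0 \<le> real i * \<delta>" using d by simp
      show ?thesis using integral_smear[OF t flow_prob[OF mu s] gb] unfolding fl[OF i] one by simp
    qed
    have v0: "v i \<ge> 0" if i: "i < N" for i
    proof -
      have t: "real (N - i) * \<delta> > 0" "0 \<le> real i * \<delta>" using i d by simp_all
      have "1 \<le> exp_renyi q (flow \<mu> (real i * \<delta>)) (heat (real (N - i) * \<delta>) g)"
        by (rule exp_renyi_ge_one[where m = m and K = K, OF flow_prob[OF mu t(2)] heat_measurable[OF t(1) gm]
              heat_bounds(1)[OF t(1) gb g] heat_bounds(2)[OF t(1) gb g] m q mean[OF i]])
      then show ?thesis by (simp add: v_def)
    qed
    have step: "v i \<le> decay q \<alpha> \<delta> (Suc i) (Suc (Suc i)) * v (Suc i) + e" if i: "i < n" for i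
    proof -
      have i': "Suc i < N" "j \<le> N - Suc i" "i < N" using i j unfolding n_def by linarith+
      define T where "T = real (N - Suc i) * \<delta>"
      have T0: "T > 0" using i' d by (simp add: T_def)
      have Td: "T + \<delta> = real (N - i) * \<delta>" using i' by (simp add: T_def of_nat_diff algebra_simps)
      have s: "0 \<le> real i * \<delta>" using d by simp
      have sf: "smear (flow \<mu> (real i * \<delta>)) \<delta> = flow \<mu> (real (Suc i) * \<delta>)"
        unfolding smear_flow[OF mu s d] by (simp add: algebra_simps)
      define a where "a = \<alpha> * \<delta> / gap_weight \<alpha> \<delta> i"
      have a0: "a \<ge> 0" unfolding a_def using al d gap_weight_pos[OF q al d, of i] by simp
      have gi: "heat_gap a \<delta> (flow \<mu> (real i * \<delta>))"
        using heat_gap_flow[OF mu d al gap[OF d], of i] by (simp add: a_def gap_weight_def)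
      have r: "\<delta> / T = 1 / real (N - Suc i)" using d by (simp add: T_def)
      have s': "sqrt (1 / real (N - Suc i)) \<le> sqrt (1 / real j)" using i' j by (intro real_sqrt_le_mono frac_le) auto
      have "sqrt (1 / real j) \<le> sqrt (1 / 576)" using j by (intro real_sqrt_le_mono frac_le) auto
      also have "sqrt (1 / 576) = 1 / (24::real)" by (rule real_sqrt_unique) (auto simp: power2_eq_square)
      finally have r24: "24 * sqrt (\<delta> / T) \<le> 1" unfolding r using s' by linarith
      have "(\<integral>x. heat (T + \<delta>) g x \<partial>flow \<mu> (real i * \<delta>)) = 1" unfolding Td by (rule mean[OF i'(3)])
      from heat_forward_step[OF flow_prob[OF mu s] d a0 gi T0 r24 gm g m q this C]
      have "v i \<le> (1 - (2/q) * (a / (1 + a))) * v (Suc i) + E * sqrt (1 / real (N - Suc i)) ^ 3"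
        unfolding r sf Td by (simp add: v_def E_def T_def mult_ac)
      also have "\<dots> \<le> decay q \<alpha> \<delta> (Suc i) (Suc (Suc i)) * v (Suc i) + e"
        unfolding e_def using s' E0 v0[OF i'(1)]
        by (intro add_mono mult_right_mono mult_left_mono power_mono step_factor_le_decay[OF q al d a_def]) auto
      finally show ?thesis .
    qed
    have "v 0 \<le> decay q \<alpha> \<delta> 1 (Suc n) * v n + real n * e"
      by (rule telescope_down[OF q al d step e0])
    also have "\<dots> \<le> \<phi> (inverse (real k)) * (exp_renyi q (smear \<mu> \<eta>) g - 1) + real N * e"
    proof (intro add_mono mult_mono)
      have jd: "real j * \<delta> = \<eta> * inverse (real k)" using k j by (simp add: \<delta>_def N_def field_simps)
      have w1: "gap_weight \<alpha> \<delta> 1 \<le> 1 + \<alpha> * \<eta> * inverse (real k)"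
      proof -
        have "1 * \<delta> \<le> real j * \<delta>" using j d by (intro mult_right_mono) auto
        then have "\<alpha> * \<delta> \<le> \<alpha> * (\<eta> * inverse (real k))" unfolding jd using al by (intro mult_left_mono) auto
        then show ?thesis by (simp add: gap_weight_def mult_ac)
      qed
      have w2: "1 + \<alpha> * \<eta> * (1 - inverse (real k)) \<le> gap_weight \<alpha> \<delta> (Suc n)"
      proof -
        have "\<eta> * (1 - inverse (real k)) = real n * \<delta>"
          unfolding n_def using jN Nd jd by (simp add: of_nat_diff left_diff_distrib right_diff_distrib)
        also have "\<dots> \<le> real (Suc n) * \<delta>" using d by (intro mult_right_mono) auto
        finally have "\<alpha> * (\<eta> * (1 - inverse (real k))) \<le> \<alpha> * (real (Suc n) * \<delta>)" using al by (intro mult_left_mono) auto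
        then show ?thesis by (simp add: gap_weight_def mult_ac)
      qed
      have p: "0 < 1 + \<alpha> * \<eta> * (1 - inverse (real k))"
        using al eta k by (intro add_pos_nonneg mult_nonneg_nonneg) (auto simp: field_simps)
      show "decay q \<alpha> \<delta> 1 (Suc n) \<le> \<phi> (inverse (real k))"
        unfolding decay_def \<phi>_def using w1 w2 q ae p gap_weight_pos[OF q al d, of 1] gap_weight_pos[OF q al d, of "Suc n"]
        by (intro powr_mono2 frac_le divide_nonneg_nonneg) (auto simp: less_imp_le)
      have nN: "n < N" "N - n = j" using j jN N0 by (auto simp: n_def)
      have jd0: "real j * \<delta> > 0" "0 \<le> real n * \<delta>" using j d by simp_all
      show "v n \<le> exp_renyi q (smear \<mu> \<eta>) g - 1"
        using exp_renyi_heat_le[OF flow_prob[OF mu jd0(2)] jd0(1) gm g m q] fl[OF nN(1)] by (simp add: v_def nN(2))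
      show "0 \<le> v n" by (rule v0[OF nN(1)])
      show "real n \<le> real N" by (simp add: n_def)
    qed (use e0 in \<open>auto simp: \<phi>_def\<close>)
    finally show "exp_renyi q \<mu> (heat \<eta> g) - 1
        \<le> \<phi> (inverse (real k)) * (exp_renyi q (smear \<mu> \<eta>) g - 1) + real (k * j) * (E * sqrt (1 / real j) ^ 3)"
      by (simp add: v_def Nd e_def N_def[symmetric] flow_def)
  qed
  then show ?thesis by (simp add: \<phi>_def)
qed

lemma proximal_step_contraction_bounded:
  fixes \<mu> :: "'a::euclidean_space measure"
  assumes mu: "prob_space \<mu>" "sets \<mu> = sets borel" and al: "\<alpha> > 0" and eta: "\<eta> > 0"
    and gap: "\<And>\<delta>. \<delta> > 0 \<Longrightarrow> heat_gap (\<alpha> * \<delta>) \<delta> \<mu>"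
    and hm: "h \<in> borel_measurable borel" and h: "\<And>x. m \<le> h x" "\<And>x. h x \<le> K" and m: "0 < m" and q: "2 \<le> q"
    and one: "(\<integral>x. h x \<partial>\<mu>) = 1"
  shows "exp_renyi q \<mu> (heat \<eta> (posterior_mean \<eta> \<mu> h)) - 1 \<le> (1 / (1 + \<alpha> * \<eta>)) powr (4/q) * (exp_renyi q \<mu> h - 1)"
proof -
  define \<kappa> where "\<kappa> = (1 / (1 + \<alpha> * \<eta>)) powr (2/q)"
  have "\<bar>h x\<bar> \<le> K" for x using h(1)[of x] h(2)[of x] m by auto
  then have hb: "bounded_borel h" using hm by (intro bounded_borelI)
  have "(\<integral>x. posterior_mean \<eta> \<mu> h x \<partial>smear \<mu> \<eta>) = 1"
    using posterior_mean_duality[OF mu eta hb bounded_borel_const[of 1]] one eta by simp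
  then have "exp_renyi q \<mu> (heat \<eta> (posterior_mean \<eta> \<mu> h)) - 1
      \<le> \<kappa> * (exp_renyi q (smear \<mu> \<eta>) (posterior_mean \<eta> \<mu> h) - 1)"
    unfolding \<kappa>_def
    by (intro heat_contraction[where m = m and K = K, OF mu al eta gap posterior_mean_measurable[OF mu eta hb]
          posterior_mean_bounds(1)[OF mu eta hb h] posterior_mean_bounds(2)[OF mu eta hb h] m q])
  also have "\<dots> \<le> \<kappa> * (\<kappa> * (exp_renyi q \<mu> h - 1))"
    unfolding \<kappa>_def by (intro mult_left_mono posterior_mean_contraction[where m = m and K = K] mu al eta gap hm h m q one) auto
  also have "\<dots> = (1 / (1 + \<alpha> * \<eta>)) powr (4/q) * (exp_renyi q \<mu> h - 1)"
  proof -
    have "\<kappa> * \<kappa> = (1 / (1 + \<alpha> * \<eta>)) powr (2/q + 2/q)" unfolding \<kappa>_def by (rule powr_add[symmetric])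
    also have "2/q + 2/q = 4/q" by simp
    finally show ?thesis by (simp add: mult.assoc[symmetric])
  qed
  finally show ?thesis .
qed

section \<open>Unbounded densities\<close>

text \<open>
  The density, with respect to \<open>\<mu>\<close>, of the law after one step of the sampler with target \<open>\<mu>\<close>, if \<open>h\<close> is the density before.
  It takes values in \<open>ennreal\<close> because a general density is only almost everywhere finite.
\<close>

definition proximal_density :: "real \<Rightarrow> 'a::euclidean_space measure \<Rightarrow> ('a \<Rightarrow> ennreal) \<Rightarrow> 'a \<Rightarrow> ennreal" where
  "proximal_density \<eta> \<mu> h x =
     (\<integral>\<^sup>+y. ennreal (gauss_density \<eta> (y - x) / smoothed \<eta> \<mu> (\<lambda>_. 1) y) * (\<integral>\<^sup>+x'. h x' * ennreal (gauss_density \<eta> (y - x')) \<partial>\<mu>) \<partial>lborel)"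

text \<open>
  The integral in the Renyi divergence; the set where \<open>h\<close> is infinite contributes \<open>0\<close>.
\<close>

definition density_moment :: "real \<Rightarrow> 'a measure \<Rightarrow> ('a \<Rightarrow> ennreal) \<Rightarrow> ennreal" where
  "density_moment q \<mu> h = (\<integral>\<^sup>+x. ennreal (enn2real (h x) powr q) \<partial>\<mu>)"

context
  fixes \<mu> :: "'a::euclidean_space measure" and \<eta> :: real
  assumes mu: "prob_space \<mu>" "sets \<mu> = sets borel" and eta: "\<eta> > 0"
begin

interpretation prob_space \<mu> by (rule mu)

lemma unnormalized_marginal_measurable:
  assumes [measurable]: "h \<in> borel_measurable borel"
  shows "(\<lambda>y. \<integral>\<^sup>+x'. h x' * ennreal (gauss_density \<eta> (y - x')) \<partial>\<mu>) \<in> borel_measurable borel"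
proof -
  note [measurable_cong] = mu(2)
  show ?thesis by measurable
qed

lemma proximal_density_measurable:
  assumes h: "h \<in> borel_measurable borel"
  shows "proximal_density \<eta> \<mu> h \<in> borel_measurable borel"
proof -
  note [measurable] = unnormalized_marginal_measurable[OF h] smoothed_measurable[OF mu eta bounded_borel_const[of 1]]
  show ?thesis unfolding proximal_density_def by measurable
qed

lemma proximal_density_mono:
  "(\<And>x. h x \<le> k x) \<Longrightarrow> proximal_density \<eta> \<mu> h x \<le> proximal_density \<eta> \<mu> k x"
  unfolding proximal_density_def by (intro nn_integral_mono mult_left_mono mult_right_mono) auto

lemma proximal_density_cmult:
  assumes h [measurable]: "h \<in> borel_measurable borel"
  shows "proximal_density \<eta> \<mu> (\<lambda>x. c * h x) x = c * proximal_density \<eta> \<mu> h x"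
proof -
  note [measurable_cong] = mu(2)
  note [measurable] = unnormalized_marginal_measurable[OF h] smoothed_measurable[OF mu eta bounded_borel_const[of 1]]
  have "(\<integral>\<^sup>+x'. c * h x' * ennreal (gauss_density \<eta> (y - x')) \<partial>\<mu>) = c * (\<integral>\<^sup>+x'. h x' * ennreal (gauss_density \<eta> (y - x')) \<partial>\<mu>)" for y
    unfolding mult.assoc by (rule nn_integral_cmult) measurable
  then show ?thesis unfolding proximal_density_def
    by (simp add: mult.left_commute[of _ c] nn_integral_cmult)
qed

lemma proximal_density_cong_AE:
  assumes "AE x in \<mu>. h x = k x"
  shows "proximal_density \<eta> \<mu> h x = proximal_density \<eta> \<mu> k x"
proof -
  have "(\<integral>\<^sup>+x'. h x' * ennreal (gauss_density \<eta> (y - x')) \<partial>\<mu>) = (\<integral>\<^sup>+x'. k x' * ennreal (gauss_density \<eta> (y - x')) \<partial>\<mu>)" for y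
    using assms by (intro nn_integral_cong_AE) auto
  then show ?thesis by (simp add: proximal_density_def)
qed

lemma proximal_density_tendsto:
  assumes inc: "incseq h" and [measurable]: "\<And>n. h n \<in> borel_measurable borel" and lim: "\<And>x. (\<lambda>n. h n x) \<longlonglongrightarrow> k x"
  shows "(\<lambda>n. proximal_density \<eta> \<mu> (h n) x) \<longlonglongrightarrow> proximal_density \<eta> \<mu> k x"
  unfolding proximal_density_def
proof (rule nn_integral_LIMSEQ)
  note [measurable_cong] = mu(2)
  note [measurable] = smoothed_measurable[OF mu eta bounded_borel_const[of 1]]
  have le: "h i x \<le> h j x" if "i \<le> j" for i j x using incseqD[OF inc that] by (simp add: le_fun_def)
  then show "incseq (\<lambda>i y. ennreal (gauss_density \<eta> (y - x) / smoothed \<eta> \<mu> (\<lambda>_. 1) y) * (\<integral>\<^sup>+x'. h i x' * ennreal (gauss_density \<eta> (y - x')) \<partial>\<mu>))"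
    by (intro monoI le_funI mult_left_mono nn_integral_mono mult_right_mono) auto
  fix y
  have "(\<lambda>i. \<integral>\<^sup>+x'. h i x' * ennreal (gauss_density \<eta> (y - x')) \<partial>\<mu>) \<longlonglongrightarrow> (\<integral>\<^sup>+x'. k x' * ennreal (gauss_density \<eta> (y - x')) \<partial>\<mu>)"
  proof (rule nn_integral_LIMSEQ)
    show "incseq (\<lambda>i x'. h i x' * ennreal (gauss_density \<eta> (y - x')))"
      using le by (intro monoI le_funI mult_right_mono) auto
    show "(\<lambda>i. h i x' * ennreal (gauss_density \<eta> (y - x'))) \<longlonglongrightarrow> k x' * ennreal (gauss_density \<eta> (y - x'))" for x'
      unfolding mult.commute[of _ "ennreal (gauss_density \<eta> (y - x'))"] by (intro ennreal_tendsto_cmult lim) auto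
  qed measurable
  then show "(\<lambda>i. ennreal (gauss_density \<eta> (y - x) / smoothed \<eta> \<mu> (\<lambda>_. 1) y) * (\<integral>\<^sup>+x'. h i x' * ennreal (gauss_density \<eta> (y - x')) \<partial>\<mu>))
      \<longlonglongrightarrow> ennreal (gauss_density \<eta> (y - x) / smoothed \<eta> \<mu> (\<lambda>_. 1) y) * (\<integral>\<^sup>+x'. k x' * ennreal (gauss_density \<eta> (y - x')) \<partial>\<mu>)"
    by (intro ennreal_tendsto_cmult) auto
next
  note [measurable_cong] = mu(2)
  note [measurable] = smoothed_measurable[OF mu eta bounded_borel_const[of 1]]
  show "(\<lambda>y. ennreal (gauss_density \<eta> (y - x) / smoothed \<eta> \<mu> (\<lambda>_. 1) y) * (\<integral>\<^sup>+x'. h i x' * ennreal (gauss_density \<eta> (y - x')) \<partial>\<mu>)) \<in> borel_measurable lborel" for i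
    by measurable
qed

lemma proximal_density_bounded:
  assumes hm: "h \<in> borel_measurable borel" and h: "\<And>x. 0 \<le> h x" "\<And>x. h x \<le> K"
  shows "proximal_density \<eta> \<mu> (\<lambda>x. ennreal (h x)) x = ennreal (heat \<eta> (posterior_mean \<eta> \<mu> h) x)"
proof -
  note [measurable] = hm
  note [measurable_cong] = mu(2)
  have hb: "bounded_borel h" using hm h by (intro bounded_borelI[where B = K]) (auto simp: abs_of_nonneg)
  define k where "k = posterior_mean \<eta> \<mu> h"
  have kb: "bounded_borel k" unfolding k_def by (rule posterior_mean_bounded_borel[OF mu eta hb])
  have k0: "0 \<le> k y" for y unfolding k_def by (rule posterior_mean_bounds(1)[OF mu eta hb h])
  note [measurable] = bounded_borel_measurable[OF kb]
  have g0: "0 \<le> gauss_density \<eta> z" for z :: 'a by (rule gauss_density_nonneg[OF eta])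
  have inner: "(\<integral>\<^sup>+x'. ennreal (h x') * ennreal (gauss_density \<eta> (y - x')) \<partial>\<mu>) = ennreal (smoothed \<eta> \<mu> h y)" for y
  proof -
    have "(\<integral>\<^sup>+x'. ennreal (h x') * ennreal (gauss_density \<eta> (y - x')) \<partial>\<mu>) = (\<integral>\<^sup>+x'. ennreal (h x' * gauss_density \<eta> (y - x')) \<partial>\<mu>)"
      using h(1) g0 by (simp add: ennreal_mult)
    also have "\<dots> = ennreal (smoothed \<eta> \<mu> h y)"
      unfolding smoothed_def using h(1) g0 by (intro nn_integral_eq_integral gauss_weight_integrable[OF mu eta hb]) auto
    finally show ?thesis .
  qed
  have "proximal_density \<eta> \<mu> (\<lambda>x. ennreal (h x)) x = (\<integral>\<^sup>+y. ennreal (gauss_density \<eta> (y - x)) * ennreal (k y) \<partial>lborel)"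
    unfolding proximal_density_def inner
  proof (rule nn_integral_cong)
    fix y
    have "smoothed \<eta> \<mu> (\<lambda>_. 1) y > 0" by (rule smoothed_one_pos[OF mu eta])
    moreover have "smoothed \<eta> \<mu> h y \<ge> 0" unfolding smoothed_def using h(1) g0 by (intro integral_nonneg_AE) auto
    ultimately show "ennreal (gauss_density \<eta> (y - x) / smoothed \<eta> \<mu> (\<lambda>_. 1) y) * ennreal (smoothed \<eta> \<mu> h y)
        = ennreal (gauss_density \<eta> (y - x)) * ennreal (k y)"
      using g0 k0 by (simp add: k_def posterior_mean_def flip: ennreal_mult)
  qed
  also have "\<dots> = (\<integral>\<^sup>+u. ennreal (k (x + u)) \<partial>gaussian 0 \<eta>)"
    by (subst nn_integral_gaussian_shift[OF eta], simp, subst nn_integral_gaussian[OF eta]) auto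
  also have "\<dots> = ennreal (heat \<eta> k x)"
    unfolding heat_def using k0 heat_integrable[OF eta kb, of x] by (intro nn_integral_eq_integral) auto
  finally show ?thesis by (simp add: k_def)
qed

text \<open>Both conditional laws are probability measures.\<close>

lemma proximal_density_mass:
  assumes h [measurable]: "h \<in> borel_measurable borel"
  shows "(\<integral>\<^sup>+x. proximal_density \<eta> \<mu> h x \<partial>\<mu>) = (\<integral>\<^sup>+x. h x \<partial>\<mu>)"
proof -
  note [measurable_cong] = mu(2)
  note [measurable] = smoothed_measurable[OF mu eta bounded_borel_const[of 1]] unnormalized_marginal_measurable[OF h]
  interpret pair_sigma_finite \<mu> lborel ..
  define I where "I y = (\<integral>\<^sup>+x'. h x' * ennreal (gauss_density \<eta> (y - x')) \<partial>\<mu>)" for y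
  have [measurable]: "I \<in> borel_measurable borel" unfolding I_def by (rule unnormalized_marginal_measurable[OF h])
  have "(\<integral>\<^sup>+x. proximal_density \<eta> \<mu> h x \<partial>\<mu>)
     = (\<integral>\<^sup>+y. \<integral>\<^sup>+x. ennreal (gauss_density \<eta> (y - x) / smoothed \<eta> \<mu> (\<lambda>_. 1) y) * I y \<partial>\<mu> \<partial>lborel)"
    unfolding proximal_density_def I_def[symmetric] by (rule Fubini'[symmetric]) measurable
  also have "\<dots> = (\<integral>\<^sup>+y. I y \<partial>lborel)"
  proof (rule nn_integral_cong)
    fix y
    have s: "smoothed \<eta> \<mu> (\<lambda>_. 1) y > 0" by (rule smoothed_one_pos[OF mu eta])
    have "(\<integral>\<^sup>+x. ennreal (gauss_density \<eta> (y - x) / smoothed \<eta> \<mu> (\<lambda>_. 1) y) * I y \<partial>\<mu>)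
       = (\<integral>\<^sup>+x. ennreal (gauss_density \<eta> (y - x)) * (ennreal (1 / smoothed \<eta> \<mu> (\<lambda>_. 1) y) * I y) \<partial>\<mu>)"
    proof (rule nn_integral_cong)
      fix x
      have "ennreal (gauss_density \<eta> (y - x) / smoothed \<eta> \<mu> (\<lambda>_. 1) y)
          = ennreal (gauss_density \<eta> (y - x)) * ennreal (1 / smoothed \<eta> \<mu> (\<lambda>_. 1) y)"
        using s gauss_density_nonneg[OF eta, of "y - x"] by (simp flip: ennreal_mult)
      then show "ennreal (gauss_density \<eta> (y - x) / smoothed \<eta> \<mu> (\<lambda>_. 1) y) * I y
          = ennreal (gauss_density \<eta> (y - x)) * (ennreal (1 / smoothed \<eta> \<mu> (\<lambda>_. 1) y) * I y)"
        by (simp only: mult.assoc)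
    qed
    also have "\<dots> = ennreal (smoothed \<eta> \<mu> (\<lambda>_. 1) y) * (ennreal (1 / smoothed \<eta> \<mu> (\<lambda>_. 1) y) * I y)"
      by (subst nn_integral_multc) (auto simp: nn_smoothed_one[OF mu eta])
    also have "\<dots> = I y" using s by (simp add: mult.assoc[symmetric] flip: ennreal_mult)
    finally show "(\<integral>\<^sup>+x. ennreal (gauss_density \<eta> (y - x) / smoothed \<eta> \<mu> (\<lambda>_. 1) y) * I y \<partial>\<mu>) = I y" .
  qed
  also have "\<dots> = (\<integral>\<^sup>+x. \<integral>\<^sup>+y. h x * ennreal (gauss_density \<eta> (y - x)) \<partial>lborel \<partial>\<mu>)"
    unfolding I_def by (rule Fubini') measurable
  also have "\<dots> = (\<integral>\<^sup>+x. h x \<partial>\<mu>)"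
  proof (rule nn_integral_cong)
    fix x :: 'a
    have "(\<integral>\<^sup>+y. ennreal (gauss_density \<eta> (- x + y)) \<partial>lborel) = 1"
      by (subst nn_integral_lborel_translate) (auto simp: gauss_density_nn_integral[OF eta])
    then show "(\<integral>\<^sup>+y. h x * ennreal (gauss_density \<eta> (y - x)) \<partial>lborel) = h x"
      by (simp add: nn_integral_cmult)
  qed
  finally show ?thesis .
qed

text \<open>
  Truncate \<open>h\<close> at height \<open>n\<close>, add \<open>1 / (n + 1)\<close> and normalise by \<open>c n\<close>. The contraction is known for the result \<open>f n\<close>, its moments
  converge by dominated convergence, and Fatou gives the inequality in the limit, since \<open>c n\<close> times the image of
  \<open>f n\<close> dominates the image of the truncation.
\<close>

lemma proximal_step_contraction:
  assumes al: "\<alpha> > 0" and gap: "\<And>\<delta>. \<delta> > 0 \<Longrightarrow> heat_gap (\<alpha> * \<delta>) \<delta> \<mu>" and q: "2 \<le> q"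
    and h [measurable]: "h \<in> borel_measurable borel" and one: "(\<integral>\<^sup>+x. h x \<partial>\<mu>) = 1"
    and fin: "density_moment q \<mu> h < \<infinity>"
  shows "density_moment q \<mu> (proximal_density \<eta> \<mu> h) < \<infinity>"
    and "enn2real (density_moment q \<mu> (proximal_density \<eta> \<mu> h)) powr (1/(q-1)) - 1
      \<le> (1 / (1 + \<alpha> * \<eta>)) powr (4/q) * (enn2real (density_moment q \<mu> h) powr (1/(q-1)) - 1)"
    and "1 \<le> enn2real (density_moment q \<mu> h)"
proof -
  note [measurable_cong] = mu(2)
  define \<kappa> where "\<kappa> = (1 / (1 + \<alpha> * \<eta>)) powr (4/q)"
  define r where "r x = enn2real (h x)" for x
  define g where "g n x = min (r x) (real n)" for n x
  define e where "e n = inverse (real (Suc n))" for n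
  define c where "c n = (\<integral>x. g n x \<partial>\<mu>) + e n" for n
  define f where "f n x = (g n x + e n) / c n" for n x
  define A where "A = (\<integral>x. r x powr q \<partial>\<mu>)"
  define a where "a n = (\<integral>x. (g n x + e n) powr q \<partial>\<mu>)" for n
  have [measurable]: "r \<in> borel_measurable borel" "g n \<in> borel_measurable borel" "f n \<in> borel_measurable borel" for n
    unfolding r_def f_def g_def by measurable
  have r0: "0 \<le> r x" and g0: "0 \<le> g n x" "g n x \<le> real n" "g n x \<le> r x" for x n by (simp_all add: r_def g_def)
  have e0: "0 < e n" "e n \<le> 1" for n by (simp_all add: e_def inverse_le_1_iff)
  have c0: "0 < c n" for n unfolding c_def using g0 e0 by (intro add_nonneg_pos integral_nonneg_AE) auto
  have "AE x in \<mu>. h x \<noteq> \<infinity>" using one by (intro nn_integral_noteq_infinite) auto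
  then have hr: "AE x in \<mu>. h x = ennreal (r x)" by eventually_elim (simp add: r_def less_top)
  have nr: "(\<integral>\<^sup>+x. ennreal (r x) \<partial>\<mu>) = 1" using one nn_integral_cong_AE[OF hr] by simp
  then have ri: "integrable \<mu> r" using r0 by (intro integrableI_nonneg) auto
  have r1: "(\<integral>x. r x \<partial>\<mu>) = 1" using nn_integral_eq_integral[OF ri] r0 nr by (simp add: ennreal_eq_1)
  have rqi: "integrable \<mu> (\<lambda>x. r x powr q)" using fin by (intro integrableI_nonneg) (auto simp: density_moment_def r_def)
  have mA: "density_moment q \<mu> h = ennreal A" unfolding density_moment_def A_def r_def[symmetric]
    by (rule nn_integral_eq_integral[OF rqi]) simp
  have A0: "A \<ge> 0" unfolding A_def by (intro integral_nonneg_AE) auto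
  have glim: "(\<lambda>n. g n x) \<longlonglongrightarrow> r x" for x
  proof (rule tendsto_eventually)
    obtain N where "r x \<le> real N" using real_arch_simple by blast
    then show "\<forall>\<^sub>F n in sequentially. g n x = r x"
      by (intro eventually_sequentiallyI[of N]) (auto simp: g_def min_def)
  qed
  have elim: "e \<longlonglongrightarrow> 0" unfolding e_def by (rule LIMSEQ_inverse_real_of_nat)
  have "(\<lambda>n. \<integral>x. g n x \<partial>\<mu>) \<longlonglongrightarrow> (\<integral>x. r x \<partial>\<mu>)"
    by (rule integral_dominated_convergence[where w = r]) (use ri glim g0 in auto)
  then have clim: "c \<longlonglongrightarrow> 1" unfolding c_def using tendsto_add[OF _ elim] r1 by force
  have alim: "a \<longlonglongrightarrow> A" unfolding a_def A_def
  proof (rule integral_dominated_convergence[where w = "\<lambda>x. 2 powr q * (r x powr q + 1)"])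
    show "integrable \<mu> (\<lambda>x. 2 powr q * (r x powr q + 1))" using rqi by simp
    show "AE x in \<mu>. (\<lambda>n. (g n x + e n) powr q) \<longlonglongrightarrow> r x powr q"
    proof (intro AE_I2)
      fix x
      have "(\<lambda>n. (g n x + e n) powr q) \<longlonglongrightarrow> (r x + 0) powr q"
      proof (intro tendsto_powr' tendsto_add glim elim tendsto_const disjI2 conjI always_eventually allI)
        show "0 \<le> g n x + e n" for n using g0(1)[of n x] e0(1)[of n] by linarith
      qed (use q in auto)
      then show "(\<lambda>n. (g n x + e n) powr q) \<longlonglongrightarrow> r x powr q" by simp
    qed
    show "AE x in \<mu>. norm ((g n x + e n) powr q) \<le> 2 powr q * (r x powr q + 1)" for n
    proof (intro AE_I2)
      fix x
      have "(g n x + e n) powr q \<le> (2 * max (r x) 1) powr q"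
        using g0[of n x] e0[of n] q by (intro powr_mono2) (auto simp: max_def)
      also have "\<dots> = 2 powr q * max (r x) 1 powr q" by (simp add: powr_mult)
      also have "\<dots> \<le> 2 powr q * (r x powr q + 1)" by (intro mult_left_mono) (auto simp: max_def)
      finally show "norm ((g n x + e n) powr q) \<le> 2 powr q * (r x powr q + 1)" by simp
    qed
  qed auto
  define m where "m n = e n / c n" for n
  define K where "K n = (real n + e n) / c n" for n
  have fb: "m n \<le> f n x" "f n x \<le> K n" and m0: "0 < m n" for n x
    unfolding m_def f_def K_def using g0 e0 c0 by (auto intro!: divide_right_mono simp: less_imp_le)
  have gi: "integrable \<mu> (g n)" for n
    by (rule Bochner_Integration.integrable_bound[OF ri]) (use g0 r0 in auto)
  have f1: "(\<integral>x. f n x \<partial>\<mu>) = 1" for n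
    unfolding f_def using gi[of n] c0[of n] prob_space by (simp add: c_def[symmetric])
  define L where "L n = heat \<eta> (posterior_mean \<eta> \<mu> (f n))" for n
  define b where "b n = exp_renyi q \<mu> (f n)" for n
  have fbb: "bounded_borel (f n)" for n
  proof (rule bounded_borelI)
    show "\<bar>f n x\<bar> \<le> K n" for x using fb(1)[of n x] fb(2)[of n x] m0[of n] by linarith
  qed measurable
  have pbb: "bounded_borel (posterior_mean \<eta> \<mu> (f n))" for n by (rule posterior_mean_bounded_borel[OF mu eta fbb])
  have pb: "m n \<le> posterior_mean \<eta> \<mu> (f n) x" "posterior_mean \<eta> \<mu> (f n) x \<le> K n" for n x
    using posterior_mean_bounds[OF mu eta fbb fb] by auto
  have Lb: "m n \<le> L n x" "L n x \<le> K n" for n x unfolding L_def using heat_bounds[OF eta pbb pb] by auto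
  have Lbb: "bounded_borel (L n)" for n unfolding L_def by (rule heat_bounded_borel[OF eta pbb])
  have Lq: "bounded_borel (\<lambda>x. L n x powr q)" for n using q by (intro bounded_borel_powr[OF Lbb Lb(1) m0]) auto
  have contr: "exp_renyi q \<mu> (L n) - 1 \<le> \<kappa> * (b n - 1)" for n
    unfolding L_def \<kappa>_def b_def
    by (rule proximal_step_contraction_bounded[where m = "m n" and K = "K n", OF mu al eta gap _ fb m0 q f1]) auto
  have feq: "(\<integral>x. f n x powr q \<partial>\<mu>) = a n / c n powr q" for n
  proof -
    have "f n x powr q = (g n x + e n) powr q / c n powr q" for x
      unfolding f_def by (rule powr_divide)
    then show ?thesis by (simp add: a_def)
  qed
  have beq: "b n = (a n / c n powr q) powr (1/(q-1))" for n by (simp add: b_def exp_renyi_def feq)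
  have A1: "1 \<le> A"
  proof -
    have "1 \<le> a n / c n powr q" for n
      using half_moment_interpolation(2)[OF _ fb m0 q f1, of n] by (simp add: feq)
    moreover have "(\<lambda>n. a n / c n powr q) \<longlonglongrightarrow> A / 1 powr q"
      by (intro tendsto_intros alim clim) auto
    ultimately show ?thesis by (intro LIMSEQ_le_const[of _ A 1]) auto
  qed
  then show "1 \<le> enn2real (density_moment q \<mu> h)" using A0 by (simp add: mA)
  have k01: "0 < \<kappa>" "\<kappa> \<le> 1"
  proof -
    have "\<alpha> * \<eta> > 0" using al eta by simp
    then show "0 < \<kappa>" "\<kappa> \<le> 1" using q unfolding \<kappa>_def by (auto intro!: powr_le1)
  qed
  define P where "P = proximal_density \<eta> \<mu> h"
  define Pn where "Pn n = proximal_density \<eta> \<mu> (\<lambda>x. ennreal (g n x))" for n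
  have Pm [measurable]: "P \<in> borel_measurable borel" "Pn n \<in> borel_measurable borel" for n
    unfolding P_def Pn_def by (rule proximal_density_measurable; measurable)+
  have "(\<integral>\<^sup>+x. P x \<partial>\<mu>) = 1" unfolding P_def proximal_density_mass[OF h] by (rule one)
  then have Pfin: "AE x in \<mu>. P x \<noteq> \<infinity>" by (intro nn_integral_noteq_infinite) auto
  have Plim: "(\<lambda>n. Pn n x) \<longlonglongrightarrow> P x" for x
  proof -
    have "(\<lambda>n. Pn n x) \<longlonglongrightarrow> proximal_density \<eta> \<mu> (\<lambda>x. ennreal (r x)) x" unfolding Pn_def
    proof (rule proximal_density_tendsto)
      show "incseq (\<lambda>n x. ennreal (g n x))"
        by (intro monoI le_funI ennreal_leI) (auto simp: g_def min_def)
    qed (auto intro!: tendsto_ennrealI glim)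
    also have "proximal_density \<eta> \<mu> (\<lambda>x. ennreal (r x)) x = P x"
      unfolding P_def using hr by (intro proximal_density_cong_AE) auto
    finally show ?thesis .
  qed
  have "AE x in \<mu>. ennreal (enn2real (P x) powr q) = liminf (\<lambda>n. ennreal (enn2real (Pn n x) powr q))"
    using Pfin
  proof eventually_elim
    case (elim x)
    have "(\<lambda>n. enn2real (Pn n x)) \<longlonglongrightarrow> enn2real (P x)"
      using elim Plim by (intro tendsto_enn2real) (auto simp: less_top)
    then have "(\<lambda>n. enn2real (Pn n x) powr q) \<longlonglongrightarrow> enn2real (P x) powr q"
      using q by (intro tendsto_powr' tendsto_const) auto
    then have "(\<lambda>n. ennreal (enn2real (Pn n x) powr q)) \<longlonglongrightarrow> ennreal (enn2real (P x) powr q)"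
      by (rule tendsto_ennrealI)
    then show ?case by (rule lim_imp_Liminf[OF sequentially_bot, symmetric])
  qed
  then have "density_moment q \<mu> P = (\<integral>\<^sup>+x. liminf (\<lambda>n. ennreal (enn2real (Pn n x) powr q)) \<partial>\<mu>)"
    unfolding density_moment_def by (rule nn_integral_cong_AE)
  also have "\<dots> \<le> liminf (\<lambda>n. \<integral>\<^sup>+x. ennreal (enn2real (Pn n x) powr q) \<partial>\<mu>)"
    by (rule nn_integral_liminf) measurable
  also have "\<dots> \<le> liminf (\<lambda>n. ennreal (c n powr q * (1 + \<kappa> * (b n - 1)) powr (q - 1)))"
  proof (intro Liminf_mono always_eventually allI)
    fix n
    have "Pn n x \<le> ennreal (c n * L n x)" for x
    proof -
      have "Pn n x \<le> proximal_density \<eta> \<mu> (\<lambda>x. ennreal (c n) * ennreal (f n x)) x"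
        unfolding Pn_def
      proof (rule proximal_density_mono)
        fix x
        have "g n x \<le> c n * f n x" using c0[of n] e0[of n] by (simp add: f_def)
        then show "ennreal (g n x) \<le> ennreal (c n) * ennreal (f n x)"
          using c0[of n] by (simp add: ennreal_leI flip: ennreal_mult')
      qed
      also have "\<dots> = ennreal (c n) * ennreal (L n x)"
      proof -
        have "0 \<le> f n x" for x using fb(1)[of n x] m0[of n] by linarith
        then show ?thesis unfolding L_def
          by (subst proximal_density_cmult, simp) (simp add: proximal_density_bounded[OF _ _ fb(2)])
      qed
      finally show ?thesis using c0[of n] by (simp add: ennreal_mult')
    qed
    then have le: "enn2real (Pn n x) \<le> c n * L n x" for x
      using c0[of n] Lb(1)[of n x] m0[of n] by (intro enn2real_leI) auto
    have "(\<integral>\<^sup>+x. ennreal (enn2real (Pn n x) powr q) \<partial>\<mu>) \<le> (\<integral>\<^sup>+x. ennreal (c n powr q * L n x powr q) \<partial>\<mu>)"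
    proof (intro nn_integral_mono ennreal_leI)
      fix x
      have "enn2real (Pn n x) powr q \<le> (c n * L n x) powr q" using le q by (intro powr_mono2) auto
      also have "\<dots> = c n powr q * L n x powr q" by (rule powr_mult)
      finally show "enn2real (Pn n x) powr q \<le> c n powr q * L n x powr q" .
    qed
    also have "\<dots> = ennreal (c n powr q * (\<integral>x. L n x powr q \<partial>\<mu>))"
      using bounded_borel_integrable[OF mu Lq[of n]] by (subst nn_integral_eq_integral) auto
    also have "(\<integral>x. L n x powr q \<partial>\<mu>) = exp_renyi q \<mu> (L n) powr (q - 1)"
      using q by (simp add: exp_renyi_def powr_powr integral_nonneg_AE)
    also have "ennreal (c n powr q * exp_renyi q \<mu> (L n) powr (q - 1)) \<le> ennreal (c n powr q * (1 + \<kappa> * (b n - 1)) powr (q - 1))"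
      using contr[of n] q by (intro ennreal_leI mult_left_mono powr_mono2) (auto simp: exp_renyi_def)
    finally show "(\<integral>\<^sup>+x. ennreal (enn2real (Pn n x) powr q) \<partial>\<mu>) \<le> ennreal (c n powr q * (1 + \<kappa> * (b n - 1)) powr (q - 1))" .
  qed
  also have "\<dots> = ennreal ((1 + \<kappa> * (A powr (1/(q-1)) - 1)) powr (q - 1))"
  proof (rule lim_imp_Liminf[OF sequentially_bot])
    have p1: "1 \<le> A powr (1/(q-1))" using A1 q by (intro ge_one_powr_ge_zero) auto
    have "0 \<le> \<kappa> * (A powr (1/(q-1)) - 1)" using p1 k01 by simp
    then have nz: "1 + \<kappa> * ((A / 1 powr q) powr (1/(q-1)) - 1) \<noteq> 0" by simp
    have "(\<lambda>n. c n powr q * (1 + \<kappa> * ((a n / c n powr q) powr (1/(q-1)) - 1)) powr (q - 1))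
       \<longlonglongrightarrow> 1 powr q * (1 + \<kappa> * ((A / 1 powr q) powr (1/(q-1)) - 1)) powr (q - 1)"
      by (intro tendsto_intros alim clim) (use A1 nz in auto)
    then show "(\<lambda>n. ennreal (c n powr q * (1 + \<kappa> * (b n - 1)) powr (q - 1))) \<longlonglongrightarrow> ennreal ((1 + \<kappa> * (A powr (1/(q-1)) - 1)) powr (q - 1))"
      unfolding beq by (intro tendsto_ennrealI) simp
  qed
  finally have main: "density_moment q \<mu> P \<le> ennreal ((1 + \<kappa> * (A powr (1/(q-1)) - 1)) powr (q - 1))" .
  have "density_moment q \<mu> P < \<infinity>" by (rule le_less_trans[OF main]) simp
  then show "density_moment q \<mu> (proximal_density \<eta> \<mu> h) < \<infinity>" by (simp add: P_def)
  have p1: "1 \<le> A powr (1/(q-1))" using A1 q by (intro ge_one_powr_ge_zero) auto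
  then have nn: "0 \<le> \<kappa> * (A powr (1/(q-1)) - 1)" using k01 by simp
  have "enn2real (density_moment q \<mu> P) \<le> (1 + \<kappa> * (A powr (1/(q-1)) - 1)) powr (q - 1)"
    using main by (intro enn2real_leI) auto
  then have "enn2real (density_moment q \<mu> P) powr (1/(q-1)) \<le> ((1 + \<kappa> * (A powr (1/(q-1)) - 1)) powr (q - 1)) powr (1/(q-1))"
    using q by (intro powr_mono2) auto
  also have "\<dots> = 1 + \<kappa> * (A powr (1/(q-1)) - 1)" using q nn by (simp add: powr_powr)
  finally show "enn2real (density_moment q \<mu> (proximal_density \<eta> \<mu> h)) powr (1/(q-1)) - 1
      \<le> (1 / (1 + \<alpha> * \<eta>)) powr (4/q) * (enn2real (density_moment q \<mu> h) powr (1/(q-1)) - 1)"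
    using A0 by (simp add: mA P_def \<kappa>_def)
qed

end

section \<open>The sampler in terms of densities\<close>

context
  fixes f :: "'a::euclidean_space \<Rightarrow> real"
  assumes fi: "integrable lborel (\<lambda>x. exp (- f x))"
begin

text \<open>
  Recovered from the measurability that is part of the integrability of \<open>exp (- f)\<close>.
\<close>

lemma potential_measurable: "f \<in> borel_measurable borel"
proof -
  have "(\<lambda>x. exp (- f x)) \<in> borel_measurable borel" using borel_measurable_integrable[OF fi] by simp
  then have "(\<lambda>x. - ln (exp (- f x))) \<in> borel_measurable borel" by measurable
  then show ?thesis by simp
qed

lemma partition_function_pos: "0 < (\<integral>z. exp (- f z) \<partial>lborel)"
proof -
  have "(\<integral>z. exp (- f z) \<partial>lborel) \<noteq> 0"
  proof
    assume "(\<integral>z. exp (- f z) \<partial>lborel) = 0"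
    then have "AE z in lborel. exp (- f z) = 0"
      using integral_nonneg_eq_0_iff_AE[OF fi] by simp
    then have "ae_filter (lborel :: 'a measure) = bot" by (simp add: trivial_limit_def)
    then show False by (simp add: ae_filter_eq_bot_iff)
  qed
  moreover have "0 \<le> (\<integral>z. exp (- f z) \<partial>lborel)" by (intro integral_nonneg_AE) auto
  ultimately show ?thesis by linarith
qed

definition gibbs_density :: "'a \<Rightarrow> real" where
  "gibbs_density x = exp (- f x) / (\<integral>z. exp (- f z) \<partial>lborel)"

lemma gibbs_density_pos: "gibbs_density x > 0"
  using partition_function_pos by (simp add: gibbs_density_def)

lemma gibbs_density_measurable [measurable]: "gibbs_density \<in> borel_measurable borel"
proof -
  note [measurable] = potential_measurable
  show ?thesis unfolding gibbs_density_def[abs_def] by measurable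
qed

lemma gibbs_eq: "gibbs f = density lborel (\<lambda>x. ennreal (gibbs_density x))"
  by (simp add: gibbs_def gibbs_density_def)

lemma sets_gibbs: "sets (gibbs f) = sets borel"
  by (simp add: gibbs_def)

lemma prob_space_gibbs: "prob_space (gibbs f)"
proof
  have i: "integrable lborel gibbs_density" unfolding gibbs_density_def[abs_def] using fi by simp
  have "emeasure (gibbs f) (space (gibbs f)) = (\<integral>\<^sup>+x. ennreal (gibbs_density x) \<partial>lborel)"
    unfolding gibbs_eq by (subst emeasure_density) auto
  also have "\<dots> = ennreal (\<integral>x. gibbs_density x \<partial>lborel)"
    using gibbs_density_pos by (intro nn_integral_eq_integral i) (auto simp: less_imp_le)
  also have "(\<integral>x. gibbs_density x \<partial>lborel) = 1"
    using partition_function_pos by (simp add: gibbs_density_def)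
  finally show "emeasure (gibbs f) (space (gibbs f)) = 1" by simp
qed

text \<open>
  With respect to the target itself the conditional density is \<open>gauss_density \<eta> (y - x)\<close> up to normalisation, so the
  potential disappears from the rest of the argument.
\<close>

lemma cond_X_eq_density:
  assumes eta: "\<eta> > 0"
  shows "cond_X_given_Y f \<eta> y
    = density (gibbs f) (\<lambda>x. ennreal (gauss_density \<eta> (y - x) / smoothed \<eta> (gibbs f) (\<lambda>_. 1) y))"
proof -
  note [measurable] = potential_measurable
  define Z where "Z = (\<integral>z. exp (- f z) \<partial>lborel)"
  define S where "S = sqrt (2 * pi * \<eta>) ^ DIM('a)"
  define d where "d = smoothed \<eta> (gibbs f) (\<lambda>_. 1) y"
  have Z0: "Z > 0" unfolding Z_def by (rule partition_function_pos)
  have S0: "S > 0" using eta by (simp add: S_def)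
  have d0: "d > 0" unfolding d_def by (rule smoothed_one_pos[OF prob_space_gibbs sets_gibbs eta])
  have w: "exp (- (f x + (norm (x - y))\<^sup>2 / (2 * \<eta>))) = Z * S * (gibbs_density x * gauss_density \<eta> (y - x))" for x
  proof -
    have "gibbs_density x = exp (- f x) / Z" by (simp add: gibbs_density_def Z_def)
    moreover have "gauss_density \<eta> (y - x) = exp (- (norm (x - y))\<^sup>2 / (2 * \<eta>)) / S"
      by (simp add: gauss_density_def S_def norm_minus_commute)
    ultimately show ?thesis using Z0 S0 by (simp add: mult_exp_exp)
  qed
  have "d = (\<integral>x. gibbs_density x * gauss_density \<eta> (y - x) \<partial>lborel)"
    unfolding d_def smoothed_def gibbs_eq using gibbs_density_pos
    by (subst integral_density) (auto simp: less_imp_le)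
  then have norm: "(\<integral>x. exp (- (f x + (norm (x - y))\<^sup>2 / (2 * \<eta>))) \<partial>lborel) = Z * S * d"
    unfolding w by simp
  have "cond_X_given_Y f \<eta> y = density lborel (\<lambda>x. ennreal (gibbs_density x) * ennreal (gauss_density \<eta> (y - x) / d))"
    unfolding cond_X_given_Y_def gibbs_def[of "\<lambda>x. f x + (norm (x - y))\<^sup>2 / (2 * \<eta>)"] norm unfolding w
  proof (intro arg_cong[where f = "density lborel"] ext)
    fix x
    have "Z * S * (gibbs_density x * gauss_density \<eta> (y - x)) / (Z * S * d) = gibbs_density x * (gauss_density \<eta> (y - x) / d)"
      using Z0 S0 by simp
    then show "ennreal (Z * S * (gibbs_density x * gauss_density \<eta> (y - x)) / (Z * S * d))
        = ennreal (gibbs_density x) * ennreal (gauss_density \<eta> (y - x) / d)"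
      by (simp only: ennreal_mult'[OF less_imp_le[OF gibbs_density_pos]])
  qed
  also have "\<dots> = density (gibbs f) (\<lambda>x. ennreal (gauss_density \<eta> (y - x) / d))"
    unfolding gibbs_eq by (subst density_density_eq) auto
  finally show ?thesis by (simp add: d_def)
qed

lemma cond_Y_measurable:
  assumes eta: "\<eta> > 0"
  shows "cond_Y_given_X \<eta> \<in> borel \<rightarrow>\<^sub>M subprob_algebra (borel :: 'a measure)"
proof (rule measurable_subprob_algebra)
  show "subprob_space (cond_Y_given_X \<eta> x)" for x :: 'a
    unfolding cond_Y_given_X_def by (intro prob_space_imp_subprob_space prob_space_gaussian eta)
  fix A :: "'a set" assume [measurable]: "A \<in> sets borel"
  have "emeasure (cond_Y_given_X \<eta> x) A = (\<integral>\<^sup>+y. ennreal (gauss_density \<eta> (y - x)) * indicator A y \<partial>lborel)" for x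
    unfolding cond_Y_given_X_def gaussian_eq_density by (subst emeasure_density) auto
  then show "(\<lambda>x. emeasure (cond_Y_given_X \<eta> x) A) \<in> borel_measurable borel" by simp
qed (simp add: cond_Y_given_X_def)

lemma cond_X_measurable:
  assumes eta: "\<eta> > 0"
  shows "cond_X_given_Y f \<eta> \<in> borel \<rightarrow>\<^sub>M subprob_algebra borel"
proof (rule measurable_subprob_algebra)
  note gi = prob_space_gibbs sets_gibbs eta
  note [measurable_cong] = sets_gibbs
  note [measurable] = smoothed_measurable[OF gi bounded_borel_const[of 1]]
  interpret G: prob_space "gibbs f" by (rule prob_space_gibbs)
  have E: "emeasure (cond_X_given_Y f \<eta> y) A
      = (\<integral>\<^sup>+x. ennreal (gauss_density \<eta> (y - x) / smoothed \<eta> (gibbs f) (\<lambda>_. 1) y) * indicator A x \<partial>gibbs f)"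
    if [measurable]: "A \<in> sets borel" for A y
    unfolding cond_X_eq_density[OF eta] by (subst emeasure_density) auto
  show "subprob_space (cond_X_given_Y f \<eta> y)" for y
  proof
    have s: "smoothed \<eta> (gibbs f) (\<lambda>_. 1) y > 0" by (rule smoothed_one_pos[OF gi])
    have "emeasure (cond_X_given_Y f \<eta> y) UNIV
      = (\<integral>\<^sup>+x. ennreal (gauss_density \<eta> (y - x)) * ennreal (1 / smoothed \<eta> (gibbs f) (\<lambda>_. 1) y) \<partial>gibbs f)"
    proof (subst E, simp, rule nn_integral_cong)
      show "ennreal (gauss_density \<eta> (y - x) / smoothed \<eta> (gibbs f) (\<lambda>_. 1) y) * indicator UNIV x
          = ennreal (gauss_density \<eta> (y - x)) * ennreal (1 / smoothed \<eta> (gibbs f) (\<lambda>_. 1) y)" for x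
        using s gauss_density_nonneg[OF eta, of "y - x"] by (simp flip: ennreal_mult)
    qed
    also have "\<dots> = ennreal (smoothed \<eta> (gibbs f) (\<lambda>_. 1) y) * ennreal (1 / smoothed \<eta> (gibbs f) (\<lambda>_. 1) y)"
      by (subst nn_integral_multc) (auto simp: nn_smoothed_one[OF gi])
    also have "\<dots> = 1" using s by (simp flip: ennreal_mult)
    finally show "emeasure (cond_X_given_Y f \<eta> y) (space (cond_X_given_Y f \<eta> y)) \<le> 1"
      by (simp add: cond_X_given_Y_def gibbs_def)
  qed (simp add: cond_X_given_Y_def gibbs_def)
  show "(\<lambda>y. emeasure (cond_X_given_Y f \<eta> y) A) \<in> borel_measurable borel" if [measurable]: "A \<in> sets borel" for A
    unfolding E[OF that] by measurable
qed (simp add: cond_X_given_Y_def gibbs_def)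

lemma proximal_step_density:
  assumes eta: "\<eta> > 0" and h [measurable]: "h \<in> borel_measurable borel"
  shows "bind (bind (density (gibbs f) h) (cond_Y_given_X \<eta>)) (cond_X_given_Y f \<eta>)
    = density (gibbs f) (proximal_density \<eta> (gibbs f) h)"
proof (rule measure_eqI)
  note gi = prob_space_gibbs sets_gibbs eta
  note [measurable_cong] = sets_gibbs
  note [measurable] = smoothed_measurable[OF gi bounded_borel_const[of 1]] proximal_density_measurable[OF gi h] unnormalized_marginal_measurable[OF gi h]
  interpret G: prob_space "gibbs f" by (rule prob_space_gibbs)
  interpret GL: pair_sigma_finite "gibbs f" lborel ..
  define \<rho> where "\<rho> = density (gibbs f) h"
  have sr: "sets \<rho> = sets borel" by (simp add: \<rho>_def sets_gibbs)
  have kY: "cond_Y_given_X \<eta> \<in> \<rho> \<rightarrow>\<^sub>M subprob_algebra (borel :: 'a measure)"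
    using cond_Y_measurable[OF eta] by (simp add: measurable_cong_sets[OF sr refl])
  have sp: "space \<rho> \<noteq> {}" using sets_eq_imp_space_eq[OF sr] by simp
  have sb: "sets (bind \<rho> (cond_Y_given_X \<eta>)) = sets borel" by (rule sets_bind[OF sets_kernel[OF kY] sp])
  have kX: "cond_X_given_Y f \<eta> \<in> bind \<rho> (cond_Y_given_X \<eta>) \<rightarrow>\<^sub>M subprob_algebra borel"
    using cond_X_measurable[OF eta] by (simp add: measurable_cong_sets[OF sb refl])
  have spb: "space (bind \<rho> (cond_Y_given_X \<eta>)) \<noteq> {}" using sets_eq_imp_space_eq[OF sb] by simp
  show "sets (bind (bind (density (gibbs f) h) (cond_Y_given_X \<eta>)) (cond_X_given_Y f \<eta>))
      = sets (density (gibbs f) (proximal_density \<eta> (gibbs f) h))"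
    unfolding \<rho>_def[symmetric] using sets_bind[OF sets_kernel[OF kX] spb] by (simp add: sets_gibbs)
  fix A assume "A \<in> sets (bind (bind (density (gibbs f) h) (cond_Y_given_X \<eta>)) (cond_X_given_Y f \<eta>))"
  then have A [measurable]: "A \<in> sets borel"
    unfolding \<rho>_def[symmetric] using sets_bind[OF sets_kernel[OF kX] spb] by simp
  define I where "I y = (\<integral>\<^sup>+x'. h x' * ennreal (gauss_density \<eta> (y - x')) \<partial>gibbs f)" for y
  have [measurable]: "I \<in> borel_measurable borel" unfolding I_def by (rule unnormalized_marginal_measurable[OF gi h])
  define E where "E y = emeasure (cond_X_given_Y f \<eta> y) A" for y
  have Eq: "E y = (\<integral>\<^sup>+x. ennreal (gauss_density \<eta> (y - x) / smoothed \<eta> (gibbs f) (\<lambda>_. 1) y) * indicator A x \<partial>gibbs f)" for y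
    unfolding E_def cond_X_eq_density[OF eta] by (subst emeasure_density) auto
  have [measurable]: "E \<in> borel_measurable borel" unfolding Eq[abs_def] by measurable
  have "emeasure (bind (bind (density (gibbs f) h) (cond_Y_given_X \<eta>)) (cond_X_given_Y f \<eta>)) A
      = (\<integral>\<^sup>+y. E y \<partial>bind \<rho> (cond_Y_given_X \<eta>))"
    unfolding \<rho>_def[symmetric] E_def by (rule emeasure_bind[OF spb kX A])
  also have "\<dots> = (\<integral>\<^sup>+x'. \<integral>\<^sup>+y. E y \<partial>cond_Y_given_X \<eta> x' \<partial>\<rho>)"
    by (rule nn_integral_bind[OF _ kY]) simp
  also have "\<dots> = (\<integral>\<^sup>+x'. h x' * (\<integral>\<^sup>+y. ennreal (gauss_density \<eta> (y - x')) * E y \<partial>lborel) \<partial>gibbs f)"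
    unfolding \<rho>_def cond_Y_given_X_def
    by (subst nn_integral_density) (auto simp: nn_integral_gaussian[OF eta])
  also have "\<dots> = (\<integral>\<^sup>+x'. \<integral>\<^sup>+y. (h x' * ennreal (gauss_density \<eta> (y - x'))) * E y \<partial>lborel \<partial>gibbs f)"
    by (simp add: nn_integral_cmult[symmetric] mult.assoc)
  also have "\<dots> = (\<integral>\<^sup>+y. \<integral>\<^sup>+x'. (h x' * ennreal (gauss_density \<eta> (y - x'))) * E y \<partial>gibbs f \<partial>lborel)"
    by (rule GL.Fubini'[symmetric]) measurable
  also have "\<dots> = (\<integral>\<^sup>+y. I y * E y \<partial>lborel)"
    unfolding I_def by (simp add: nn_integral_multc)
  also have "\<dots> = (\<integral>\<^sup>+y. \<integral>\<^sup>+x. (ennreal (gauss_density \<eta> (y - x) / smoothed \<eta> (gibbs f) (\<lambda>_. 1) y) * I y) * indicator A x \<partial>gibbs f \<partial>lborel)"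
    unfolding Eq by (simp add: nn_integral_cmult[symmetric] mult_ac)
  also have "\<dots> = (\<integral>\<^sup>+x. \<integral>\<^sup>+y. (ennreal (gauss_density \<eta> (y - x) / smoothed \<eta> (gibbs f) (\<lambda>_. 1) y) * I y) * indicator A x \<partial>lborel \<partial>gibbs f)"
    by (rule GL.Fubini') measurable
  also have "\<dots> = (\<integral>\<^sup>+x. proximal_density \<eta> (gibbs f) h x * indicator A x \<partial>gibbs f)"
    unfolding proximal_density_def I_def[symmetric] by (simp add: nn_integral_multc)
  also have "\<dots> = emeasure (density (gibbs f) (proximal_density \<eta> (gibbs f) h)) A"
    by (subst emeasure_density) auto
  finally show "emeasure (bind (bind (density (gibbs f) h) (cond_Y_given_X \<eta>)) (cond_X_given_Y f \<eta>)) A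
      = emeasure (density (gibbs f) (proximal_density \<eta> (gibbs f) h)) A" .
qed

lemma lebesgue_density_gibbs: "AE x in lborel. lebesgue_density (gibbs f) x = gibbs_density x"
proof -
  have "AE x in lborel. ennreal (gibbs_density x) = RN_deriv lborel (gibbs f) x"
    by (rule sigma_finite_measure.RN_deriv_unique[OF sigma_finite_lborel _ gibbs_eq[symmetric]]) simp
  then show ?thesis
  proof eventually_elim
    case (elim x)
    then show ?case using gibbs_density_pos[of x] by (simp add: lebesgue_density_def less_imp_le flip: elim)
  qed
qed

lemma lebesgue_density_density_gibbs:
  assumes [measurable]: "h \<in> borel_measurable borel"
  shows "AE x in lborel. lebesgue_density (density (gibbs f) h) x = gibbs_density x * enn2real (h x)"
proof -
  have "density lborel (\<lambda>x. ennreal (gibbs_density x) * h x) = density (gibbs f) h"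
    unfolding gibbs_eq by (subst density_density_eq) auto
  then have "AE x in lborel. ennreal (gibbs_density x) * h x = RN_deriv lborel (density (gibbs f) h) x"
    by (intro sigma_finite_measure.RN_deriv_unique[OF sigma_finite_lborel]) auto
  then show ?thesis
  proof eventually_elim
    case (elim x)
    then show ?case using gibbs_density_pos[of x] by (simp add: lebesgue_density_def less_imp_le enn2real_mult flip: elim)
  qed
qed

lemma nn_integral_gibbs:
  assumes [measurable]: "k \<in> borel_measurable borel"
  shows "(\<integral>\<^sup>+x. k x \<partial>gibbs f) = (\<integral>\<^sup>+x. ennreal (gibbs_density x) * k x \<partial>lborel)"
  unfolding gibbs_eq by (subst nn_integral_density) auto

lemma renyi_integral_density:
  assumes [measurable]: "h \<in> borel_measurable borel"
  shows "renyi_integral q (gibbs f) (density (gibbs f) h) = density_moment q (gibbs f) h"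
proof -
  have "renyi_integral q (gibbs f) (density (gibbs f) h) = (\<integral>\<^sup>+x. ennreal (gibbs_density x) * ennreal (enn2real (h x) powr q) \<partial>lborel)"
    unfolding renyi_integral_def
  proof (rule nn_integral_cong_AE)
    show "AE x in lborel. ennreal (lebesgue_density (density (gibbs f) h) x powr q / lebesgue_density (gibbs f) x powr (q - 1))
        = ennreal (gibbs_density x) * ennreal (enn2real (h x) powr q)"
      using lebesgue_density_gibbs lebesgue_density_density_gibbs[OF assms]
    proof eventually_elim
      case (elim x)
      have p: "gibbs_density x > 0" by (rule gibbs_density_pos)
      have "(gibbs_density x * enn2real (h x)) powr q / gibbs_density x powr (q - 1) = gibbs_density x * enn2real (h x) powr q"
        using p by (simp add: powr_mult powr_diff)
      then show ?case using p by (simp add: elim less_imp_le flip: ennreal_mult)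
    qed
  qed
  also have "\<dots> = density_moment q (gibbs f) h"
    unfolding density_moment_def by (subst nn_integral_gibbs) auto
  finally show ?thesis .
qed

lemma chi_squared_density:
  assumes [measurable]: "h \<in> borel_measurable borel"
  shows "chi_squared (gibbs f) (density (gibbs f) h) = enn2ereal (density_moment 2 (gibbs f) h) - 1"
proof -
  note [measurable_cong] = sets_gibbs
  have "(\<integral>\<^sup>+x. ennreal ((lebesgue_density (density (gibbs f) h) x)\<^sup>2 / lebesgue_density (gibbs f) x) \<partial>lborel)
     = renyi_integral 2 (gibbs f) (density (gibbs f) h)"
    unfolding renyi_integral_def
  proof (rule nn_integral_cong_AE)
    show "AE x in lborel. ennreal ((lebesgue_density (density (gibbs f) h) x)\<^sup>2 / lebesgue_density (gibbs f) x)
      = ennreal (lebesgue_density (density (gibbs f) h) x powr 2 / lebesgue_density (gibbs f) x powr (2 - 1))"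
      using lebesgue_density_gibbs lebesgue_density_density_gibbs[OF assms]
    proof eventually_elim
      case (elim x)
      show ?case using gibbs_density_pos[of x] by (simp add: elim)
    qed
  qed
  moreover have "absolutely_continuous (gibbs f) (density (gibbs f) h)"
    by (rule absolutely_continuousI_density) measurable
  ultimately show ?thesis by (simp add: chi_squared_def renyi_integral_density[OF assms])
qed

lemma renyi_density:
  assumes h [measurable]: "h \<in> borel_measurable borel" and fin: "density_moment q (gibbs f) h < \<infinity>"
  shows "renyi q (gibbs f) (density (gibbs f) h) = ereal (1 / (q - 1) * ln (enn2real (density_moment q (gibbs f) h)))"
proof -
  note [measurable_cong] = sets_gibbs
  have "absolutely_continuous (gibbs f) (density (gibbs f) h)"
    by (rule absolutely_continuousI_density) measurable
  then show ?thesis using fin by (simp add: renyi_def renyi_integral_density[OF h])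
qed

lemma proximal_sampler_density:
  assumes eta: "\<eta> > 0" and h: "h \<in> borel_measurable borel"
  shows "proximal_sampler f \<eta> (density (gibbs f) h) k = density (gibbs f) ((proximal_density \<eta> (gibbs f) ^^ k) h)
    \<and> (proximal_density \<eta> (gibbs f) ^^ k) h \<in> borel_measurable borel"
proof (induction k)
  case (Suc k)
  then show ?case
    using proximal_step_density[OF eta] proximal_density_measurable[OF prob_space_gibbs sets_gibbs eta] by simp
qed (simp add: h)

text \<open>
  Iteration of \<open>proximal_step_contraction\<close>; the normalisation of the density is preserved along the way.
\<close>

lemma density_moment_iterate:
  assumes eta: "\<eta> > 0" and al: "\<alpha> > 0" and P: "poincare \<alpha> (gibbs f)" and q: "2 \<le> q"
    and h: "h \<in> borel_measurable borel" and one: "(\<integral>\<^sup>+x. h x \<partial>gibbs f) = 1"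
    and fin: "density_moment q (gibbs f) h < \<infinity>"
  defines "A \<equiv> \<lambda>k. density_moment q (gibbs f) ((proximal_density \<eta> (gibbs f) ^^ k) h)"
  shows "A k < \<infinity>" "1 \<le> enn2real (A k)"
    and "enn2real (A k) powr (1/(q-1)) - 1 \<le> ((1 / (1 + \<alpha> * \<eta>)) powr (4/q)) ^ k * (enn2real (A 0) powr (1/(q-1)) - 1)"
proof -
  note gi = prob_space_gibbs sets_gibbs eta
  have gap: "heat_gap (\<alpha> * \<delta>) \<delta> (gibbs f)" if "\<delta> > 0" for \<delta>
    by (rule poincare_imp_heat_gap[OF prob_space_gibbs sets_gibbs P al that])
  define H where "H k = (proximal_density \<eta> (gibbs f) ^^ k) h" for k
  have H: "H k \<in> borel_measurable borel \<and> (\<integral>\<^sup>+x. H k x \<partial>gibbs f) = 1" for k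
    by (induction k) (simp_all add: H_def h one proximal_density_measurable[OF gi] proximal_density_mass[OF gi])
  define \<kappa> where "\<kappa> = (1 / (1 + \<alpha> * \<eta>)) powr (4/q)"
  have *: "A k < \<infinity> \<and> enn2real (A k) powr (1/(q-1)) - 1 \<le> \<kappa> ^ k * (enn2real (A 0) powr (1/(q-1)) - 1)" for k
  proof (induction k)
    case 0
    then show ?case using fin by (simp add: A_def)
  next
    case (Suc k)
    have "density_moment q (gibbs f) (H k) < \<infinity>" using Suc by (simp add: A_def H_def)
    note c = proximal_step_contraction[OF gi al gap q _ _ this]
    have "enn2real (A (Suc k)) powr (1/(q-1)) - 1 \<le> \<kappa> * (enn2real (A k) powr (1/(q-1)) - 1)"
      using c(2) H[of k] by (simp add: A_def H_def \<kappa>_def)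
    also have "\<dots> \<le> \<kappa> * (\<kappa> ^ k * (enn2real (A 0) powr (1/(q-1)) - 1))"
      using Suc by (intro mult_left_mono) (auto simp: \<kappa>_def)
    finally show ?case using c(1) H[of k] by (simp add: A_def H_def mult.assoc)
  qed
  show "A k < \<infinity>" using * by blast
  then show "1 \<le> enn2real (A k)"
    using proximal_step_contraction(3)[OF gi al gap q, of "H k"] H[of k] by (simp add: A_def H_def)
  show "enn2real (A k) powr (1/(q-1)) - 1 \<le> ((1 / (1 + \<alpha> * \<eta>)) powr (4/q)) ^ k * (enn2real (A 0) powr (1/(q-1)) - 1)"
    using * by (simp add: \<kappa>_def)
qed

end

section \<open>From the contraction to the Renyi bounds\<close>

text \<open>
  As long as \<open>R - x \<ge> 1\<close>, geometric decay of \<open>exp R - 1\<close> at rate \<open>2 x\<close> is more than linear decay of \<open>R\<close> at rate \<open>x\<close>: the claim reduces to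
  \<open>exp x + 1 \<le> exp R\<close>, and \<open>exp x + 1 \<le> 2 exp x \<le> exp (1 + x)\<close>.
\<close>

lemma renyi_linear_phase:
  fixes R R' x :: real
  assumes "0 \<le> x" "x \<le> R - 1" and le: "exp R' - 1 \<le> exp (- 2 * x) * (exp R - 1)"
  shows "R' \<le> R - x"
proof -
  have "exp x + 1 \<le> 2 * exp x" using assms(1) by simp
  also have "\<dots> \<le> exp 1 * exp x" using exp_ge_add_one_self[of "1::real"] by (intro mult_right_mono) auto
  also have "\<dots> \<le> exp R" using assms(2) by (simp flip: exp_add)
  finally have "(exp x - 1) * (exp x + 1) \<le> (exp x - 1) * exp R" using assms(1) by (intro mult_left_mono) auto
  then have a1: "exp (- 2 * x) * ((exp x - 1) * (exp x + 1)) \<le> exp (- 2 * x) * ((exp x - 1) * exp R)"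
    by (rule mult_left_mono) simp
  have a2: "exp (- 2 * x) * ((exp x - 1) * (exp x + 1)) = 1 - exp (- 2 * x)"
  proof -
    have "exp (- 2 * x) * (exp x * exp x) = 1" by (simp add: mult_exp_exp)
    then show ?thesis by (simp add: algebra_simps)
  qed
  have a3: "exp (- 2 * x) * ((exp x - 1) * exp R) = exp (R - x) - exp (- 2 * x) * exp R"
  proof -
    have "exp (- 2 * x) * (exp x * exp R) = exp (R - x)" by (simp add: mult_exp_exp)
    then show ?thesis by (simp add: algebra_simps)
  qed
  have "exp (- 2 * x) * (exp R - 1) = exp (- 2 * x) * exp R - exp (- 2 * x)" by (simp add: right_diff_distrib)
  then have "exp R' \<le> exp (R - x)" using a1 le unfolding a2 a3 by linarith
  then show ?thesis by simp
qed

text \<open>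
  As a function of \<open>w\<close> the difference of the two sides is concave on \<open>[0, 1]\<close> and vanishes at both ends.
\<close>

lemma exp_chord:
  fixes w r :: real
  assumes w: "0 \<le> w" "w \<le> 1" and r: "0 \<le> r" "r \<le> 1"
  shows "1 + w\<^sup>2 * (exp r - 1) \<le> exp (w * r)"
proof -
  define g where "g w = exp (w * r) - 1 - w\<^sup>2 * (exp r - 1)" for w
  have bound: "r\<^sup>2 * exp (w * r) \<le> 2 * (exp r - 1)" if "0 \<le> w" "w \<le> 1" for w
  proof -
    have wr: "w * r \<le> r" using that r mult_right_mono[of w 1 r] by simp
    have "1 \<le> (1 - r / 2) * (1 + r)" using r mult_left_mono[of r 1 r] by (simp add: algebra_simps)
    also have "\<dots> \<le> (1 - r / 2) * exp r" using r exp_ge_add_one_self[of r] by (intro mult_left_mono) auto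
    finally have "r * exp r \<le> 2 * (exp r - 1)" by (simp add: algebra_simps)
    moreover have "r\<^sup>2 * exp (w * r) \<le> r * exp r"
      using wr r by (intro mult_mono) (auto simp: power2_eq_square mult_left_le)
    ultimately show ?thesis by linarith
  qed
  have "concave_on {0..1} g"
  proof (rule f''_le0_imp_concave)
    show "DERIV g w :> r * exp (w * r) - 2 * w * (exp r - 1)" for w
      unfolding g_def[abs_def] by (auto intro!: derivative_eq_intros)
    show "DERIV (\<lambda>w. r * exp (w * r) - 2 * w * (exp r - 1)) w :> r\<^sup>2 * exp (w * r) - 2 * (exp r - 1)" for w
      by (auto intro!: derivative_eq_intros simp: power2_eq_square)
    show "r\<^sup>2 * exp (w * r) - 2 * (exp r - 1) \<le> 0" if "w \<in> {0..1}" for w using bound[of w] that by simp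
  qed simp
  then have "(1 - w) * g 0 + w * g 1 \<le> g ((1 - w) *\<^sub>R 0 + w *\<^sub>R 1)"
    using w by (intro concave_onD) auto
  then show ?thesis by (simp add: g_def)
qed

text \<open>
  If \<open>R \<le> 1\<close> then \<open>exp_chord\<close> gives \<open>R' \<le> exp (- x) R\<close>, and \<open>R \<le> exp (R - 1)\<close> covers negative \<open>x0\<close>. Otherwise \<open>x0\<close> is
  positive, and the time up to \<open>x0\<close> brings \<open>exp R - 1\<close> below \<open>exp 1 - 1\<close>, which is the previous case with \<open>R = 1\<close>.
\<close>

lemma renyi_exponential_phase:
  fixes R R' x x0 :: real
  assumes x: "0 \<le> x" "x0 \<le> x" and R: "0 \<le> R" "R - 1 \<le> x0" and le: "exp R' - 1 \<le> exp (- 2 * x) * (exp R - 1)"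
  shows "R' \<le> exp (- (x - x0))"
proof (cases "R \<le> 1")
  case True
  have e: "exp (- 2 * x) = (exp (- x))\<^sup>2" by (simp flip: exp_of_nat_mult)
  have "exp R' \<le> 1 + (exp (- x))\<^sup>2 * (exp R - 1)" using le unfolding e by linarith
  also have "\<dots> \<le> exp (exp (- x) * R)" using x R True by (intro exp_chord) auto
  finally have "R' \<le> exp (- x) * R" by simp
  also have "\<dots> \<le> exp (- x) * exp x0"
  proof (intro mult_left_mono)
    have "R \<le> exp (R - 1)" using exp_ge_add_one_self[of "R - 1"] by simp
    also have "\<dots> \<le> exp x0" using R by simp
    finally show "R \<le> exp x0" .
  qed simp
  finally show ?thesis by (simp flip: exp_add)
next
  case False
  then have x0: "0 < x0" using R by simp
  define v where "v = exp x0"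
  define E where "E = exp (1::real)"
  define w where "w = exp (- (x - x0))"
  have v: "1 \<le> v" using x0 by (simp add: v_def)
  have E: "2 \<le> E" using exp_ge_add_one_self[of "1::real"] by (simp add: E_def)
  have "1 \<le> (E - 1) * v" using v E mult_mono[of 1 "E - 1" 1 v] by simp
  then have "0 \<le> (v - 1) * ((E - 1) * v - 1)" using v by simp
  then have "E * v - 1 \<le> v\<^sup>2 * (E - 1)" by (simp add: power2_eq_square algebra_simps)
  moreover have "exp R \<le> E * v" using R by (simp add: E_def v_def flip: exp_add)
  ultimately have "exp (- 2 * x) * (exp R - 1) \<le> exp (- 2 * x) * (v\<^sup>2 * (E - 1))" by (intro mult_left_mono) auto
  also have "\<dots> = w\<^sup>2 * (E - 1)"
  proof -
    have "w = exp (- x) * v" by (simp add: w_def v_def flip: exp_add)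
    moreover have "exp (- 2 * x) = (exp (- x))\<^sup>2" by (simp flip: exp_of_nat_mult)
    ultimately show ?thesis by (simp add: power_mult_distrib)
  qed
  finally have "exp R' \<le> 1 + w\<^sup>2 * (exp 1 - 1)" using le by (simp add: E_def)
  also have "\<dots> \<le> exp (w * 1)" using x by (intro exp_chord) (auto simp: w_def)
  finally show ?thesis by (simp add: w_def)
qed

theorem theorem4:
  fixes f :: "'a::euclidean_space \<Rightarrow> real"
    and \<alpha> \<eta> :: real
    and \<rho>\<^sub>0 :: "'a measure"
    and k :: nat
  assumes "integrable lborel (\<lambda>x. exp (- f x))"
    and "integrable (gibbs f) (\<lambda>x. (norm x)\<^sup>2)"
    and "\<alpha> > 0"
    and "poincare \<alpha> (gibbs f)"
    and "\<eta> > 0"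
    and "prob_space \<rho>\<^sub>0"
    and "sets \<rho>\<^sub>0 = sets borel"
  shows "chi_squared (gibbs f) (proximal_sampler f \<eta> \<rho>\<^sub>0 k)
           \<le> chi_squared (gibbs f) \<rho>\<^sub>0 / ereal ((1 + \<alpha> * \<eta>) ^ (2 * k))
    \<and> (\<forall>q::real. q \<ge> 2 \<longrightarrow>
         (ereal (real k) \<le> ereal (q / (2 * ln (1 + \<alpha> * \<eta>))) * (renyi q (gibbs f) \<rho>\<^sub>0 - 1) \<longrightarrow>
            renyi q (gibbs f) (proximal_sampler f \<eta> \<rho>\<^sub>0 k)
              \<le> renyi q (gibbs f) \<rho>\<^sub>0 - ereal (2 * real k * ln (1 + \<alpha> * \<eta>) / q))
       \<and> (\<forall>r::real. renyi q (gibbs f) \<rho>\<^sub>0 = ereal r \<longrightarrow>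
            (let k\<^sub>0 = \<lceil>q / (2 * ln (1 + \<alpha> * \<eta>)) * (r - 1)\<rceil>
             in int k \<ge> k\<^sub>0 \<longrightarrow>
                  renyi q (gibbs f) (proximal_sampler f \<eta> \<rho>\<^sub>0 k)
                    \<le> ereal (1 / (1 + \<alpha> * \<eta>) powr (2 * (real k - real_of_int k\<^sub>0) / q)))))"
proof -
  note eta = assms(5) and al = assms(3) and P = assms(4)
  define L where "L = ln (1 + \<alpha> * \<eta>)"
  define \<pi> where "\<pi> = gibbs f"
  have s0: "\<alpha> * \<eta> > 0" using al eta by simp
  have L0: "L > 0" using s0 by (simp add: L_def)
  interpret pr: prob_space \<pi> unfolding \<pi>_def by (rule prob_space_gibbs[OF assms(1)])
  interpret p0: prob_space \<rho>\<^sub>0 by fact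
  have sp: "sets \<pi> = sets borel" unfolding \<pi>_def by (rule sets_gibbs[OF assms(1)])
  show ?thesis
  proof (cases "absolutely_continuous \<pi> \<rho>\<^sub>0")
    case False
    \<comment> \<open>Both divergences of the initial law are infinite, which makes every upper bound trivial.\<close>
    then have "chi_squared \<pi> \<rho>\<^sub>0 = \<infinity>" "renyi q \<pi> \<rho>\<^sub>0 = \<infinity>" for q by (simp_all add: chi_squared_def renyi_def)
    then show ?thesis using s0 unfolding \<pi>_def[symmetric] by simp
  next
    case True
    define h where "h = RN_deriv \<pi> \<rho>\<^sub>0"
    have h: "h \<in> borel_measurable borel" using borel_measurable_RN_deriv[of \<pi> \<rho>\<^sub>0] sp
      by (simp add: h_def cong: measurable_cong_sets)
    have rho: "\<rho>\<^sub>0 = density \<pi> h"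
      unfolding h_def by (rule pr.density_RN_deriv[OF True, symmetric]) (simp add: sp assms(7))
    have one: "(\<integral>\<^sup>+x. h x \<partial>\<pi>) = 1"
    proof -
      have "emeasure (density \<pi> h) (space (density \<pi> h)) = 1" using p0.emeasure_space_1 by (simp add: rho)
      moreover have "h \<in> borel_measurable \<pi>" using h sp by (simp cong: measurable_cong_sets)
      ultimately show ?thesis by (simp add: emeasure_density cong: nn_integral_cong)
    qed
    define H where "H k = (proximal_density \<eta> \<pi> ^^ k) h" for k
    define A where "A q k = density_moment q \<pi> (H k)" for q k
    have samp: "proximal_sampler f \<eta> \<rho>\<^sub>0 k = density \<pi> (H k)" "H k \<in> borel_measurable borel" for k
      using proximal_sampler_density[OF assms(1) eta h, of k] by (simp_all add: rho \<pi>_def H_def)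
    have rho0: "\<rho>\<^sub>0 = density \<pi> (H 0)" using samp(1)[of 0] by simp
    have chi: "chi_squared \<pi> (density \<pi> (H k)) = enn2ereal (A 2 k) - 1" for k
      using chi_squared_density[OF assms(1) samp(2)] by (simp add: A_def \<pi>_def)
    have ren: "renyi q \<pi> (density \<pi> (H k)) = ereal (1 / (q - 1) * ln (enn2real (A q k)))" if "A q k < \<infinity>" for q k
      using renyi_density[OF assms(1) samp(2)] that by (simp add: A_def \<pi>_def)
    have iter: "A q k < \<infinity>" "1 \<le> enn2real (A q k)"
        "enn2real (A q k) powr (1/(q-1)) - 1 \<le> ((1 / (1 + \<alpha> * \<eta>)) powr (4/q)) ^ k * (enn2real (A q 0) powr (1/(q-1)) - 1)"
      if "2 \<le> q" "A q 0 < \<infinity>" for q k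
      using density_moment_iterate[OF assms(1) eta al P that(1) h one[unfolded \<pi>_def]] that(2)
      by (simp_all add: A_def H_def \<pi>_def)
    have "chi_squared \<pi> (density \<pi> (H k)) \<le> chi_squared \<pi> (density \<pi> (H 0)) / ereal ((1 + \<alpha> * \<eta>) ^ (2 * k))"
    proof (cases "A 2 0 < \<infinity>")
      case False
      then have "A 2 0 = \<infinity>" by (auto simp: less_top[symmetric])
      then show ?thesis using s0 by (simp add: chi)
    next
      case fin: True
      define a where "a k = enn2real (A 2 k)" for k
      have e: "enn2ereal (A 2 k) = ereal (a k)" for k
      proof -
        have "A 2 k = ennreal (a k)" using iter(1)[OF _ fin, of k] by (simp add: a_def)
        moreover have "0 \<le> a k" by (simp add: a_def)
        ultimately show ?thesis by (metis enn2ereal_ennreal)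
      qed
      have "((1 / (1 + \<alpha> * \<eta>)) powr (4/2)) ^ k = 1 / (1 + \<alpha> * \<eta>) ^ (2 * k)"
        using s0 by (simp add: power_mult power_divide)
      then have "a k - 1 \<le> (a 0 - 1) / (1 + \<alpha> * \<eta>) ^ (2 * k)"
        using iter(3)[OF _ fin, of k] by (simp add: a_def)
      then show ?thesis using s0 by (simp add: chi e one_ereal_def)
    qed
    moreover have phase: "\<exists>R R'. renyi q \<pi> (density \<pi> (H 0)) = ereal R \<and> renyi q \<pi> (density \<pi> (H k)) = ereal R'
        \<and> 0 \<le> R \<and> exp R' - 1 \<le> exp (- 2 * (2 * real k * L / q)) * (exp R - 1)"
      if q: "2 \<le> q" and fin: "A q 0 < \<infinity>" for q
    proof -
      define R where "R k = 1 / (q - 1) * ln (enn2real (A q k))" for k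
      have E: "exp (R k) = enn2real (A q k) powr (1/(q-1))" for k
        using iter(2)[OF q fin, of k] by (simp add: R_def powr_def)
      have "((1 / (1 + \<alpha> * \<eta>)) powr (4/q)) ^ k = exp (- 2 * (2 * real k * L / q))"
        using s0 by (simp add: powr_def L_def ln_div exp_of_nat_mult[symmetric] algebra_simps)
      then have "exp (R k) - 1 \<le> exp (- 2 * (2 * real k * L / q)) * (exp (R 0) - 1)"
        using iter(3)[OF q fin, of k] by (simp only: E)
      moreover have "0 \<le> R 0" using iter(2)[OF q fin, of 0] q by (simp add: R_def)
      moreover have "renyi q \<pi> (density \<pi> (H j)) = ereal (R j)" for j
        unfolding R_def by (rule ren[OF iter(1)[OF q fin]])
      ultimately show ?thesis by blast
    qed
    have inf: "renyi q \<pi> (density \<pi> (H 0)) = \<infinity>" if "\<not> A q 0 < \<infinity>" for q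
    proof -
      have "renyi_integral q \<pi> (density \<pi> (H 0)) = \<infinity>"
        using that renyi_integral_density[OF assms(1) samp(2)] by (auto simp: A_def \<pi>_def less_top[symmetric])
      then show ?thesis by (simp add: renyi_def)
    qed
    have "renyi q \<pi> (density \<pi> (H k)) \<le> renyi q \<pi> (density \<pi> (H 0)) - ereal (2 * real k * ln (1 + \<alpha> * \<eta>) / q)"
      if q: "2 \<le> q" and kle: "ereal (real k) \<le> ereal (q / (2 * ln (1 + \<alpha> * \<eta>))) * (renyi q \<pi> (density \<pi> (H 0)) - 1)" for q
    proof (cases "A q 0 < \<infinity>")
      case False
      then show ?thesis by (simp add: inf)
    next
      case True
      obtain R R' where R: "renyi q \<pi> (density \<pi> (H 0)) = ereal R" "renyi q \<pi> (density \<pi> (H k)) = ereal R'"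
        "exp R' - 1 \<le> exp (- 2 * (2 * real k * L / q)) * (exp R - 1)" using phase[OF q True] by blast
      have "real k \<le> q / (2 * L) * (R - 1)" using kle by (simp add: R(1) L_def one_ereal_def)
      then have "2 * real k * L / q \<le> R - 1" using q L0 by (simp add: field_simps)
      from renyi_linear_phase[OF _ this R(3)] have "R' \<le> R - 2 * real k * L / q" using q L0 by simp
      then show ?thesis by (simp add: R L_def)
    qed
    moreover have "renyi q \<pi> (density \<pi> (H k)) \<le> ereal (1 / (1 + \<alpha> * \<eta>) powr (2 * (real k - real_of_int \<lceil>q / (2 * ln (1 + \<alpha> * \<eta>)) * (r - 1)\<rceil>) / q))"
      if q: "2 \<le> q" and r: "renyi q \<pi> (density \<pi> (H 0)) = ereal r" and k: "\<lceil>q / (2 * ln (1 + \<alpha> * \<eta>)) * (r - 1)\<rceil> \<le> int k" for q r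
    proof -
      have "A q 0 < \<infinity>" using inf[of q] r by auto
      from phase[OF q this] obtain R' where R: "renyi q \<pi> (density \<pi> (H k)) = ereal R'" "0 \<le> r"
        "exp R' - 1 \<le> exp (- 2 * (2 * real k * L / q)) * (exp r - 1)" using r by auto
      define k0 where "k0 = \<lceil>q / (2 * L) * (r - 1)\<rceil>"
      have "q / (2 * L) * (r - 1) \<le> real_of_int k0" unfolding k0_def by simp
      then have x0: "r - 1 \<le> 2 * real_of_int k0 * L / q" using q L0 by (simp add: field_simps)
      have "real_of_int k0 \<le> real k" using k by (simp add: k0_def L_def)
      then have "2 * real_of_int k0 * L / q \<le> 2 * real k * L / q"
        using q L0 by (intro divide_right_mono mult_right_mono) auto
      from renyi_exponential_phase[OF _ this R(2) x0 R(3)]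
      have "R' \<le> exp (- (2 * real k * L / q - 2 * real_of_int k0 * L / q))" using q L0 by simp
      also have "\<dots> = 1 / (1 + \<alpha> * \<eta>) powr (2 * (real k - real_of_int k0) / q)"
      proof -
        have "2 * real k * L / q - 2 * real_of_int k0 * L / q = (2 * (real k - real_of_int k0) / q) * L"
          by (simp add: diff_divide_distrib algebra_simps)
        then show ?thesis using s0 by (simp only: exp_minus) (simp add: powr_def L_def inverse_eq_divide)
      qed
      finally show ?thesis by (simp add: R k0_def L_def)
    qed
    ultimately show ?thesis unfolding \<pi>_def[symmetric] samp(1) unfolding rho0 Let_def by blast
  qed
qed

end
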